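(* Fix $r\ge1$. For every nonzero compact operator $K$ on a separable Hilbert space $H$, there is a block-lower-triangular operator model of a nonzero depth-$r$ primitive word whose only nonzero endpoint block is unitarily equivalent to $K$. More explicitly, let $\mathcal H=H_0\oplus\cdots\oplus H_r$ with $H_j\cong H$. One can choose operators $X_1,\dots,X_r$ on $\mathcal H$, where $X_j$ has as its only nonzero block a compact adjacent block $H_{j-1}\to H_j$, such that, with $W_1=X_1$ and $W_j=[X_j,W_{j-1}]$ for $2\le j\le r$, the operator $W_r$ has only its $(r,0)$ block ($H_0\to H_r$) nonzero, this block is unitarily equivalent to $K$, and $W_r$ realizes (i.e. is the image under the Lie homomorphism $\mathsf q_j\mapsto X_j$ of) the nonzero free Lie word $$\operatorname{ad}_{\mathsf q_r}\operatorname{ad}_{\mathsf q_{r-1}}\cdots\operatorname{ad}_{\mathsf q_2}(\mathsf q_1)\in\mathfrak L_r(Q^\sharp).$$ In particular $s_j(W_r)=s_j(K)$ for all $j\ge1$; consequently primitive depth alone forces no Schatten membership, decay law, regular variation, Mellin order, or Fredholm growth. Moreover $W_r^2=0$. If $K\in\mathcal S_1$, then $$\det(I+zW_r)=1,\qquad \tfrac12\log\det(I+z^2W_r^*W_r)=\tfrac12\log\det(I+z^2K^*K).$$ More generally, if $D=\operatorname{diag}(D_0,\dots,D_r)$ and $R_\triangle$ are trace-class operators on $\mathcal H$ with $D$ block diagonal and $R_\triangle$ strictly block triangular, then $$\det(I+z(D+R_\triangle))=\prod_{j=0}^r\det(I+zD_j).$$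
   Context: $\mathfrak L_r(W)$ is the bracket-length-$r$ part of the free Lie algebra $\mathfrak L(W)$ on a vector space $W$; here $Q^\sharp$ is the vector space with basis the free generators $\mathsf q_1,\dots,\mathsf q_r$. $s_j(T)$ are the singular values of a compact operator, nonincreasing with multiplicity; $\mathcal S_1$ is the trace class; $\det$ is the Fredholm determinant. "Mellin order" refers to the growth of $\operatorname{Tr}|T|^{s}$ as $s$ decreases to the abscissa of convergence and "Fredholm growth" to the growth of $\frac12\log\det(I+a^2T^*T)$ as $a\to\infty$. *)

theory Defs
  imports
    "HOL-Analysis.Analysis"
    "HOL-Combinatorics.Permutations"
    "HOL-Library.Landau_Symbols"
begin

section \<open>Complex Hilbert spaces\<close>

class scaleC =
  fixes scaleC :: "complex \<Rightarrow> 'a \<Rightarrow> 'a"  (infixr \<open>*\<^sub>C\<close> 75)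

class complex_vector = scaleC + ab_group_add +
  assumes scaleC_add_right: "a *\<^sub>C (x + y) = a *\<^sub>C x + a *\<^sub>C y"
    and scaleC_add_left: "(a + b) *\<^sub>C x = a *\<^sub>C x + b *\<^sub>C x"
    and scaleC_scaleC: "a *\<^sub>C b *\<^sub>C x = (a * b) *\<^sub>C x"
    and scaleC_one: "1 *\<^sub>C x = x"

global_interpretation complex_vector:
  vector_space "scaleC :: complex \<Rightarrow> 'a \<Rightarrow> 'a::complex_vector"
  by unfold_locales (rule scaleC_add_right scaleC_add_left scaleC_scaleC scaleC_one)+

text \<open>The complex inner product is antilinear in its first argument; its real part is the
  inner product of the underlying real space, so norm and topology are those of
  \<^class>\<open>real_inner\<close>.\<close>

class complex_inner = complex_vector + real_inner +
  fixes cinner :: "'a \<Rightarrow> 'a \<Rightarrow> complex"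
  assumes scaleR_scaleC: "r *\<^sub>R x = complex_of_real r *\<^sub>C x"
    and inner_eq_Re_cinner: "inner x y = Re (cinner x y)"
    and cinner_commute: "cinner x y = cnj (cinner y x)"
    and cinner_add_right: "cinner x (y + z) = cinner x y + cinner x z"
    and cinner_scaleC_right: "cinner x (c *\<^sub>C y) = c * cinner x y"

class chilbert_space = complex_inner + complete_space

lemma scaleC_minus1: "(- 1) *\<^sub>C x = - (x::'a::complex_vector)"
  by (metis complex_vector.scale_minus_left scaleC_one)

lemma cinner_self: "cinner x x = complex_of_real ((norm (x::'a::complex_inner))\<^sup>2)"
proof -
  have "Im (cinner x x) = 0"
    by (metis cinner_commute cnj.simps(2) neg_equal_zero)
  moreover have "Re (cinner x x) = (norm x)\<^sup>2"
    by (metis inner_eq_Re_cinner power2_norm_eq_inner)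
  ultimately show ?thesis
    by (simp add: complex_eq_iff)
qed

lemma norm_scaleC: "norm (c *\<^sub>C x) = cmod c * norm (x::'a::complex_inner)"
proof -
  have "cinner (c *\<^sub>C x) (c *\<^sub>C x) = c * cnj c * cinner x x"
    by (metis (no_types, lifting) cinner_commute cinner_scaleC_right complex_cnj_mult
        mult.assoc)
  then have "complex_of_real ((norm (c *\<^sub>C x))\<^sup>2)
      = complex_of_real ((cmod c * norm x)\<^sup>2)"
    by (simp add: cinner_self power_mult_distrib flip: complex_norm_square)
  then have "(norm (c *\<^sub>C x))\<^sup>2 = (cmod c * norm x)\<^sup>2"
    using of_real_eq_iff by blast
  then show ?thesis
    by (metis norm_ge_zero power2_eq_iff_nonneg zero_le_mult_iff)
qed

instantiation vec :: (complex_inner, finite) complex_inner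
begin

definition scaleC_vec :: "complex \<Rightarrow> 'a ^ 'b \<Rightarrow> 'a ^ 'b"
  where "c *\<^sub>C x = (\<chi> i. c *\<^sub>C (x $ i))"

definition cinner_vec :: "'a ^ 'b \<Rightarrow> 'a ^ 'b \<Rightarrow> complex"
  where "cinner x y = (\<Sum>i\<in>UNIV. cinner (x $ i) (y $ i))"

instance
proof
  show "cinner x y = cnj (cinner y x)" for x y :: "'a ^ 'b"
    unfolding cinner_vec_def cnj_sum by (intro sum.cong refl cinner_commute)
qed (simp_all add: scaleC_vec_def cinner_vec_def vec_eq_iff scaleC_add_right
      scaleC_add_left scaleC_scaleC scaleC_one scaleR_scaleC inner_vec_def
      inner_eq_Re_cinner cinner_add_right cinner_scaleC_right sum.distrib sum_distrib_left)

end

instance vec :: (chilbert_space, finite) chilbert_space ..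


section \<open>Bounded complex-linear operators\<close>

typedef (overloaded) ('a, 'b) cblinfun (\<open>(_ \<Rightarrow>\<^sub>C\<^sub>L /_)\<close> [22, 21] 21) =
  "{f::'a::complex_inner \<Rightarrow> 'b::complex_inner.
      bounded_linear f \<and> (\<forall>c x. f (c *\<^sub>C x) = c *\<^sub>C f x)}"
  morphisms cblinfun_apply Cblinfun
  by (intro exI[of _ "\<lambda>_. 0"]) auto

notation cblinfun_apply (infixr \<open>*\<^sub>V\<close> 70)

setup_lifting type_definition_cblinfun

instantiation cblinfun :: (complex_inner, complex_inner) complex_vector
begin

lift_definition zero_cblinfun :: "'a \<Rightarrow>\<^sub>C\<^sub>L 'b" is "\<lambda>_. 0"
  by simp
lift_definition plus_cblinfun :: "('a \<Rightarrow>\<^sub>C\<^sub>L 'b) \<Rightarrow> ('a \<Rightarrow>\<^sub>C\<^sub>L 'b) \<Rightarrow> ('a \<Rightarrow>\<^sub>C\<^sub>L 'b)"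
  is "\<lambda>f g x. f x + g x"
  by (auto intro: bounded_linear_add simp: scaleC_add_right)
lift_definition uminus_cblinfun :: "('a \<Rightarrow>\<^sub>C\<^sub>L 'b) \<Rightarrow> ('a \<Rightarrow>\<^sub>C\<^sub>L 'b)"
  is "\<lambda>f x. - f x"
  by (auto intro: bounded_linear_minus)
lift_definition minus_cblinfun :: "('a \<Rightarrow>\<^sub>C\<^sub>L 'b) \<Rightarrow> ('a \<Rightarrow>\<^sub>C\<^sub>L 'b) \<Rightarrow> ('a \<Rightarrow>\<^sub>C\<^sub>L 'b)"
  is "\<lambda>f g x. f x - g x"
  by (auto intro: bounded_linear_sub simp: complex_vector.scale_right_diff_distrib)
lift_definition scaleC_cblinfun :: "complex \<Rightarrow> ('a \<Rightarrow>\<^sub>C\<^sub>L 'b) \<Rightarrow> ('a \<Rightarrow>\<^sub>C\<^sub>L 'b)"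
  is "\<lambda>c f x. c *\<^sub>C f x"
proof -
  fix c and f :: "'a \<Rightarrow> 'b"
  assume f: "bounded_linear f \<and> (\<forall>c x. f (c *\<^sub>C x) = c *\<^sub>C f x)"
  have "bounded_linear (\<lambda>x::'b. c *\<^sub>C x)"
    by (rule bounded_linear_intro[where K = "cmod c"])
      (simp_all add: scaleC_add_right scaleR_scaleC scaleC_scaleC norm_scaleC mult.commute)
  with f show "bounded_linear (\<lambda>x. c *\<^sub>C f x) \<and> (\<forall>d x. c *\<^sub>C f (d *\<^sub>C x) = d *\<^sub>C c *\<^sub>C f x)"
    by (auto intro: bounded_linear_compose simp: scaleC_scaleC mult.commute)
qed

instance
  by standard
    (transfer; simp add: fun_eq_iff scaleC_add_right scaleC_add_left scaleC_scaleC scaleC_one)+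

end

lift_definition cblinfun_compose ::
  "('b::complex_inner \<Rightarrow>\<^sub>C\<^sub>L 'c::complex_inner) \<Rightarrow> ('a::complex_inner \<Rightarrow>\<^sub>C\<^sub>L 'b) \<Rightarrow> ('a \<Rightarrow>\<^sub>C\<^sub>L 'c)"
  (infixl \<open>o\<^sub>C\<^sub>L\<close> 67) is "\<lambda>f g x. f (g x)"
  by (auto intro: bounded_linear_compose)

lift_definition id_cblinfun :: "'a::complex_inner \<Rightarrow>\<^sub>C\<^sub>L 'a" is "\<lambda>x. x"
  by simp

definition adj :: "('a::complex_inner \<Rightarrow>\<^sub>C\<^sub>L 'b::complex_inner) \<Rightarrow> ('b \<Rightarrow>\<^sub>C\<^sub>L 'a)"
  where "adj T = (THE S. \<forall>x y. cinner (T *\<^sub>V x) y = cinner x (S *\<^sub>V y))"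

definition commutator ::
  "('a::complex_inner \<Rightarrow>\<^sub>C\<^sub>L 'a) \<Rightarrow> ('a \<Rightarrow>\<^sub>C\<^sub>L 'a) \<Rightarrow> ('a \<Rightarrow>\<^sub>C\<^sub>L 'a)"
  where "commutator X Y = X o\<^sub>C\<^sub>L Y - Y o\<^sub>C\<^sub>L X"

definition compact_op :: "('a::complex_inner \<Rightarrow>\<^sub>C\<^sub>L 'b::complex_inner) \<Rightarrow> bool"
  where "compact_op T \<longleftrightarrow> compact (closure (cblinfun_apply T ` cball 0 1))"

definition unitary :: "('a::complex_inner \<Rightarrow>\<^sub>C\<^sub>L 'b::complex_inner) \<Rightarrow> bool"
  where "unitary U \<longleftrightarrow> adj U o\<^sub>C\<^sub>L U = id_cblinfun \<and> U o\<^sub>C\<^sub>L adj U = id_cblinfun"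

definition unitarily_equiv ::
  "('a::complex_inner \<Rightarrow>\<^sub>C\<^sub>L 'a) \<Rightarrow> ('b::complex_inner \<Rightarrow>\<^sub>C\<^sub>L 'b) \<Rightarrow> bool"
  where "unitarily_equiv S T \<longleftrightarrow> (\<exists>U. unitary U \<and> S = U o\<^sub>C\<^sub>L T o\<^sub>C\<^sub>L adj U)"


section \<open>Singular values, Schatten classes, Fredholm determinant\<close>

definition sv_space :: "('a::complex_inner \<Rightarrow>\<^sub>C\<^sub>L 'b::complex_inner) \<Rightarrow> real \<Rightarrow> 'a set"
  where "sv_space T t = {x. (adj T o\<^sub>C\<^sub>L T) *\<^sub>V x = complex_of_real (t\<^sup>2) *\<^sub>C x}"

text \<open>The number of singular values \<open>\<ge> t\<close>, counted with multiplicity. For compact \<open>T\<close> and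
  \<open>t > 0\<close> the index set and all the dimensions are finite.\<close>

definition sv_count :: "('a::complex_inner \<Rightarrow>\<^sub>C\<^sub>L 'b::complex_inner) \<Rightarrow> real \<Rightarrow> nat"
  where "sv_count T t = (\<Sum>s | t \<le> s \<and> sv_space T s \<noteq> {0}. complex_vector.dim (sv_space T s))"

text \<open>The \<open>j\<close>-th singular value, \<open>j \<ge> 1\<close>, of a compact operator: singular values are listed in
  nonincreasing order with multiplicity, and the list is continued by zeros if it is finite.\<close>

definition singular_value :: "('a::complex_inner \<Rightarrow>\<^sub>C\<^sub>L 'b::complex_inner) \<Rightarrow> nat \<Rightarrow> real"
  where "singular_value T j = Sup (insert 0 {t. 0 < t \<and> j \<le> sv_count T t})"

definition schatten :: "real \<Rightarrow> ('a::complex_inner \<Rightarrow>\<^sub>C\<^sub>L 'b::complex_inner) \<Rightarrow> bool"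
  where "schatten p T \<longleftrightarrow> compact_op T \<and> summable (\<lambda>j. singular_value T (Suc j) powr p)"

abbreviation trace_class :: "('a::complex_inner \<Rightarrow>\<^sub>C\<^sub>L 'b::complex_inner) \<Rightarrow> bool"
  where "trace_class T \<equiv> schatten 1 T"

definition is_onb :: "'a::complex_inner set \<Rightarrow> bool"
  where "is_onb B \<longleftrightarrow> (\<forall>e\<in>B. \<forall>f\<in>B. cinner e f = (if e = f then 1 else 0))
    \<and> closure (complex_vector.span B) = UNIV"

text \<open>The Leibniz determinant of the matrix \<open>\<langle>e, T f\<rangle>\<close>, \<open>e, f \<in> S\<close>.\<close>

definition principal_minor :: "('a::complex_inner \<Rightarrow>\<^sub>C\<^sub>L 'a) \<Rightarrow> 'a set \<Rightarrow> complex"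
  where "principal_minor T S =
    (\<Sum>p | p permutes S. of_int (sign p) * (\<Prod>e\<in>S. cinner e (T *\<^sub>V p e)))"

text \<open>\<open>fredholm_det T\<close> is \<open>det(I + T)\<close> for trace-class \<open>T\<close>, given by Fredholm's expansion
  \<open>\<Sum>\<^sub>n Tr (\<Lambda>\<^sup>n T)\<close>: in an orthonormal basis, \<open>Tr (\<Lambda>\<^sup>n T)\<close> is the sum of the \<open>n \<times> n\<close> principal
  minors. The value is required to be the same in every orthonormal basis.\<close>

definition fredholm_det :: "('a::complex_inner \<Rightarrow>\<^sub>C\<^sub>L 'a) \<Rightarrow> complex"
  where "fredholm_det T =
    (THE d. \<forall>B. is_onb B \<longrightarrow> (principal_minor T has_sum d) {S. finite S \<and> S \<subseteq> B})"


section \<open>Asymptotic quantities attached to a compact operator\<close>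

text \<open>\<open>Tr |T|\<^sup>s\<close>\<close>

definition mellin_trace :: "('a::complex_inner \<Rightarrow>\<^sub>C\<^sub>L 'b::complex_inner) \<Rightarrow> real \<Rightarrow> real"
  where "mellin_trace T s = (\<Sum>j. singular_value T (Suc j) powr s)"

definition mellin_abscissa :: "('a::complex_inner \<Rightarrow>\<^sub>C\<^sub>L 'b::complex_inner) \<Rightarrow> ereal"
  where "mellin_abscissa T = (INF s\<in>{s. 0 < s \<and> schatten s T}. ereal s)"

definition fredholm_growth :: "('a::complex_inner \<Rightarrow>\<^sub>C\<^sub>L 'b::complex_inner) \<Rightarrow> real \<Rightarrow> real"
  where "fredholm_growth T a =
    1 / 2 * ln (Re (fredholm_det (complex_of_real (a\<^sup>2) *\<^sub>C (adj T o\<^sub>C\<^sub>L T))))"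

definition regularly_varying :: "(nat \<Rightarrow> real) \<Rightarrow> bool"
  where "regularly_varying s \<longleftrightarrow>
    (\<exists>\<rho>. \<forall>c>0. (\<lambda>n. s (nat \<lfloor>c * real n\<rfloor>) / s n) \<longlonglongrightarrow> c powr \<rho>)"


section \<open>The free Lie algebra\<close>

datatype 'q lie_term =
    LZero
  | LGen 'q
  | LAdd "'q lie_term" "'q lie_term"
  | LScale complex "'q lie_term"
  | LBracket "'q lie_term" "'q lie_term"

inductive lie_eq :: "'q lie_term \<Rightarrow> 'q lie_term \<Rightarrow> bool" where
  refl: "lie_eq x x"
| sym: "lie_eq x y \<Longrightarrow> lie_eq y x"
| trans: "lie_eq x y \<Longrightarrow> lie_eq y z \<Longrightarrow> lie_eq x z"
| cong_add: "lie_eq x x' \<Longrightarrow> lie_eq y y' \<Longrightarrow> lie_eq (LAdd x y) (LAdd x' y')"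
| cong_scale: "lie_eq x x' \<Longrightarrow> lie_eq (LScale c x) (LScale c x')"
| cong_bracket: "lie_eq x x' \<Longrightarrow> lie_eq y y' \<Longrightarrow> lie_eq (LBracket x y) (LBracket x' y')"
| add_assoc: "lie_eq (LAdd (LAdd x y) z) (LAdd x (LAdd y z))"
| add_commute: "lie_eq (LAdd x y) (LAdd y x)"
| add_zero: "lie_eq (LAdd LZero x) x"
| add_neg: "lie_eq (LAdd (LScale (- 1) x) x) LZero"
| scale_add_right: "lie_eq (LScale c (LAdd x y)) (LAdd (LScale c x) (LScale c y))"
| scale_add_left: "lie_eq (LScale (c + d) x) (LAdd (LScale c x) (LScale d x))"
| scale_scale: "lie_eq (LScale c (LScale d x)) (LScale (c * d) x)"
| scale_one: "lie_eq (LScale 1 x) x"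
| bracket_add_left: "lie_eq (LBracket (LAdd x y) z) (LAdd (LBracket x z) (LBracket y z))"
| bracket_add_right: "lie_eq (LBracket x (LAdd y z)) (LAdd (LBracket x y) (LBracket x z))"
| bracket_scale_left: "lie_eq (LBracket (LScale c x) y) (LScale c (LBracket x y))"
| bracket_scale_right: "lie_eq (LBracket x (LScale c y)) (LScale c (LBracket x y))"
| bracket_self: "lie_eq (LBracket x x) LZero"
| jacobi: "lie_eq (LAdd (LBracket x (LBracket y z))
      (LAdd (LBracket y (LBracket z x)) (LBracket z (LBracket x y)))) LZero"

text \<open>The free complex Lie algebra on the vector space with basis \<^typ>\<open>'q\<close>, as the quotient of
  the Lie terms by the congruence generated by the Lie algebra axioms.\<close>

quotient_type 'q free_lie = "'q lie_term" / lie_eq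
  by (intro equivpI reflpI sympI transpI) (auto intro: lie_eq.intros)

lift_definition lie_gen :: "'q \<Rightarrow> 'q free_lie" is LGen .

lift_definition lie_bracket :: "'q free_lie \<Rightarrow> 'q free_lie \<Rightarrow> 'q free_lie" is LBracket
  by (rule lie_eq.cong_bracket)

instantiation free_lie :: (type) complex_vector
begin

lift_definition zero_free_lie :: "'a free_lie" is LZero .
lift_definition plus_free_lie :: "'a free_lie \<Rightarrow> 'a free_lie \<Rightarrow> 'a free_lie" is LAdd
  by (rule lie_eq.cong_add)
lift_definition scaleC_free_lie :: "complex \<Rightarrow> 'a free_lie \<Rightarrow> 'a free_lie" is LScale
  by (rule lie_eq.cong_scale)
lift_definition uminus_free_lie :: "'a free_lie \<Rightarrow> 'a free_lie" is "LScale (- 1)"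
  by (rule lie_eq.cong_scale)
lift_definition minus_free_lie :: "'a free_lie \<Rightarrow> 'a free_lie \<Rightarrow> 'a free_lie"
  is "\<lambda>x y. LAdd x (LScale (- 1) y)"
  by (intro lie_eq.cong_add lie_eq.cong_scale)

instance
proof
  fix a b :: complex and x y z :: "'a free_lie"
  show "x + y + z = x + (y + z)" by transfer (rule lie_eq.add_assoc)
  show "x + y = y + x" by transfer (rule lie_eq.add_commute)
  show "0 + x = x" by transfer (rule lie_eq.add_zero)
  show "- x + x = 0" by transfer (rule lie_eq.add_neg)
  show "x - y = x + - y" by transfer (rule lie_eq.refl)
  show "a *\<^sub>C (x + y) = a *\<^sub>C x + a *\<^sub>C y" by transfer (rule lie_eq.scale_add_right)
  show "(a + b) *\<^sub>C x = a *\<^sub>C x + b *\<^sub>C x" by transfer (rule lie_eq.scale_add_left)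
  show "a *\<^sub>C b *\<^sub>C x = (a * b) *\<^sub>C x" by transfer (rule lie_eq.scale_scale)
  show "1 *\<^sub>C x = x" by transfer (rule lie_eq.scale_one)
qed

end

inductive lie_homogeneous :: "'q set \<Rightarrow> nat \<Rightarrow> 'q free_lie \<Rightarrow> bool" for G :: "'q set" where
  gen: "q \<in> G \<Longrightarrow> lie_homogeneous G 1 (lie_gen q)"
| bracket: "lie_homogeneous G m x \<Longrightarrow> lie_homogeneous G n y \<Longrightarrow>
    lie_homogeneous G (m + n) (lie_bracket x y)"
| zero: "lie_homogeneous G n 0"
| add: "lie_homogeneous G n x \<Longrightarrow> lie_homogeneous G n y \<Longrightarrow> lie_homogeneous G n (x + y)"
| scale: "lie_homogeneous G n x \<Longrightarrow> lie_homogeneous G n (c *\<^sub>C x)"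

text \<open>The bracket-length-\<open>n\<close> part of the free Lie algebra on the generators in \<open>G\<close>, viewed
  inside the free Lie algebra on all of \<^typ>\<open>'q\<close>.\<close>

definition lie_part :: "'q set \<Rightarrow> nat \<Rightarrow> 'q free_lie set"
  where "lie_part G n = {x. lie_homogeneous G n x}"

definition lie_hom :: "('q free_lie \<Rightarrow> ('a::complex_inner \<Rightarrow>\<^sub>C\<^sub>L 'a)) \<Rightarrow> bool"
  where "lie_hom \<phi> \<longleftrightarrow> (\<forall>x y. \<phi> (x + y) = \<phi> x + \<phi> y) \<and> (\<forall>c x. \<phi> (c *\<^sub>C x) = c *\<^sub>C \<phi> x)
    \<and> (\<forall>x y. \<phi> (lie_bracket x y) = commutator (\<phi> x) (\<phi> y))"

text \<open>\<open>ad\<^bsub>q\<^sub>r\<^esub> \<dots> ad\<^bsub>q\<^sub>2\<^esub> q\<^sub>1\<close>\<close>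

definition depth_word :: "nat \<Rightarrow> nat free_lie"
  where "depth_word r = fold (\<lambda>j. lie_bracket (lie_gen j)) [2..<Suc r] (lie_gen 1)"


section \<open>Block operators on a finite direct sum of copies of a Hilbert space\<close>

type_synonym ('h, 'n) block_op = "('h ^ 'n) \<Rightarrow>\<^sub>C\<^sub>L ('h ^ 'n)"

text \<open>The block of \<open>T\<close> mapping the \<open>k\<close>-th summand to the \<open>i\<close>-th one.\<close>

lift_definition block ::
  "('h::complex_inner, 'n) block_op \<Rightarrow> 'n::finite \<Rightarrow> 'n \<Rightarrow> ('h \<Rightarrow>\<^sub>C\<^sub>L 'h)"
  is "\<lambda>T i k x. T (axis k x) $ i"
proof -
  fix T :: "'h ^ 'n \<Rightarrow> 'h ^ 'n" and i k
  assume T: "bounded_linear T \<and> (\<forall>c x. T (c *\<^sub>C x) = c *\<^sub>C T x)"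
  have norm: "norm (axis k x :: 'h ^ 'n) = norm x" for x
    unfolding norm_eq_sqrt_inner inner_axis_axis by simp
  have "bounded_linear (axis k :: 'h \<Rightarrow> 'h ^ 'n)"
  proof (rule bounded_linear_intro[where K = 1])
    show "axis k (x + y) = axis k x + (axis k y :: 'h ^ 'n)" for x y
      by (simp add: vec_eq_iff axis_def)
    show "axis k (c *\<^sub>R x) = c *\<^sub>R (axis k x :: 'h ^ 'n)" for c x
      by (simp add: vec_eq_iff axis_def)
    show "norm (axis k x :: 'h ^ 'n) \<le> norm x * 1" for x
      by (simp add: norm)
  qed
  from bounded_linear_compose[OF _ this] T have "bounded_linear (\<lambda>x. T (axis k x))"
    by blast
  then have "bounded_linear (\<lambda>x. T (axis k x) $ i)"
    by (rule bounded_linear_compose[OF bounded_linear_vec_nth])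
  moreover have "axis k (c *\<^sub>C x) = c *\<^sub>C (axis k x :: 'h ^ 'n)" for c x
    by (simp add: vec_eq_iff axis_def scaleC_vec_def)
  ultimately show "bounded_linear (\<lambda>x. T (axis k x) $ i)
      \<and> (\<forall>c x. T (axis k (c *\<^sub>C x)) $ i = c *\<^sub>C (T (axis k x) $ i))"
    using T by (simp add: scaleC_vec_def)
qed

definition only_nonzero_block ::
  "('h::complex_inner, 'n::finite) block_op \<Rightarrow> 'n \<Rightarrow> 'n \<Rightarrow> bool"
  where "only_nonzero_block T i k \<longleftrightarrow>
    block T i k \<noteq> 0 \<and> (\<forall>i' k'. (i', k') \<noteq> (i, k) \<longrightarrow> block T i' k' = 0)"

text \<open>In the following, \<open>idx\<close> enumerates the \<open>r + 1\<close> summands as \<open>H\<^sub>0, \<dots>, H\<^sub>r\<close>.\<close>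

definition depth_model ::
  "(nat \<Rightarrow> 'n::finite) \<Rightarrow> nat \<Rightarrow> (nat \<Rightarrow> ('h::complex_inner, 'n) block_op) \<Rightarrow>
    (nat \<Rightarrow> ('h, 'n) block_op) \<Rightarrow> bool"
  where "depth_model idx r X W \<longleftrightarrow>
    (\<forall>j\<in>{1..r}. only_nonzero_block (X j) (idx j) (idx (j - 1)) \<and>
        compact_op (block (X j) (idx j) (idx (j - 1)))) \<and>
    W 1 = X 1 \<and> (\<forall>j\<in>{2..r}. W j = commutator (X j) (W (j - 1)))"

end

theory Submission
  imports Defs
begin

text \<open>
  Let \<open>A\<^sub>1, \<dots>, A\<^sub>r\<close> be operators on \<open>H\<close> and let \<open>X\<^sub>j\<close> have the single block \<open>A\<^sub>j: H\<^bsub>j-1\<^esub> \<rightarrow> H\<^sub>j\<close>. Of the two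
  products in \<open>[X\<^sub>j, W\<^bsub>j-1\<^esub>]\<close> only \<open>X\<^sub>j W\<^bsub>j-1\<^esub>\<close> survives, so \<open>W\<^sub>r\<close> has the single block \<open>A\<^sub>r \<dots> A\<^sub>1\<close>, from \<open>H\<^sub>0\<close>
  to \<open>H\<^sub>r\<close>. Every compact \<open>K\<close> is such a product of compact factors: with the polar decomposition
  \<open>K = V |K|\<close>, take \<open>r - 1\<close> factors \<open>|K|\<^bsup>1/r\<^esup>\<close> and the factor \<open>V |K|\<^bsup>1/r\<^esup>\<close>
  (\<open>compact_op_factorization\<close>). The roots are defined on an orthonormal basis of eigenvectors of
  \<open>K\<^sup>*K\<close>, whose existence is the spectral theorem needed here (\<open>compact_op_eigenbasis\<close>).
  The block of \<open>W\<^sub>r\<close> is then \<open>K\<close> itself. The operators \<open>X\<^sub>j\<close> define a representation of the free Lie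
  algebra which takes the word \<open>ad q\<^sub>r \<dots> ad q\<^sub>2 q\<^sub>1\<close> to \<open>W\<^sub>r \<noteq> 0\<close>, so the word is not zero.

  The determinants rest on one fact: the Fredholm series of a trace-class operator converges
  absolutely and has the same sum in every orthonormal basis. An eigenbasis of \<open>T\<^sup>*T\<close> provides an
  expansion \<open>T = \<Sum>\<^sub>i \<langle>u\<^sub>i, \<cdot>\<rangle> v\<^sub>i\<close> with \<open>\<Sum>\<^sub>i \<parallel>u\<^sub>i\<parallel> \<parallel>v\<^sub>i\<parallel> < \<infinity>\<close>. The principal minors of \<open>T\<close> in a basis are
  minors of the product of the matrices \<open>\<langle>e, v\<^sub>i\<rangle>\<close> and \<open>\<langle>u\<^sub>i, f\<rangle>\<close>; an infinite Cauchy-Binet argument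
  turns their sum into the sum of the principal minors of the product in the other order, which by
  Parseval is \<open>\<langle>u\<^sub>j, v\<^sub>i\<rangle>\<close> and does not mention the basis
  (\<open>sum_principal_minors_commute\<close>, \<open>has_sum_fredholm_det\<close>). Expansions of this kind can be added and
  composed with bounded operators, which covers all operators whose determinants occur below.

  In a basis adapted to \<open>H\<^sub>0 \<oplus> \<dots> \<oplus> H\<^sub>r\<close>, every principal minor of a block triangular operator is the
  product of the principal minors of its diagonal blocks, and summation over all finite subsets of
  the basis gives the product formula (\<open>fredholm_det_block_triangular\<close>). It yields
  \<open>det(I + z W\<^sub>r) = 1\<close> because \<open>W\<^sub>r\<close> is strictly triangular, and the formula for \<open>W\<^sub>r\<^sup>*W\<^sub>r\<close> because this
  operator has the single block \<open>K\<^sup>*K\<close>, on the diagonal.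

  The remaining assertions concern the choice of \<open>K\<close>. If \<open>H\<close> is infinite-dimensional, every
  nonincreasing null sequence is the sequence of singular values of a diagonal operator
  (\<open>diagonal_operator_exists\<close>), so it suffices to find sequences with the required behaviour. Most of
  them are step sequences, in which heights and multiplicities are chosen independently at a sequence
  of scales.
\<close>

section \<open>Complex inner products and bounded operators\<close>

lemma cinner_add_left: "cinner (x + y) z = cinner x z + cinner y (z::'a::complex_inner)"
  by (metis cinner_add_right cinner_commute complex_cnj_add)

lemma cinner_scaleC_left: "cinner (c *\<^sub>C x) y = cnj c * cinner x (y::'a::complex_inner)"
  by (metis cinner_commute cinner_scaleC_right complex_cnj_mult)

lemma cinner_zero_right [simp]: "cinner x (0::'a::complex_inner) = 0"
  by (metis add_cancel_right_left cinner_add_right)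

lemma cinner_zero_left [simp]: "cinner (0::'a::complex_inner) x = 0"
  by (metis cinner_commute cinner_zero_right complex_cnj_zero)

lemma cinner_minus_right: "cinner x (- y) = - cinner x (y::'a::complex_inner)"
  by (metis add.right_inverse add_eq_0_iff cinner_add_right cinner_zero_right)

lemma cinner_diff_right: "cinner x (y - z) = cinner x y - cinner x (z::'a::complex_inner)"
  using cinner_add_right[of x y "- z"] by (simp add: cinner_minus_right)

lemma cinner_sum_right: "cinner x (\<Sum>i\<in>I. f i) = (\<Sum>i\<in>I. cinner x (f i :: 'a::complex_inner))"
  by (induction I rule: infinite_finite_induct) (simp_all add: cinner_add_right)

lemma cinner_sum_left: "cinner (\<Sum>i\<in>I. f i) x = (\<Sum>i\<in>I. cinner (f i) (x :: 'a::complex_inner))"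
  by (induction I rule: infinite_finite_induct) (simp_all add: cinner_add_left)

lemma cinner_self_eq_0_iff [simp]: "cinner x x = 0 \<longleftrightarrow> (x::'a::complex_inner) = 0"
  by (simp add: cinner_self)

lemma cinner_extI: "(\<And>z. cinner z x = cinner z (y::'a::complex_inner)) \<Longrightarrow> x = y"
  by (metis cinner_diff_right cinner_self_eq_0_iff eq_iff_diff_eq_0)

text \<open>Cauchy-Schwarz reduces to the real case, because a unimodular factor on \<open>y\<close> makes
  \<open>\<langle>x, y\<rangle>\<close> real without changing the norms.\<close>

lemma cmod_cinner_le: "cmod (cinner x y) \<le> norm x * norm (y::'a::complex_inner)"
proof (cases "cinner x y = 0")
  case False
  define a where "a = cinner x y"
  define c where "c = cnj a / cmod a"
  have "a \<noteq> 0" using False by (simp add: a_def)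
  then have c: "cmod c = 1" "c * a = cmod a"
    by (simp_all add: c_def norm_divide mult.commute[of "cnj a"] flip: complex_norm_square)
      (simp add: power2_eq_square)
  have "cmod a = Re (cinner x (c *\<^sub>C y))"
    using c(2) by (simp add: cinner_scaleC_right a_def[symmetric])
  also have "\<dots> = inner x (c *\<^sub>C y)"
    by (simp add: inner_eq_Re_cinner)
  also have "\<dots> \<le> norm x * norm (c *\<^sub>C y)"
    by (rule norm_cauchy_schwarz)
  finally show ?thesis using c(1) by (simp add: norm_scaleC a_def)
qed simp

lemma norm_add_orthogonal:
  "cinner x y = 0 \<Longrightarrow> (norm (x + y))\<^sup>2 = (norm x)\<^sup>2 + (norm (y::'a::complex_inner))\<^sup>2"
  using cinner_commute[of y x]
  by (simp add: power2_norm_eq_inner inner_eq_Re_cinner cinner_add_left cinner_add_right)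

lemma bounded_linear_cinner_right: "bounded_linear (\<lambda>y. cinner x (y::'a::complex_inner))"
  by (rule bounded_linear_intro[where K = "norm x"])
    (simp_all add: cinner_add_right scaleR_scaleC cinner_scaleC_right scaleR_conv_of_real
      cmod_cinner_le mult.commute[of _ "norm x"])

lemma bounded_linear_scaleC: "bounded_linear (\<lambda>x::'a::complex_inner. c *\<^sub>C x)"
  by (rule bounded_linear_intro[where K = "cmod c"])
    (simp_all add: scaleC_add_right scaleR_scaleC scaleC_scaleC norm_scaleC mult.commute)

lemma bounded_linear_scaleC_left: "bounded_linear (\<lambda>c. c *\<^sub>C (x::'a::complex_inner))"
  by (rule bounded_linear_intro[where K = "norm x"])
    (simp_all add: scaleC_add_left scaleR_scaleC scaleC_scaleC norm_scaleC scaleR_conv_of_real)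

lemma bounded_linear_cblinfun: "bounded_linear (cblinfun_apply T)"
  using cblinfun_apply[of T] by simp

lemma cblinfun_scaleC: "T *\<^sub>V (c *\<^sub>C x) = c *\<^sub>C (T *\<^sub>V x)"
  using cblinfun_apply[of T] by simp

lemmas cblinfun_add = linear_add[OF bounded_linear.linear[OF bounded_linear_cblinfun]]
  and cblinfun_diff = linear_diff[OF bounded_linear.linear[OF bounded_linear_cblinfun]]
  and cblinfun_zero = linear_0[OF bounded_linear.linear[OF bounded_linear_cblinfun]]
  and cblinfun_sum = linear_sum[OF bounded_linear.linear[OF bounded_linear_cblinfun]]

lemma cblinfun_eqI: "(\<And>x. S *\<^sub>V x = T *\<^sub>V x) \<Longrightarrow> S = T"
  by (simp add: cblinfun_apply_inject[symmetric] fun_eq_iff)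

lemma zero_cblinfun_apply [simp]: "0 *\<^sub>V x = 0" by transfer simp
lemma plus_cblinfun_apply [simp]: "(S + T) *\<^sub>V x = S *\<^sub>V x + T *\<^sub>V x" by transfer simp
lemma minus_cblinfun_apply [simp]: "(S - T) *\<^sub>V x = S *\<^sub>V x - T *\<^sub>V x" by transfer simp
lemma scaleC_cblinfun_apply [simp]: "(c *\<^sub>C S) *\<^sub>V x = c *\<^sub>C (S *\<^sub>V x)" by transfer simp
lemma compose_cblinfun_apply [simp]: "(S o\<^sub>C\<^sub>L T) *\<^sub>V x = S *\<^sub>V T *\<^sub>V x" by transfer simp
lemma id_cblinfun_apply [simp]: "id_cblinfun *\<^sub>V x = x" by transfer simp

lemma Cblinfun_apply:
  "bounded_linear f \<Longrightarrow> (\<And>c x. f (c *\<^sub>C x) = c *\<^sub>C f x) \<Longrightarrow> Cblinfun f *\<^sub>V x = f x"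
  by (subst Cblinfun_inverse) auto

lemma cblinfun_norm_bound: "\<exists>C>0. \<forall>x. norm (T *\<^sub>V x) \<le> norm x * C"
  using bounded_linear.pos_bounded[OF bounded_linear_cblinfun[of T]] by auto

lemma continuous_on_cblinfun: "continuous_on A (cblinfun_apply T)"
  by (rule linear_continuous_on) (rule bounded_linear_cblinfun)

lemma continuous_on_cinner_right: "continuous_on A (cinner (x::'a::complex_inner))"
  by (rule linear_continuous_on) (rule bounded_linear_cinner_right)


section \<open>Orthogonal projection, Riesz representation and adjoints\<close>

text \<open>A minimising sequence for the distance from \<open>x\<close> to \<open>M\<close> is Cauchy by the parallelogram
  law, and a nearest point \<open>p\<close> makes \<open>x - p\<close> orthogonal to \<open>M\<close>, since otherwise a small step
  along an element of \<open>M\<close> would come closer.\<close>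

lemma orthogonal_projection_exists:
  fixes x :: "'a::chilbert_space"
  assumes M: "complex_vector.subspace M" "closed M"
  shows "\<exists>p\<in>M. \<forall>m\<in>M. cinner m (x - p) = 0"
proof -
  define d where "d = (INF m\<in>M. norm (x - m))"
  have zero: "0 \<in> M" using M(1) by (rule complex_vector.subspace_0)
  have bdd: "bdd_below ((\<lambda>m. norm (x - m)) ` M)" by (rule bdd_belowI[of _ 0]) auto
  have d_le: "d \<le> norm (x - m)" if "m \<in> M" for m
    unfolding d_def using bdd that by (rule cINF_lower)
  have d0: "d \<ge> 0" unfolding d_def by (rule cINF_greatest) (use zero in auto)
  have "\<exists>m\<in>M. norm (x - m) < d + 1 / Suc n" for n
    using cINF_less_iff[OF _ bdd, of "d + 1 / Suc n"] zero unfolding d_def by fastforce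
  then obtain y where y: "\<And>n. y n \<in> M" "\<And>n. norm (x - y n) < d + 1 / Suc n" by metis
  have par: "(norm (a - b))\<^sup>2 \<le> 2 * (norm (x - a))\<^sup>2 + 2 * (norm (x - b))\<^sup>2 - 4 * d\<^sup>2"
    if "a \<in> M" "b \<in> M" for a b
  proof -
    define m where "m = (1/2::complex) *\<^sub>C (a + b)"
    have "m \<in> M" unfolding m_def using M(1) that
      by (intro complex_vector.subspace_scale complex_vector.subspace_add)
    then have "d\<^sup>2 \<le> (norm (x - m))\<^sup>2" using d_le d0 by (intro power_mono) auto
    moreover have "m = (1/2) *\<^sub>R (a + b)" by (simp add: m_def scaleR_scaleC)
    then have "(norm (a - b))\<^sup>2 + 4 * (norm (x - m))\<^sup>2 = 2 * (norm (x - a))\<^sup>2 + 2 * (norm (x - b))\<^sup>2"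
      by (simp add: power2_norm_eq_inner inner_diff_left inner_diff_right inner_add_left
          inner_add_right inner_commute algebra_simps)
    ultimately show ?thesis by linarith
  qed
  have "Cauchy y"
  proof (rule metric_CauchyI)
    fix e :: real assume e: "e > 0"
    have "(\<lambda>n. 4 * (d + 1 / Suc n)\<^sup>2 - 4 * d\<^sup>2) \<longlonglongrightarrow> 4 * (d + 0)\<^sup>2 - 4 * d\<^sup>2"
      by (intro tendsto_intros LIMSEQ_Suc[OF lim_1_over_n])
    then have "(\<lambda>n. 4 * (d + 1 / Suc n)\<^sup>2 - 4 * d\<^sup>2) \<longlonglongrightarrow> 0" by simp
    then have "\<forall>\<^sub>F n in sequentially. 4 * (d + 1 / Suc n)\<^sup>2 - 4 * d\<^sup>2 < e\<^sup>2"
      by (rule order_tendstoD) (use e in auto)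
    then obtain N where N: "4 * (d + 1 / Suc N)\<^sup>2 - 4 * d\<^sup>2 < e\<^sup>2"
      by (auto simp: eventually_sequentially)
    have "norm (x - y n) \<le> d + 1 / Suc N" if "n \<ge> N" for n
      using y(2)[of n] that frac_le[of 1 1 "Suc N" "Suc n"] by simp
    then have sq: "(norm (x - y n))\<^sup>2 \<le> (d + 1 / Suc N)\<^sup>2" if "n \<ge> N" for n
      using that by (intro power_mono) auto
    show "\<exists>N. \<forall>m\<ge>N. \<forall>n\<ge>N. dist (y m) (y n) < e"
    proof (intro exI[of _ N] allI impI)
      fix m n assume "m \<ge> N" "n \<ge> N"
      then have "(norm (y m - y n))\<^sup>2 < e\<^sup>2"
        using par[OF y(1) y(1), of m n] sq[of m] sq[of n] N by linarith
      then show "dist (y m) (y n) < e"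
        using e by (simp add: dist_norm power_less_imp_less_base)
    qed
  qed
  then obtain p where p: "y \<longlonglongrightarrow> p" using Cauchy_convergent convergent_def by blast
  have pM: "p \<in> M" using closed_sequentially[OF M(2)] y(1) p by blast
  have "(\<lambda>n. norm (x - y n)) \<longlonglongrightarrow> norm (x - p)" by (intro tendsto_intros p)
  moreover have "(\<lambda>n. d + 1 / Suc n) \<longlonglongrightarrow> d + 0"
    by (intro tendsto_intros LIMSEQ_Suc[OF lim_1_over_n])
  ultimately have "norm (x - p) \<le> d + 0"
    by (rule LIMSEQ_le) (use y(2) less_imp_le in blast)
  then have dp: "norm (x - p) \<le> norm (x - m)" if "m \<in> M" for m
    using d_le[OF that] by simp
  have "cinner m (x - p) = 0" if m: "m \<in> M" for m
  proof (rule ccontr)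
    assume neq: "cinner m (x - p) \<noteq> 0"
    define a w where "a = cinner m (x - p)" and "w = x - p"
    have m0: "norm m \<noteq> 0" using neq by auto
    \<comment> \<open>\<open>q\<close> is the component of \<open>w\<close> along \<open>m\<close>, and \<open>p + q\<close> would be nearer to \<open>x\<close> than \<open>p\<close>.\<close>
    define c where "c = a / complex_of_real ((norm m)\<^sup>2)"
    define q where "q = c *\<^sub>C m"
    have "cinner q (w - q) = cnj c * (a - c * cinner m m)"
      by (simp add: q_def cinner_scaleC_left cinner_scaleC_right cinner_diff_right a_def w_def
          right_diff_distrib mult.left_commute)
    also have "\<dots> = 0" using m0 by (simp add: c_def cinner_self)
    finally have "(norm w)\<^sup>2 = (norm q)\<^sup>2 + (norm (w - q))\<^sup>2"
      using norm_add_orthogonal[of q "w - q"] by simp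
    moreover have "p + q \<in> M" unfolding q_def
      using M(1) pM m by (intro complex_vector.subspace_add complex_vector.subspace_scale)
    then have "norm w \<le> norm (w - q)" using dp[of "p + q"] by (simp add: w_def algebra_simps)
    then have "(norm w)\<^sup>2 \<le> (norm (w - q))\<^sup>2" by (intro power_mono) auto
    ultimately have "norm q = 0" by (simp add: power2_eq_square not_less sum_squares_le_zero_iff mult_le_0_iff)
    then show False using m0 neq by (simp add: q_def c_def a_def norm_scaleC)
  qed
  with pM show ?thesis by blast
qed

text \<open>The kernel of \<open>f \<noteq> 0\<close> is closed and has codimension one, so a vector orthogonal to it represents \<open>f\<close>
  up to a factor.\<close>

lemma riesz_representation:
  fixes f :: "'a::chilbert_space \<Rightarrow> complex"
  assumes f: "bounded_linear f" and fC: "\<And>c x. f (c *\<^sub>C x) = c * f x"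
  shows "\<exists>z. \<forall>x. f x = cinner z x"
proof (cases "\<forall>x. f x = 0")
  case True
  then show ?thesis by (intro exI[of _ 0]) simp
next
  case False
  then obtain x where x: "f x \<noteq> 0" by blast
  note lin = bounded_linear.linear[OF f]
  define M where "M = {y. f y = 0}"
  have "complex_vector.subspace M"
    by (rule complex_vector.subspaceI)
      (simp_all add: M_def linear_0[OF lin] linear_add[OF lin] fC)
  moreover have "closed M"
    unfolding M_def by (intro closed_Collect_eq linear_continuous_on f continuous_on_const)
  ultimately obtain p where p: "p \<in> M" "\<And>m. m \<in> M \<Longrightarrow> cinner m (x - p) = 0"
    using orthogonal_projection_exists by metis
  define w where "w = x - p"
  have fw: "f w \<noteq> 0" using x p(1) by (simp add: w_def linear_diff[OF lin] M_def)
  then have w0: "norm w \<noteq> 0" using linear_0[OF lin] by force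
  show ?thesis
  proof (intro exI allI)
    fix y
    have "y - (f y / f w) *\<^sub>C w \<in> M"
      using fw by (simp add: M_def linear_diff[OF lin] fC)
    then have "cinner (y - (f y / f w) *\<^sub>C w) w = 0" using p(2) by (simp add: w_def)
    then have "cinner w (y - (f y / f w) *\<^sub>C w) = 0" by (metis cinner_commute complex_cnj_zero)
    then have "cinner w y = f y / f w * (norm w)\<^sup>2"
      by (simp add: cinner_diff_right cinner_scaleC_right cinner_self)
    then show "f y = cinner (cnj (f w / (norm w)\<^sup>2) *\<^sub>C w) y"
      using fw w0 by (simp add: cinner_scaleC_left)
  qed
qed

lemma adj_eqI:
  assumes "\<And>x y. cinner (T *\<^sub>V x) y = cinner x (S *\<^sub>V y)"
  shows "adj T = S"
  unfolding adj_def
proof (rule the_equality)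
  show "\<forall>x y. cinner (T *\<^sub>V x) y = cinner x (S *\<^sub>V y)" using assms by blast
  show "S' = S" if "\<forall>x y. cinner (T *\<^sub>V x) y = cinner x (S' *\<^sub>V y)" for S'
    using that assms by (intro cblinfun_eqI cinner_extI) metis
qed

text \<open>The constant \<open>adj\<close> is a definite description, so its characteristic equation requires that an
  adjoint exists; representing the functionals \<open>\<langle>y, T \<cdot>\<rangle>\<close> provides one.\<close>

lemma cinner_adj_right:
  fixes T :: "'a::chilbert_space \<Rightarrow>\<^sub>C\<^sub>L 'b::complex_inner"
  shows "cinner x (adj T *\<^sub>V y) = cinner (T *\<^sub>V x) y"
proof -
  have "\<exists>z. \<forall>x. cinner y (T *\<^sub>V x) = cinner z x" for y
    by (rule riesz_representation)
      (simp_all add: cblinfun_scaleC cinner_scaleC_right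
        bounded_linear_compose[OF bounded_linear_cinner_right bounded_linear_cblinfun])
  then obtain S where S: "\<And>x y. cinner y (T *\<^sub>V x) = cinner (S y) x" by metis
  then have S': "cinner (T *\<^sub>V x) y = cinner x (S y)" for x y
    by (metis cinner_commute)
  obtain C where C: "C > 0" "\<And>x. norm (T *\<^sub>V x) \<le> norm x * C"
    using cblinfun_norm_bound by blast
  have scale: "S (c *\<^sub>C y) = c *\<^sub>C S y" for c y
    by (rule cinner_extI) (simp add: S'[symmetric] cinner_scaleC_right)
  have "bounded_linear S"
  proof (rule bounded_linear_intro[where K = C])
    show "S (x + y) = S x + S y" for x y
      by (rule cinner_extI) (simp add: S'[symmetric] cinner_add_right)
    show "S (r *\<^sub>R x) = r *\<^sub>R S x" for r x by (simp add: scaleR_scaleC scale)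
    show "norm (S y) \<le> norm y * C" for y
    proof (cases "S y = 0")
      case False
      have "(norm (S y))\<^sup>2 = cmod (cinner (S y) (S y))" by (simp add: cinner_self norm_power)
      also have "\<dots> = cmod (cinner y (T *\<^sub>V S y))" by (simp add: S)
      also have "\<dots> \<le> norm y * (norm (S y) * C)"
        using C(2) by (intro order_trans[OF cmod_cinner_le] mult_left_mono) auto
      finally show ?thesis using False by (simp add: power2_eq_square mult.assoc mult.left_commute)
    qed (use C(1) in simp)
  qed
  then have "adj T = Cblinfun S"
    by (intro adj_eqI) (simp add: S' Cblinfun_apply scale)
  then show ?thesis
    using \<open>bounded_linear S\<close> by (simp add: S' Cblinfun_apply scale)
qed

lemma cinner_adj_left:
  fixes T :: "'a::chilbert_space \<Rightarrow>\<^sub>C\<^sub>L 'b::complex_inner"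
  shows "cinner (adj T *\<^sub>V y) x = cinner y (T *\<^sub>V x)"
  by (metis cinner_adj_right cinner_commute)


section \<open>Orthonormal bases\<close>

definition orthonormal :: "'a::complex_inner set \<Rightarrow> bool"
  where "orthonormal B \<longleftrightarrow> (\<forall>e\<in>B. \<forall>f\<in>B. cinner e f = (if e = f then 1 else 0))"

lemma is_onb_iff: "is_onb B \<longleftrightarrow> orthonormal B \<and> closure (complex_vector.span B) = UNIV"
  by (simp add: is_onb_def orthonormal_def)

lemma orthonormal_norm: "orthonormal B \<Longrightarrow> b \<in> B \<Longrightarrow> norm b = 1"
  by (simp add: norm_eq_sqrt_inner inner_eq_Re_cinner orthonormal_def)

lemma orthonormal_cinner:
  "orthonormal B \<Longrightarrow> e \<in> B \<Longrightarrow> f \<in> B \<Longrightarrow> cinner e f = (if e = f then 1 else 0)"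
  by (simp add: orthonormal_def)

lemma cinner_sum_orthonormal:
  assumes "orthonormal B" "finite F" "F \<subseteq> B" "b \<in> B"
  shows "cinner b (\<Sum>e\<in>F. c e *\<^sub>C e) = (if b \<in> F then c b else 0)"
proof -
  have "cinner b (\<Sum>e\<in>F. c e *\<^sub>C e) = (\<Sum>e\<in>F. if b = e then c e else 0)"
    unfolding cinner_sum_right
    by (rule sum.cong) (use assms orthonormal_cinner[OF assms(1,4)] in \<open>auto simp: cinner_scaleC_right\<close>)
  then show ?thesis using assms(2) by simp
qed

lemma norm_sum_orthonormal:
  assumes "orthonormal B" "finite F" "F \<subseteq> B"
  shows "(norm (\<Sum>e\<in>F. c e *\<^sub>C e))\<^sup>2 = (\<Sum>e\<in>F. (cmod (c e))\<^sup>2)"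
proof -
  define v where "v = (\<Sum>e\<in>F. c e *\<^sub>C e)"
  have "complex_of_real ((norm v)\<^sup>2) = cinner v v" by (simp add: cinner_self)
  also have "\<dots> = (\<Sum>e\<in>F. cnj (c e) * cinner e v)"
    by (simp add: v_def cinner_sum_left cinner_scaleC_left)
  also have "\<dots> = (\<Sum>e\<in>F. complex_of_real ((cmod (c e))\<^sup>2))"
    using cinner_sum_orthonormal[OF assms, of _ c] assms(3)
    by (intro sum.cong refl) (auto simp: v_def complex_norm_square mult.commute simp del: of_real_power)
  finally have "complex_of_real ((norm v)\<^sup>2) = complex_of_real (\<Sum>e\<in>F. (cmod (c e))\<^sup>2)"
    by (simp only: of_real_sum)
  then show ?thesis by (simp only: v_def of_real_eq_iff)
qed

text \<open>Subtracting the finite Fourier sum of \<open>x\<close> removes from \<open>x\<close> its components along \<open>F\<close>, so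
  it is the best approximation of \<open>x\<close> from the span of \<open>F\<close>.\<close>

lemma fourier_sum_best:
  assumes "orthonormal B" "finite F" "F \<subseteq> B"
  shows "(norm x)\<^sup>2 = (\<Sum>e\<in>F. (cmod (cinner e x))\<^sup>2) + (norm (x - (\<Sum>e\<in>F. cinner e x *\<^sub>C e)))\<^sup>2"
    and "norm (x - (\<Sum>e\<in>F. cinner e x *\<^sub>C e)) \<le> norm (x - (\<Sum>e\<in>F. c e *\<^sub>C e))"
proof -
  define w where "w = x - (\<Sum>e\<in>F. cinner e x *\<^sub>C e)"
  have "cinner e w = 0" if "e \<in> F" for e
    using cinner_sum_orthonormal[OF assms, of e "\<lambda>e. cinner e x"] that assms(3)
    by (auto simp: w_def cinner_diff_right)
  then have orth: "cinner (\<Sum>e\<in>F. d e *\<^sub>C e) w = 0" for d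
    by (simp add: cinner_sum_left cinner_scaleC_left)
  show "(norm x)\<^sup>2 = (\<Sum>e\<in>F. (cmod (cinner e x))\<^sup>2) + (norm w)\<^sup>2"
    using norm_add_orthogonal[OF orth[of "\<lambda>e. cinner e x"]] norm_sum_orthonormal[OF assms, of "\<lambda>e. cinner e x"]
    by (simp add: w_def)
  have "x - (\<Sum>e\<in>F. c e *\<^sub>C e) = (\<Sum>e\<in>F. (cinner e x - c e) *\<^sub>C e) + w"
    by (simp add: w_def complex_vector.scale_left_diff_distrib sum_subtractf)
  then have "(norm w)\<^sup>2 \<le> (norm (x - (\<Sum>e\<in>F. c e *\<^sub>C e)))\<^sup>2"
    using norm_add_orthogonal[OF orth[of "\<lambda>e. cinner e x - c e"]] by simp
  then show "norm w \<le> norm (x - (\<Sum>e\<in>F. c e *\<^sub>C e))" by simp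
qed

text \<open>By density, some finite combination of basis vectors is close to \<open>x\<close>; every Fourier sum over a
  larger finite set is at least as close.\<close>

lemma has_sum_fourier:
  assumes B: "is_onb B"
  shows "((\<lambda>b. cinner b x *\<^sub>C b) has_sum x) B"
proof -
  have on: "orthonormal B" using B by (simp add: is_onb_iff)
  show ?thesis
    unfolding has_sum_def tendsto_iff
  proof (intro allI impI)
    fix e :: real assume e: "e > 0"
    have "x \<in> closure (complex_vector.span B)" using B by (simp add: is_onb_def)
    then obtain y where y: "y \<in> complex_vector.span B" "dist y x < e"
      using e closure_approachable by blast
    then obtain t c where t: "finite t" "t \<subseteq> B" "y = (\<Sum>a\<in>t. c a *\<^sub>C a)"
      unfolding complex_vector.span_explicit by blast
    have "dist (\<Sum>b\<in>F. cinner b x *\<^sub>C b) x < e" if F: "finite F" "t \<subseteq> F" "F \<subseteq> B" for F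
    proof -
      have "y = (\<Sum>a\<in>F. (if a \<in> t then c a else 0) *\<^sub>C a)"
        unfolding t(3) by (rule sum.mono_neutral_cong_left) (use F in auto)
      then have "norm (x - (\<Sum>b\<in>F. cinner b x *\<^sub>C b)) \<le> norm (x - y)"
        using fourier_sum_best(2)[OF on F(1,3)] by simp
      then show ?thesis using y(2) by (simp add: dist_norm norm_minus_commute)
    qed
    then show "\<forall>\<^sub>F F in finite_subsets_at_top B. dist (\<Sum>b\<in>F. cinner b x *\<^sub>C b) x < e"
      unfolding eventually_finite_subsets_at_top using t(1,2) by blast
  qed
qed

lemma has_sum_parseval:
  assumes "is_onb B"
  shows "((\<lambda>b. cinner y b * cinner b x) has_sum cinner y x) B"
  using has_sum_bounded_linear[OF bounded_linear_cinner_right[of y] has_sum_fourier[OF assms, of x]]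
  by (simp add: cinner_scaleC_right mult.commute o_def)

lemma has_sum_parseval_norm:
  assumes "is_onb B"
  shows "((\<lambda>b. (cmod (cinner b x))\<^sup>2) has_sum (norm x)\<^sup>2) B"
  using has_sum_Re[OF has_sum_parseval[OF assms, of x x]]
  by (subst (asm) cinner_commute[of x])
    (simp add: cinner_self mult.commute[of "cnj _"] flip: of_real_power complex_norm_square)

lemma has_sum_cblinfun_fourier:
  assumes "is_onb B"
  shows "((\<lambda>b. cinner b x *\<^sub>C (T *\<^sub>V b)) has_sum (T *\<^sub>V x)) B"
  using has_sum_bounded_linear[OF bounded_linear_cblinfun has_sum_fourier[OF assms, of x], of T]
  by (simp add: cblinfun_scaleC o_def)

lemma cblinfun_eq_on_onb:
  assumes "is_onb B" "\<And>b. b \<in> B \<Longrightarrow> S *\<^sub>V b = T *\<^sub>V b"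
  shows "S = T"
proof (rule cblinfun_eqI)
  fix x
  have "((\<lambda>b. cinner b x *\<^sub>C (S *\<^sub>V b)) has_sum (T *\<^sub>V x)) B"
    using has_sum_cblinfun_fourier[OF assms(1), of x T] assms(2) by (simp cong: has_sum_cong)
  then show "S *\<^sub>V x = T *\<^sub>V x"
    using has_sum_cblinfun_fourier[OF assms(1), of x S] has_sum_unique by blast
qed

text \<open>Zorn's lemma for orthonormal sets of vectors with a given property; the property makes
  the lemma serve both for bases and for families of eigenvectors.\<close>

lemma maximal_orthonormal_exists:
  fixes E :: "'a::complex_inner set"
  assumes "orthonormal E" "\<And>e. e \<in> E \<Longrightarrow> P e"
  obtains M where "E \<subseteq> M" "orthonormal M" "\<And>e. e \<in> M \<Longrightarrow> P e"
    "\<And>x. norm x = 1 \<Longrightarrow> P x \<Longrightarrow> \<exists>e\<in>M. cinner e x \<noteq> 0"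
proof -
  define \<A> where "\<A> = {M. E \<subseteq> M \<and> orthonormal M \<and> (\<forall>e\<in>M. P e)}"
  have "\<exists>M\<in>\<A>. \<forall>X\<in>\<A>. M \<subseteq> X \<longrightarrow> X = M"
  proof (rule subset_Zorn_nonempty)
    show "\<A> \<noteq> {}" using assms by (auto simp: \<A>_def)
    fix C assume C: "C \<noteq> {}" "subset.chain \<A> C"
    have chain: "X \<subseteq> Y \<or> Y \<subseteq> X" if "X \<in> C" "Y \<in> C" for X Y
      using C(2) that by (auto simp: subset_chain_def)
    have CA: "C \<subseteq> \<A>" using C(2) by (auto simp: subset_chain_def)
    have "cinner e f = (if e = f then 1 else 0)" if "e \<in> \<Union>C" "f \<in> \<Union>C" for e f
    proof -
      from that obtain X where "X \<in> C" "e \<in> X" "f \<in> X" using chain by blast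
      then show ?thesis using CA by (auto simp: \<A>_def orthonormal_def)
    qed
    then have "orthonormal (\<Union>C)" by (simp add: orthonormal_def)
    moreover have "E \<subseteq> \<Union>C" "\<forall>e\<in>\<Union>C. P e" using C(1) CA by (auto simp: \<A>_def)
    ultimately show "\<Union>C \<in> \<A>" by (simp add: \<A>_def)
  qed
  then obtain M where M: "M \<in> \<A>" "\<And>X. X \<in> \<A> \<Longrightarrow> M \<subseteq> X \<Longrightarrow> X = M" by blast
  have "\<exists>e\<in>M. cinner e x \<noteq> 0" if x: "norm x = 1" "P x" for x
  proof (rule ccontr)
    assume "\<not> ?thesis"
    then have 0: "cinner e x = 0" "cinner x e = 0" if "e \<in> M" for e
      using that cinner_commute[of x e] by auto
    moreover have 1: "cinner x x = 1" using x(1) by (simp add: cinner_self)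
    moreover from 0 1 have "x \<notin> M" by force
    ultimately have "insert x M \<in> \<A>"
      using M(1) x(2) by (auto simp: \<A>_def orthonormal_def)
    then show False using M(2) \<open>x \<notin> M\<close> by blast
  qed
  then show ?thesis using that M(1) by (auto simp: \<A>_def)
qed

lemma subspace_closure:
  fixes S :: "'a::complex_inner set"
  assumes "complex_vector.subspace S"
  shows "complex_vector.subspace (closure S)"
proof (rule complex_vector.subspaceI)
  show "0 \<in> closure S" using assms closure_subset complex_vector.subspace_0 by blast
  show "x + y \<in> closure S" if "x \<in> closure S" "y \<in> closure S" for x y
  proof -
    from that obtain f g where "\<And>n. f n \<in> S" "f \<longlonglongrightarrow> x" "\<And>n. g n \<in> S" "g \<longlonglongrightarrow> y"
      unfolding closure_sequential by blast
    then show ?thesis unfolding closure_sequential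
      by (intro exI[of _ "\<lambda>n. f n + g n"])
        (auto intro: tendsto_add complex_vector.subspace_add assms)
  qed
  show "c *\<^sub>C x \<in> closure S" if "x \<in> closure S" for c x
  proof -
    from that obtain f where "\<And>n. f n \<in> S" "f \<longlonglongrightarrow> x"
      unfolding closure_sequential by blast
    then show ?thesis unfolding closure_sequential
      by (intro exI[of _ "\<lambda>n. c *\<^sub>C f n"])
        (auto intro: bounded_linear.tendsto[OF bounded_linear_scaleC] complex_vector.subspace_scale assms)
  qed
qed

text \<open>A maximal orthonormal set spans a dense subspace, because the component of a vector orthogonal to
  the closed span could be normalised and added.\<close>

lemma orthonormal_extends_to_onb:
  fixes E :: "'a::chilbert_space set"
  assumes "orthonormal E"
  obtains B where "E \<subseteq> B" "is_onb B"
proof -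
  obtain B where B: "E \<subseteq> B" "orthonormal B" "\<And>x. norm x = 1 \<Longrightarrow> \<exists>e\<in>B. cinner e x \<noteq> 0"
    using maximal_orthonormal_exists[of E "\<lambda>_. True"] assms by metis
  define M where "M = closure (complex_vector.span B)"
  have "x \<in> M" for x
  proof -
    have "complex_vector.subspace M"
      unfolding M_def by (intro subspace_closure complex_vector.subspace_span)
    then obtain p where p: "p \<in> M" "\<And>m. m \<in> M \<Longrightarrow> cinner m (x - p) = 0"
      using orthogonal_projection_exists[of M x] by (auto simp: M_def)
    have "x = p"
    proof (rule ccontr)
      assume "x \<noteq> p"
      define u where "u = complex_of_real (1 / norm (x - p)) *\<^sub>C (x - p)"
      have "norm u = 1" using \<open>x \<noteq> p\<close> by (simp add: u_def norm_scaleC norm_divide)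
      then obtain e where "e \<in> B" "cinner e u \<noteq> 0" using B(3) by blast
      moreover have "e \<in> M" if "e \<in> B" for e
        using that closure_subset complex_vector.span_base unfolding M_def by blast
      ultimately show False using p(2) by (auto simp: u_def cinner_scaleC_right)
    qed
    then show ?thesis using p(1) by simp
  qed
  then have "closure (complex_vector.span B) = UNIV" by (auto simp: M_def)
  with B(1,2) show ?thesis by (intro that[of B]) (simp_all add: is_onb_iff)
qed


section \<open>Compact operators and their eigenbases\<close>

lemma compact_opI:
  assumes "cblinfun_apply T ` cball 0 1 \<subseteq> C" "compact C"
  shows "compact_op T"
proof -
  have "closure (cblinfun_apply T ` cball 0 1) \<subseteq> C"
    using assms by (intro closure_minimal compact_imp_closed)
  then show ?thesis
    unfolding compact_op_def
    using compact_Int_closed[OF assms(2) closed_closure[of "cblinfun_apply T ` cball 0 1"]]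
    by (simp add: Int_absorb1)
qed

lemma compact_op_compose_left: 
  assumes "compact_op T"
  shows "compact_op (S o\<^sub>C\<^sub>L T)"
proof (rule compact_opI)
  show "compact (cblinfun_apply S ` closure (cblinfun_apply T ` cball 0 1))"
    using assms by (intro compact_continuous_image continuous_on_cblinfun) (simp add: compact_op_def)
  show "cblinfun_apply (S o\<^sub>C\<^sub>L T) ` cball 0 1 \<subseteq> cblinfun_apply S ` closure (cblinfun_apply T ` cball 0 1)"
    using closure_subset by force
qed

lemma compact_op_compose_right: 
  assumes "compact_op T"
  shows "compact_op (T o\<^sub>C\<^sub>L S)"
proof -
  obtain C where C: "C > 0" "\<And>x. norm (S *\<^sub>V x) \<le> norm x * C"
    using cblinfun_norm_bound by blast
  let ?K = "closure (cblinfun_apply T ` cball 0 1)"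
  show ?thesis
  proof (rule compact_opI)
    show "compact ((\<lambda>x. C *\<^sub>R x) ` ?K)"
      using assms by (intro compact_scaling) (simp add: compact_op_def)
    show "cblinfun_apply (T o\<^sub>C\<^sub>L S) ` cball 0 1 \<subseteq> (\<lambda>x. C *\<^sub>R x) ` ?K"
    proof clarify
      fix x assume x: "x \<in> cball (0::'c) 1"
      define y where "y = (1 / C) *\<^sub>R (S *\<^sub>V x)"
      have "norm (S *\<^sub>V x) \<le> 1 * C"
        using C(1) x by (intro order_trans[OF C(2)] mult_right_mono) auto
      then have "norm y \<le> 1" using C(1) by (simp add: y_def)
      moreover have "S *\<^sub>V x = C *\<^sub>R y" using C(1) by (simp add: y_def)
      ultimately have "(T o\<^sub>C\<^sub>L S) *\<^sub>V x = C *\<^sub>R (T *\<^sub>V y)" "T *\<^sub>V y \<in> ?K"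
        using closure_subset by (force simp: scaleR_scaleC cblinfun_scaleC)+
      then show "(T o\<^sub>C\<^sub>L S) *\<^sub>V x \<in> (\<lambda>x. C *\<^sub>R x) ` ?K" by blast
    qed
  qed
qed

lemma compact_op_convergent_subsequence:
  assumes "compact_op T" "\<And>n::nat. norm (x n) \<le> 1"
  obtains l r where "strict_mono r" "(\<lambda>n. T *\<^sub>V x (r n)) \<longlonglongrightarrow> l"
proof -
  let ?K = "closure (cblinfun_apply T ` cball 0 1)"
  have "T *\<^sub>V x n \<in> ?K" for n
    using assms(2) closure_subset by (force simp: image_iff)
  then have "\<exists>l\<in>?K. \<exists>r. strict_mono r \<and> ((\<lambda>n. T *\<^sub>V x n) \<circ> r) \<longlonglongrightarrow> l"
    using assms(1) by (auto simp: compact_op_def compact_def)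
  then show ?thesis using that by (auto simp: o_def)
qed

text \<open>Any sequence of unit vectors of \<open>M\<close> along which \<open>\<parallel>T x\<parallel>\<close> approaches its supremum \<open>m\<close> on the
  unit sphere of \<open>M\<close> is asymptotically an eigenvector of \<open>T\<^sup>*T\<close> for \<open>m\<^sup>2\<close>; compactness turns this
  into a convergent subsequence.\<close>

lemma extremal_eigenvector_exists:
  fixes T :: "'a::chilbert_space \<Rightarrow>\<^sub>C\<^sub>L 'b::complex_inner"
  assumes T: "compact_op T"
    and M: "complex_vector.subspace M" "closed M"
    and inv: "\<And>x. x \<in> M \<Longrightarrow> adj T *\<^sub>V T *\<^sub>V x \<in> M"
    and y: "y \<in> M" "T *\<^sub>V y \<noteq> 0"
  shows "\<exists>x\<in>M. norm x = 1 \<and> T *\<^sub>V x \<noteq> 0 \<and>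
    adj T *\<^sub>V T *\<^sub>V x = complex_of_real ((norm (T *\<^sub>V x))\<^sup>2) *\<^sub>C x"
proof -
  define S where "S = {x\<in>M. norm x = 1}"
  define m where "m = (SUP x\<in>S. norm (T *\<^sub>V x))"
  define A where "A = adj T o\<^sub>C\<^sub>L T"
  obtain C where C: "C > 0" "\<And>x. norm (T *\<^sub>V x) \<le> norm x * C"
    using cblinfun_norm_bound by blast
  have normalize: "complex_of_real (1 / norm x) *\<^sub>C x \<in> S" if "x \<in> M" "x \<noteq> 0" for x
    using that M(1) by (simp add: S_def norm_scaleC norm_divide complex_vector.subspace_scale)
  have "y \<noteq> 0" using y(2) by (auto simp: cblinfun_zero)
  then have y': "complex_of_real (1 / norm y) *\<^sub>C y \<in> S" using normalize y(1) by blast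
  have bdd: "bdd_above ((\<lambda>x. norm (T *\<^sub>V x)) ` S)"
    using C(2) by (intro bdd_aboveI2[of _ _ C]) (metis (mono_tags) S_def mem_Collect_eq mult_1)
  have le_m: "norm (T *\<^sub>V x) \<le> m" if "x \<in> S" for x
    unfolding m_def using bdd that by (rule cSUP_upper2) simp
  have m0: "m > 0"
    using le_m[OF y'] y(2) \<open>y \<noteq> 0\<close> 
    by (intro less_le_trans[OF _ le_m[OF y']]) (simp add: cblinfun_scaleC norm_scaleC norm_divide)
  have le_m': "norm (T *\<^sub>V x) \<le> m * norm x" if "x \<in> M" for x
  proof (cases "x = 0")
    case False
    then show ?thesis using le_m[OF normalize[OF that False]]
      by (simp add: cblinfun_scaleC norm_scaleC norm_divide field_simps)
  qed (simp add: cblinfun_zero)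
  have A_sq: "inner (A *\<^sub>V x) x = (norm (T *\<^sub>V x))\<^sup>2" for x
    by (simp add: A_def inner_eq_Re_cinner cinner_adj_left cinner_self)
  have A_bound: "norm (A *\<^sub>V x) \<le> m\<^sup>2" if x: "x \<in> S" for x
  proof (cases "A *\<^sub>V x = 0")
    case False
    have "(norm (A *\<^sub>V x))\<^sup>2 = cmod (cinner (A *\<^sub>V x) (A *\<^sub>V x))" by (simp add: cinner_self norm_power)
    also have "\<dots> = cmod (cinner (T *\<^sub>V x) (T *\<^sub>V A *\<^sub>V x))"
      by (subst (1) A_def) (simp add: cinner_adj_left)
    also have "\<dots> \<le> norm (T *\<^sub>V x) * norm (T *\<^sub>V A *\<^sub>V x)" by (rule cmod_cinner_le)
    also have "\<dots> \<le> m * (m * norm (A *\<^sub>V x))"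
      using x inv[of x] m0 by (intro mult_mono le_m le_m') (auto simp: S_def A_def)
    finally show ?thesis using False by (simp add: power2_eq_square mult.assoc)
  qed simp
  have "\<exists>x\<in>S. m - 1 / Suc n < norm (T *\<^sub>V x)" for n
    using less_cSUP_iff[OF _ bdd, of "m - 1 / Suc n"] y' unfolding m_def[symmetric] by fastforce
  then obtain x where x: "\<And>n. x n \<in> S" "\<And>n. m - 1 / Suc n < norm (T *\<^sub>V x n)" by metis
  have nx: "norm (x n) = 1" for n using x(1)[of n] by (simp add: S_def)
  have "compact_op A" unfolding A_def by (rule compact_op_compose_left[OF T])
  then obtain l r where r: "strict_mono r" and l: "(\<lambda>n. A *\<^sub>V x (r n)) \<longlonglongrightarrow> l"
    by (rule compact_op_convergent_subsequence[of A x]) (use nx in auto)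
  have "(\<lambda>n. norm (T *\<^sub>V x n)) \<longlonglongrightarrow> m"
  proof (rule tendsto_sandwich)
    have "(\<lambda>n. m - 1 / Suc n) \<longlonglongrightarrow> m - 0"
      by (intro tendsto_intros LIMSEQ_Suc[OF lim_1_over_n])
    then show "(\<lambda>n. m - 1 / Suc n) \<longlonglongrightarrow> m" by simp
    show "\<forall>\<^sub>F n in sequentially. m - 1 / Suc n \<le> norm (T *\<^sub>V x n)"
      by (intro always_eventually allI less_imp_le x(2))
    show "\<forall>\<^sub>F n in sequentially. norm (T *\<^sub>V x n) \<le> m"
      by (intro always_eventually allI le_m x(1))
  qed (rule tendsto_const)
  then have Tlim: "(\<lambda>n. norm (T *\<^sub>V x (r n))) \<longlonglongrightarrow> m"
    using LIMSEQ_subseq_LIMSEQ[OF _ r] by (fastforce simp: o_def)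
  have "(norm (A *\<^sub>V x n - m\<^sup>2 *\<^sub>R x n))\<^sup>2 \<le> 2 * m\<^sup>2 * (m\<^sup>2 - (norm (T *\<^sub>V x n))\<^sup>2)" for n
  proof -
    have "(norm (A *\<^sub>V x n - m\<^sup>2 *\<^sub>R x n))\<^sup>2
        = (norm (A *\<^sub>V x n))\<^sup>2 - 2 * m\<^sup>2 * (norm (T *\<^sub>V x n))\<^sup>2 + (m\<^sup>2)\<^sup>2"
    proof -
      have "(norm (a - c *\<^sub>R b))\<^sup>2 = (norm a)\<^sup>2 - 2 * c * inner a b + c\<^sup>2 * (norm b)\<^sup>2"
        for a b :: 'a and c :: real
        by (simp add: power2_norm_eq_inner inner_diff_left inner_diff_right inner_commute
            power2_eq_square[of c] algebra_simps)
      then show ?thesis using nx[of n] A_sq[of "x n"] by simp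
    qed
    also have "(norm (A *\<^sub>V x n))\<^sup>2 \<le> (m\<^sup>2)\<^sup>2" by (intro power_mono A_bound x(1)) auto
    finally show ?thesis by (simp add: algebra_simps power2_eq_square)
  qed
  then have le: "(norm (A *\<^sub>V x (r n) - m\<^sup>2 *\<^sub>R x (r n)))\<^sup>2 \<le> 2 * m\<^sup>2 * (m\<^sup>2 - (norm (T *\<^sub>V x (r n)))\<^sup>2)" for n
    by blast
  have "(\<lambda>n. 2 * m\<^sup>2 * (m\<^sup>2 - (norm (T *\<^sub>V x (r n)))\<^sup>2)) \<longlonglongrightarrow> 2 * m\<^sup>2 * (m\<^sup>2 - m\<^sup>2)"
    by (intro tendsto_intros Tlim)
  then have "(\<lambda>n. 2 * m\<^sup>2 * (m\<^sup>2 - (norm (T *\<^sub>V x (r n)))\<^sup>2)) \<longlonglongrightarrow> 0" by simp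
  then have "(\<lambda>n. (norm (A *\<^sub>V x (r n) - m\<^sup>2 *\<^sub>R x (r n)))\<^sup>2) \<longlonglongrightarrow> 0"
    by (rule Lim_null_comparison[rotated]) (use le in \<open>auto intro!: always_eventually\<close>)
  from tendsto_real_sqrt[OF this]
  have "(\<lambda>n. norm (A *\<^sub>V x (r n) - m\<^sup>2 *\<^sub>R x (r n))) \<longlonglongrightarrow> 0" by simp
  then have "(\<lambda>n. A *\<^sub>V x (r n) - m\<^sup>2 *\<^sub>R x (r n)) \<longlonglongrightarrow> 0"
    by (rule tendsto_norm_zero_cancel)
  then have "(\<lambda>n. (1 / m\<^sup>2) *\<^sub>R (A *\<^sub>V x (r n) - (A *\<^sub>V x (r n) - m\<^sup>2 *\<^sub>R x (r n)))) \<longlonglongrightarrow> (1 / m\<^sup>2) *\<^sub>R (l - 0)"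
    by (intro tendsto_intros l)
  moreover define z where "z = (1 / m\<^sup>2) *\<^sub>R l"
  ultimately have z: "(\<lambda>n. x (r n)) \<longlonglongrightarrow> z" using m0 by simp
  have zM: "z \<in> M" using closed_sequentially[OF M(2) _ z] x(1) by (simp add: S_def)
  have "(\<lambda>n. norm (x (r n))) \<longlonglongrightarrow> norm z" by (intro tendsto_intros z)
  then have nz: "norm z = 1" using nx by (simp add: LIMSEQ_const_iff)
  have "(\<lambda>n. A *\<^sub>V x (r n)) \<longlonglongrightarrow> A *\<^sub>V z"
    by (rule bounded_linear.tendsto[OF bounded_linear_cblinfun z])
  then have "A *\<^sub>V z = l" using l LIMSEQ_unique by blast
  then have Az: "A *\<^sub>V z = m\<^sup>2 *\<^sub>R z" using m0 by (simp add: z_def)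
  then have "m\<^sup>2 = (norm (T *\<^sub>V z))\<^sup>2" using A_sq[of z] nz by (simp add: norm_eq_1)
  then show ?thesis
    using zM nz Az m0 by (intro bexI[of _ z]) (auto simp: A_def scaleR_scaleC)
qed

text \<open>The vectors orthogonal to a maximal orthonormal family of eigenvectors of \<open>T\<^sup>*T\<close> with
  \<open>T e \<noteq> 0\<close> form an invariant subspace, on which \<open>T\<close> vanishes since otherwise it would contain
  a further eigenvector. Completing the family to a basis therefore adds only vectors of the
  kernel.\<close>

theorem compact_op_eigenbasis:
  fixes T :: "'a::chilbert_space \<Rightarrow>\<^sub>C\<^sub>L 'b::complex_inner"
  assumes T: "compact_op T"
  obtains B where "is_onb B"
    "\<And>b. b \<in> B \<Longrightarrow> adj T *\<^sub>V T *\<^sub>V b = complex_of_real ((norm (T *\<^sub>V b))\<^sup>2) *\<^sub>C b"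
proof -
  define P where "P e \<longleftrightarrow> T *\<^sub>V e \<noteq> 0 \<and>
    adj T *\<^sub>V T *\<^sub>V e = complex_of_real ((norm (T *\<^sub>V e))\<^sup>2) *\<^sub>C e" for e
  have "orthonormal {}" by (simp add: orthonormal_def)
  then obtain E where E: "orthonormal E" "\<And>e. e \<in> E \<Longrightarrow> P e"
      "\<And>x. norm x = 1 \<Longrightarrow> P x \<Longrightarrow> \<exists>e\<in>E. cinner e x \<noteq> 0"
    by (rule maximal_orthonormal_exists[of "{}" P]) auto
  define M where "M = (\<Inter>e\<in>E. {x. cinner e x = 0})"
  have "complex_vector.subspace M"
    by (rule complex_vector.subspaceI) (simp_all add: M_def cinner_add_right cinner_scaleC_right)
  moreover have "closed M" unfolding M_def
    by (intro closed_INT ballI closed_Collect_eq continuous_on_cinner_right continuous_on_const)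
  moreover have "adj T *\<^sub>V T *\<^sub>V x \<in> M" if x: "x \<in> M" for x
  proof -
    have "cinner e (adj T *\<^sub>V T *\<^sub>V x) = cinner (adj T *\<^sub>V T *\<^sub>V e) x" for e
      by (simp add: cinner_adj_right cinner_adj_left)
    then show ?thesis using x E(2) by (auto simp: M_def P_def cinner_scaleC_left)
  qed
  ultimately have T0: "T *\<^sub>V y = 0" if "y \<in> M" for y
    using extremal_eigenvector_exists[OF T, of M y] that E(3) by (fastforce simp: P_def M_def)
  obtain B where B: "E \<subseteq> B" "is_onb B" using orthonormal_extends_to_onb[OF E(1)] .
  show ?thesis
  proof (rule that[OF B(2)])
    fix b assume b: "b \<in> B"
    show "adj T *\<^sub>V T *\<^sub>V b = complex_of_real ((norm (T *\<^sub>V b))\<^sup>2) *\<^sub>C b"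
    proof (cases "b \<in> E")
      case True
      then show ?thesis using E(2) by (simp add: P_def)
    next
      case False
      then have "b \<in> M"
        using B b by (auto simp: M_def is_onb_iff orthonormal_def)
      then show ?thesis by (simp add: T0 cblinfun_zero)
    qed
  qed
qed

lemma eigenbasis_images_orthogonal:
  fixes T :: "'a::chilbert_space \<Rightarrow>\<^sub>C\<^sub>L 'b::complex_inner"
  assumes "orthonormal B" "b \<in> B" "c \<in> B" "b \<noteq> c"
    and "adj T *\<^sub>V T *\<^sub>V b = complex_of_real ((norm (T *\<^sub>V b))\<^sup>2) *\<^sub>C b"
  shows "cinner (T *\<^sub>V b) (T *\<^sub>V c) = 0"
proof -
  have "cinner (T *\<^sub>V b) (T *\<^sub>V c) = cinner (adj T *\<^sub>V T *\<^sub>V b) c"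
    by (simp add: cinner_adj_left)
  then show ?thesis
    using assms by (simp add: cinner_scaleC_left orthonormal_def)
qed

text \<open>Orthogonal vectors of norm at least \<open>\<epsilon>\<close> are at mutual distance at least \<open>\<epsilon>\<close>, so no infinite
  family of them fits into a compact set.\<close>

lemma finite_large_images:
  fixes T :: "'a::complex_inner \<Rightarrow>\<^sub>C\<^sub>L 'b::complex_inner"
  assumes T: "compact_op T" and B: "\<And>b. b \<in> B \<Longrightarrow> norm b \<le> 1"
    and orth: "\<And>b c. b \<in> B \<Longrightarrow> c \<in> B \<Longrightarrow> b \<noteq> c \<Longrightarrow> cinner (T *\<^sub>V b) (T *\<^sub>V c) = 0"
    and \<epsilon>: "\<epsilon> > 0"
  shows "finite {b\<in>B. norm (T *\<^sub>V b) \<ge> \<epsilon>}"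
proof (rule ccontr)
  assume "infinite {b\<in>B. norm (T *\<^sub>V b) \<ge> \<epsilon>}"
  then obtain f :: "nat \<Rightarrow> 'a" where f: "inj f" "range f \<subseteq> {b\<in>B. norm (T *\<^sub>V b) \<ge> \<epsilon>}"
    using infinite_countable_subset by blast
  have "norm (f n) \<le> 1" for n using f(2) B by blast
  then obtain l r where r: "strict_mono r" "(\<lambda>n. T *\<^sub>V f (r n)) \<longlonglongrightarrow> l"
    using compact_op_convergent_subsequence[OF T] by metis
  then have "Cauchy (\<lambda>n. T *\<^sub>V f (r n))" by (intro LIMSEQ_imp_Cauchy)
  then obtain N where N: "dist (T *\<^sub>V f (r m)) (T *\<^sub>V f (r n)) < \<epsilon>" if "m \<ge> N" "n \<ge> N" for m n
    using \<epsilon> unfolding Cauchy_def by metis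
  define b c where "b = f (r N)" and "c = f (r (Suc N))"
  have "b \<noteq> c" using f(1) r(1) by (simp add: b_def c_def inj_eq strict_mono_eq)
  moreover have bc: "b \<in> B" "c \<in> B" "norm (T *\<^sub>V b) \<ge> \<epsilon>" using f(2) by (auto simp: b_def c_def)
  ultimately have "(norm (T *\<^sub>V b + - (T *\<^sub>V c)))\<^sup>2 = (norm (T *\<^sub>V b))\<^sup>2 + (norm (- (T *\<^sub>V c)))\<^sup>2"
    by (intro norm_add_orthogonal) (simp add: cinner_minus_right orth)
  then have "(norm (T *\<^sub>V b))\<^sup>2 \<le> (dist (T *\<^sub>V b) (T *\<^sub>V c))\<^sup>2" by (simp add: dist_norm)
  then have "norm (T *\<^sub>V b) \<le> dist (T *\<^sub>V b) (T *\<^sub>V c)" by (rule power2_le_imp_le) simp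
  then show False using N[of N "Suc N"] bc(3) by (simp add: b_def c_def)
qed


section \<open>Operators prescribed on an orthonormal basis\<close>

lemma norm_sum_orthogonal:
  fixes f :: "'i \<Rightarrow> 'a::complex_inner"
  assumes "\<And>i j. i \<in> F \<Longrightarrow> j \<in> F \<Longrightarrow> i \<noteq> j \<Longrightarrow> cinner (f i) (f j) = 0"
  shows "(norm (\<Sum>i\<in>F. f i))\<^sup>2 = (\<Sum>i\<in>F. (norm (f i))\<^sup>2)"
  using assms
proof (induction F rule: infinite_finite_induct)
  case (insert i F)
  then have "cinner (f i) (\<Sum>j\<in>F. f j) = 0"
    by (auto simp: cinner_sum_right intro!: sum.neutral)
  then show ?case using insert by (simp add: norm_add_orthogonal)
qed auto

text \<open>The squared norm of a finite partial sum is the sum of the squared norms, so the Cauchy condition for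
  the series of squares is the Cauchy condition for the series of vectors.\<close>

lemma orthogonal_series_summable:
  fixes f :: "'i \<Rightarrow> 'a::chilbert_space"
  assumes orth: "\<And>i j. i \<in> I \<Longrightarrow> j \<in> I \<Longrightarrow> i \<noteq> j \<Longrightarrow> cinner (f i) (f j) = 0"
    and sq: "(\<lambda>i. (norm (f i))\<^sup>2) summable_on I"
  shows "f summable_on I"
proof -
  have "\<exists>P. eventually P (finite_subsets_at_top I) \<and>
      (\<forall>F F'. P F \<and> P F' \<longrightarrow> dist (sum f F) (sum f F') < e)" if e: "e > 0" for e
  proof -
    obtain L where L: "((\<lambda>i. (norm (f i))\<^sup>2) has_sum L) I" using sq by (auto simp: summable_on_def)
    have "(e/2)\<^sup>2 > 0" using e by simp
    then obtain F0 where F0: "finite F0" "F0 \<subseteq> I" "dist (\<Sum>i\<in>F0. (norm (f i))\<^sup>2) L \<le> (e/2)\<^sup>2 / 2"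
      using has_sum_finite_approximation[OF L, of "(e/2)\<^sup>2 / 2"] by auto
    have *: "dist (sum f F) (sum f F0) < e / 2" if F: "finite F" "F0 \<subseteq> F" "F \<subseteq> I" for F
    proof -
      have "(\<Sum>i\<in>F. (norm (f i))\<^sup>2) \<le> L"
        by (rule finite_sum_le_has_sum[OF L]) (use F in auto)
      then have "(\<Sum>i\<in>F - F0. (norm (f i))\<^sup>2) \<le> (e/2)\<^sup>2 / 2"
        using F0(3) unfolding sum_diff[OF F(1,2)] dist_real_def by linarith
      moreover have "(norm (sum f (F - F0)))\<^sup>2 = (\<Sum>i\<in>F - F0. (norm (f i))\<^sup>2)"
        by (rule norm_sum_orthogonal) (use orth F(3) in auto)
      ultimately have "(norm (sum f (F - F0)))\<^sup>2 < (e/2)\<^sup>2" using \<open>(e/2)\<^sup>2 > 0\<close> by linarith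
      then have "norm (sum f (F - F0)) < e/2" by (rule power_less_imp_less_base) (use e in simp)
      then show ?thesis by (simp add: dist_norm sum_diff[OF F(1,2)])
    qed
    show ?thesis
    proof (intro exI conjI allI impI)
      show "eventually (\<lambda>F. finite F \<and> F0 \<subseteq> F \<and> F \<subseteq> I) (finite_subsets_at_top I)"
        unfolding eventually_finite_subsets_at_top using F0 by blast
      fix F F' assume "(finite F \<and> F0 \<subseteq> F \<and> F \<subseteq> I) \<and> (finite F' \<and> F0 \<subseteq> F' \<and> F' \<subseteq> I)"
      then show "dist (sum f F) (sum f F') < e"
        using *[of F] *[of F'] dist_triangle_half_l by blast
    qed
  qed
  then have "cauchy_filter (filtermap (sum f) (finite_subsets_at_top I))"
    by (simp add: cauchy_filter_metric_filtermap)
  moreover have "complete (UNIV::'a set)"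
    by (meson Cauchy_convergent UNIV_I complete_def convergent_def)
  ultimately have "\<exists>l. filtermap (sum f) (finite_subsets_at_top I) \<le> nhds l"
    using complete_uniform[where S=UNIV] by (force simp add: filterlim_def)
  then show ?thesis by (auto simp: summable_on_def has_sum_def filterlim_def)
qed

lemma norm_orthogonal_series_le:
  fixes f :: "'a::complex_inner \<Rightarrow> 'b::complex_inner"
  assumes B: "is_onb B" and f: "(f has_sum v) B"
    and orth: "\<And>b c. b \<in> B \<Longrightarrow> c \<in> B \<Longrightarrow> b \<noteq> c \<Longrightarrow> cinner (f b) (f c) = 0"
    and le: "\<And>b. b \<in> B \<Longrightarrow> norm (f b) \<le> \<delta> * cmod (cinner b x)" and \<delta>: "\<delta> \<ge> 0"
  shows "norm v \<le> \<delta> * norm x"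
proof (rule tendsto_upperbound)
  show "((\<lambda>F. norm (sum f F)) \<longlongrightarrow> norm v) (finite_subsets_at_top B)"
    using f unfolding has_sum_def by (rule tendsto_norm)
  have "norm (sum f F) \<le> \<delta> * norm x" if F: "finite F" "F \<subseteq> B" for F
  proof (rule power2_le_imp_le)
    have "(norm (sum f F))\<^sup>2 = (\<Sum>b\<in>F. (norm (f b))\<^sup>2)"
      by (rule norm_sum_orthogonal) (use orth F in auto)
    also have "\<dots> \<le> (\<Sum>b\<in>F. (\<delta> * cmod (cinner b x))\<^sup>2)"
      using le F by (intro sum_mono power_mono) auto
    also have "\<dots> = \<delta>\<^sup>2 * (\<Sum>b\<in>F. (cmod (cinner b x))\<^sup>2)"
      by (simp add: power_mult_distrib sum_distrib_left)
    also have "\<dots> \<le> \<delta>\<^sup>2 * (norm x)\<^sup>2"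
      using finite_sum_le_has_sum[OF has_sum_parseval_norm[OF B, of x]] F
      by (intro mult_left_mono) auto
    finally show "(norm (sum f F))\<^sup>2 \<le> (\<delta> * norm x)\<^sup>2" by (simp add: power_mult_distrib)
  qed (use \<delta> in simp)
  then show "\<forall>\<^sub>F F in finite_subsets_at_top B. norm (sum f F) \<le> \<delta> * norm x"
    by (auto intro: eventually_finite_subsets_at_top_weakI)
qed simp

text \<open>Mutual orthogonality of the prescribed images is what makes their uniform boundedness sufficient:
  the norm of \<open>\<Sum>\<^sub>b \<langle>b, x\<rangle> g b\<close> is then controlled by that of \<open>x\<close>.\<close>

lemma operator_on_onb_exists:
  fixes g :: "'a::complex_inner \<Rightarrow> 'b::chilbert_space"
  assumes B: "is_onb B"
    and orth: "\<And>b c. b \<in> B \<Longrightarrow> c \<in> B \<Longrightarrow> b \<noteq> c \<Longrightarrow> cinner (g b) (g c) = 0"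
    and bound: "\<And>b. b \<in> B \<Longrightarrow> norm (g b) \<le> C"
  obtains T where "\<And>b. b \<in> B \<Longrightarrow> T *\<^sub>V b = g b"
proof -
  have on: "orthonormal B" using B by (simp add: is_onb_iff)
  define f where "f x = (\<Sum>\<^sub>\<infinity>b\<in>B. cinner b x *\<^sub>C g b)" for x
  have bd: "norm (cinner b x *\<^sub>C g b) \<le> max 0 C * cmod (cinner b x)" if "b \<in> B" for b x
    using bound[OF that] by (simp add: norm_scaleC mult.commute[of "cmod _"] mult_right_mono)
  have orth': "cinner (cinner b x *\<^sub>C g b) (cinner c x *\<^sub>C g c) = 0"
    if "b \<in> B" "c \<in> B" "b \<noteq> c" for b c x
    using orth[OF that] by (simp add: cinner_scaleC_left cinner_scaleC_right)
  have f: "((\<lambda>b. cinner b x *\<^sub>C g b) has_sum f x) B" for x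
    unfolding f_def
  proof (rule has_sum_infsum, rule orthogonal_series_summable)
    have "(\<lambda>b. (max 0 C)\<^sup>2 * (cmod (cinner b x))\<^sup>2) summable_on B"
      using has_sum_parseval_norm[OF B, of x] by (intro summable_on_cmult_right) (auto simp: summable_on_def)
    then show "(\<lambda>b. (norm (cinner b x *\<^sub>C g b))\<^sup>2) summable_on B"
      by (rule summable_on_comparison_test)
        (use power_mono[OF bd, of _ _ 2] in \<open>auto simp: power_mult_distrib\<close>)
  qed (use orth' in blast)
  have add: "f (x + y) = f x + f y" for x y
    using has_sum_add[OF f[of x] f[of y]] f[of "x + y"] has_sum_unique
    by (fastforce simp: cinner_add_right scaleC_add_left)
  have scale: "f (c *\<^sub>C x) = c *\<^sub>C f x" for c x
    using has_sum_bounded_linear[OF bounded_linear_scaleC f[of x], of c] f[of "c *\<^sub>C x"] has_sum_unique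
    by (fastforce simp: cinner_scaleC_right scaleC_scaleC o_def)
  have "bounded_linear f"
    by (rule bounded_linear_intro[where K = "max 0 C"])
      (use norm_orthogonal_series_le[OF B f orth' bd] in
        \<open>auto simp: add scale scaleR_scaleC mult.commute[of "norm _"]\<close>)
  then have T: "Cblinfun f *\<^sub>V x = f x" for x by (simp add: Cblinfun_apply scale)
  show ?thesis
  proof (rule that)
    fix b assume b: "b \<in> B"
    have "((\<lambda>c. cinner c b *\<^sub>C g c) has_sum g b) B"
      by (rule has_sum_finite_neutralI[of "{b}"])
        (use b on in \<open>auto simp: orthonormal_def scaleC_one\<close>)
    then show "Cblinfun f *\<^sub>V b = g b" using f[of b] T has_sum_unique by metis
  qed
qed

lemma compact_bounded_combinations:
  fixes g :: "'i \<Rightarrow> 'b::complex_inner"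
  assumes "finite F"
  shows "compact {\<Sum>b\<in>F. c b *\<^sub>C g b | c. \<forall>b\<in>F. cmod (c b) \<le> 1}"
  using assms
proof (induction F rule: finite_induct)
  case (insert a F)
  have "compact ((\<lambda>z. z *\<^sub>C g a) ` cball 0 1)"
    by (intro compact_continuous_image linear_continuous_on bounded_linear_scaleC_left compact_cball)
  from compact_sums[OF this insert.IH]
  have "compact {x + y | x y. x \<in> (\<lambda>z. z *\<^sub>C g a) ` cball 0 1 \<and>
      y \<in> {\<Sum>b\<in>F. c b *\<^sub>C g b | c. \<forall>b\<in>F. cmod (c b) \<le> 1}}" .
  also have "{x + y | x y. x \<in> (\<lambda>z. z *\<^sub>C g a) ` cball 0 1 \<and>
      y \<in> {\<Sum>b\<in>F. c b *\<^sub>C g b | c. \<forall>b\<in>F. cmod (c b) \<le> 1}}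
    = {\<Sum>b\<in>insert a F. c b *\<^sub>C g b | c. \<forall>b\<in>insert a F. cmod (c b) \<le> 1}" (is "?L = ?R")
  proof
    show "?R \<subseteq> ?L" using insert(1,2) by fastforce
    show "?L \<subseteq> ?R"
    proof clarify
      fix z c assume z: "z \<in> cball (0::complex) 1" and c: "\<forall>b\<in>F. cmod (c b) \<le> 1"
      have "(\<Sum>b\<in>F. c b *\<^sub>C g b) = (\<Sum>b\<in>F. (c(a := z)) b *\<^sub>C g b)"
        by (rule sum.cong) (use insert(2) in auto)
      then show "\<exists>c'. z *\<^sub>C g a + (\<Sum>b\<in>F. c b *\<^sub>C g b) = (\<Sum>b\<in>insert a F. c' b *\<^sub>C g b) \<and>
          (\<forall>b\<in>insert a F. cmod (c' b) \<le> 1)"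
        using insert(1,2) z c by (intro exI[of _ "c(a := z)"]) auto
    qed
  qed
  finally show ?case .
qed simp

text \<open>The finitely many basis vectors with large image contribute a compact part of the image of the unit
  ball, and the others contribute vectors of norm at most \<open>e/4\<close>, so the image is totally bounded.\<close>

lemma compact_op_if_images_vanish:
  fixes T :: "'a::complex_inner \<Rightarrow>\<^sub>C\<^sub>L 'b::chilbert_space"
  assumes B: "is_onb B"
    and orth: "\<And>b c. b \<in> B \<Longrightarrow> c \<in> B \<Longrightarrow> b \<noteq> c \<Longrightarrow> cinner (T *\<^sub>V b) (T *\<^sub>V c) = 0"
    and fin: "\<And>\<epsilon>. \<epsilon> > 0 \<Longrightarrow> finite {b\<in>B. norm (T *\<^sub>V b) \<ge> \<epsilon>}"
  shows "compact_op T"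
  unfolding compact_op_def compact_eq_totally_bounded
proof (intro conjI allI impI)
  let ?S = "cblinfun_apply T ` cball 0 1"
  show "complete (closure ?S)" by (simp add: complete_eq_closed)
  fix e :: real assume e: "e > 0"
  have on: "orthonormal B" using B by (simp add: is_onb_iff)
  define F where "F = {b\<in>B. norm (T *\<^sub>V b) \<ge> e/4}"
  have F: "finite F" "F \<subseteq> B" using fin[of "e/4"] e by (auto simp: F_def)
  define K where "K = {\<Sum>b\<in>F. c b *\<^sub>C (T *\<^sub>V b) | c. \<forall>b\<in>F. cmod (c b) \<le> 1}"
  have "compact K" unfolding K_def by (rule compact_bounded_combinations[OF F(1)])
  then obtain k where k: "finite k" "K \<subseteq> (\<Union>x\<in>k. ball x (e/4))"
    unfolding compact_eq_totally_bounded using e by (meson divide_pos_pos zero_less_numeral)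
  have "?S \<subseteq> (\<Union>x\<in>k. cball x (e/2))"
  proof clarify
    fix x :: 'a assume x: "x \<in> cball 0 1"
    have coeff: "cmod (cinner b x) \<le> 1" if "b \<in> B" for b
      using cmod_cinner_le[of b x] orthonormal_norm[OF on that] x by simp
    define p where "p = (\<Sum>b\<in>F. cinner b x *\<^sub>C b)"
    have Tp: "T *\<^sub>V p = (\<Sum>b\<in>F. cinner b x *\<^sub>C (T *\<^sub>V b))"
      by (simp add: p_def cblinfun_sum cblinfun_scaleC)
    then have "T *\<^sub>V p \<in> K" using coeff F(2) by (auto simp: K_def intro!: exI[of _ "\<lambda>b. cinner b x"])
    then obtain y where y: "y \<in> k" "dist y (T *\<^sub>V p) < e/4" using k(2) by auto
    have cxp: "cinner b (x - p) = (if b \<in> F then 0 else cinner b x)" if "b \<in> B" for b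
      using cinner_sum_orthonormal[OF on F that, of "\<lambda>b. cinner b x"] by (simp add: cinner_diff_right p_def)
    have "norm (T *\<^sub>V (x - p)) \<le> e/4 * norm x"
    proof (rule norm_orthogonal_series_le[OF B has_sum_cblinfun_fourier[OF B]])
      show "norm (cinner b (x - p) *\<^sub>C (T *\<^sub>V b)) \<le> e/4 * cmod (cinner b x)" if "b \<in> B" for b
      proof (cases "b \<in> F")
        case False
        then have "norm (T *\<^sub>V b) * cmod (cinner b x) \<le> e/4 * cmod (cinner b x)"
          using that by (intro mult_right_mono) (auto simp: F_def)
        with False show ?thesis using cxp[OF that] by (simp add: norm_scaleC mult.commute)
      qed (use cxp[OF that] e in simp)
    qed (use orth e in \<open>auto simp: cinner_scaleC_left cinner_scaleC_right\<close>)
    also have "\<dots> \<le> e/4 * 1" using x e by (intro mult_left_mono) auto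
    finally have "dist (T *\<^sub>V p) (T *\<^sub>V x) \<le> e/4"
      by (simp add: cblinfun_diff dist_norm norm_minus_commute)
    then have "dist y (T *\<^sub>V x) \<le> e/2" using y(2) dist_triangle[of y "T *\<^sub>V x" "T *\<^sub>V p"] by simp
    then show "T *\<^sub>V x \<in> (\<Union>x\<in>k. cball x (e/2))" using y(1) by auto
  qed
  then have "closure ?S \<subseteq> (\<Union>x\<in>k. cball x (e/2))"
    by (rule closure_minimal) (use k(1) in auto)
  also have "\<dots> \<subseteq> (\<Union>x\<in>k. ball x e)" using e by force
  finally show "\<exists>k. finite k \<and> closure ?S \<subseteq> (\<Union>x\<in>k. ball x e)" using k(1) by blast
qed


section \<open>Sums over finite subsets and over finite products\<close>

lemma has_sum_prod_PiE:
  fixes f :: "'a \<Rightarrow> 'b \<Rightarrow> complex"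
  assumes S: "finite S" and f: "\<And>e. e \<in> S \<Longrightarrow> (\<lambda>k. norm (f e k)) summable_on I e"
    and M: "\<And>e. e \<in> S \<Longrightarrow> (f e has_sum M e) (I e)"
  shows "((\<lambda>g. \<Prod>e\<in>S. f e (g e)) has_sum (\<Prod>e\<in>S. M e)) (PiE S I)"
proof -
  have "(\<lambda>g. norm (\<Prod>e\<in>S. f e (g e))) summable_on PiE S I"
  proof (rule nonneg_bounded_partial_sums_imp_summable_on)
    show "\<forall>\<^sub>F \<Phi> in finite_subsets_at_top (PiE S I).
        (\<Sum>g\<in>\<Phi>. norm (\<Prod>e\<in>S. f e (g e))) \<le> (\<Prod>e\<in>S. \<Sum>\<^sub>\<infinity>k\<in>I e. norm (f e k))"
    proof (rule eventually_finite_subsets_at_top_weakI)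
      fix \<Phi> assume \<Phi>: "finite \<Phi>" "\<Phi> \<subseteq> PiE S I"
      define F where "F e = (\<lambda>g. g e) ` \<Phi>" for e
      have F: "finite (F e)" "e \<in> S \<Longrightarrow> F e \<subseteq> I e" for e using \<Phi> by (auto simp: F_def)
      have sub: "\<Phi> \<subseteq> PiE S F" using \<Phi>(2) by (auto simp: F_def PiE_def)
      have "(\<Sum>g\<in>\<Phi>. norm (\<Prod>e\<in>S. f e (g e))) \<le> (\<Sum>g\<in>PiE S F. norm (\<Prod>e\<in>S. f e (g e)))"
        by (rule sum_mono2[OF finite_PiE[OF S F(1)] sub]) auto
      also have "\<dots> = (\<Prod>e\<in>S. \<Sum>k\<in>F e. norm (f e k))"
        using prod_sum_PiE[OF S F(1), of "\<lambda>e k. norm (f e k)"] by (simp add: prod_norm)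
      also have "\<dots> \<le> (\<Prod>e\<in>S. \<Sum>\<^sub>\<infinity>k\<in>I e. norm (f e k))"
        using F f by (intro prod_mono conjI sum_nonneg finite_sum_le_infsum) auto
      finally show "(\<Sum>g\<in>\<Phi>. norm (\<Prod>e\<in>S. f e (g e))) \<le> (\<Prod>e\<in>S. \<Sum>\<^sub>\<infinity>k\<in>I e. norm (f e k))" .
    qed
  qed simp
  then have "((\<lambda>g. \<Prod>e\<in>S. f e (g e)) has_sum infsum (\<lambda>g. \<Prod>e\<in>S. f e (g e)) (PiE S I)) (PiE S I)"
    by (rule has_sum_infsum[OF abs_summable_summable])
  also have "infsum (\<lambda>g. \<Prod>e\<in>S. f e (g e)) (PiE S I) = (\<Prod>e\<in>S. infsum (f e) (I e))"
    by (rule infsum_prod_PiE_abs[OF S]) (rule f)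
  also have "\<dots> = (\<Prod>e\<in>S. M e)" by (rule prod.cong[OF HOL.refl]) (rule infsumI[OF M])
  finally show ?thesis .
qed

text \<open>\<open>weighted_fact_sum s m F\<close> grows by the term
  \<open>s x * weighted_fact_sum s (Suc m) F\<close> when \<open>x\<close> is added to \<open>F\<close>; the shift \<open>m\<close> is what makes
  this recursion close up.\<close>

definition weighted_fact_sum :: "('i \<Rightarrow> real) \<Rightarrow> nat \<Rightarrow> 'i set \<Rightarrow> real"
  where "weighted_fact_sum s m F = (\<Sum>J\<in>Pow F. fact (m + card J) * (\<Prod>k\<in>J. s k))"

lemma weighted_fact_sum_insert:
  assumes "finite F" "x \<notin> F"
  shows "weighted_fact_sum s m (insert x F) = weighted_fact_sum s m F + s x * weighted_fact_sum s (Suc m) F"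
proof -
  have "weighted_fact_sum s m (insert x F) = weighted_fact_sum s m F
      + (\<Sum>J\<in>insert x ` Pow F. fact (m + card J) * (\<Prod>k\<in>J. s k))"
    unfolding weighted_fact_sum_def Pow_insert
    by (rule sum.union_disjoint) (use assms in auto)
  also have "(\<Sum>J\<in>insert x ` Pow F. fact (m + card J) * (\<Prod>k\<in>J. s k))
      = (\<Sum>J\<in>Pow F. fact (m + card (insert x J)) * (\<Prod>k\<in>insert x J. s k))"
    by (subst sum.reindex) (use assms(2) in \<open>auto simp: inj_on_def\<close>)
  also have "\<dots> = s x * weighted_fact_sum s (Suc m) F"
    unfolding weighted_fact_sum_def sum_distrib_left
  proof (rule sum.cong)
    fix J assume "J \<in> Pow F"
    then have "finite J" "x \<notin> J" using assms finite_subset by auto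
    then show "fact (m + card (insert x J)) * (\<Prod>k\<in>insert x J. s k)
        = s x * (fact (Suc m + card J) * (\<Prod>k\<in>J. s k))" by simp
  qed simp
  finally show ?thesis .
qed

lemma weighted_fact_sum_le:
  assumes "finite F" "\<And>x. x \<in> F \<Longrightarrow> s x \<ge> 0" "(\<Sum>x\<in>F. s x) < 1"
  shows "weighted_fact_sum s m F \<le> fact m / (1 - (\<Sum>x\<in>F. s x)) ^ Suc m"
  using assms
proof (induction F arbitrary: m rule: finite_induct)
  case empty
  then show ?case by (simp add: weighted_fact_sum_def)
next
  case (insert x F)
  define q where "q = 1 - (\<Sum>y\<in>F. s y)"
  have sx: "s x \<ge> 0" and q: "q - s x > 0" using insert by (auto simp: q_def)
  have q0: "q > 0" using sx q by linarith
  \<comment> \<open>The two terms of the recursion are the start of the binomial expansion of \<open>(1 + s x / q)\<^bsup>m+1\<^esup>\<close>.\<close>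
  have "1 + real (Suc m) * (s x / q) \<le> (1 + s x / q) ^ Suc m"
    by (rule Bernoulli_inequality) (use sx q0 in \<open>simp add: order.trans[OF _ divide_nonneg_pos]\<close>)
  also have "\<dots> \<le> (q / (q - s x)) ^ Suc m"
    using sx q q0 by (intro power_mono) (auto simp: field_simps)
  finally have "fact m / q ^ Suc m * (1 + real (Suc m) * (s x / q))
      \<le> fact m / q ^ Suc m * (q / (q - s x)) ^ Suc m"
    using q0 by (intro mult_left_mono) auto
  also have "\<dots> = fact m / (q - s x) ^ Suc m" using q0 by (simp add: power_divide)
  finally have *: "fact m / q ^ Suc m + s x * (fact (Suc m) / q ^ Suc (Suc m)) \<le> fact m / (q - s x) ^ Suc m"
    using q0 by (simp add: field_simps)
  have "weighted_fact_sum s m (insert x F) \<le> fact m / q ^ Suc m + s x * (fact (Suc m) / q ^ Suc (Suc m))"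
    unfolding weighted_fact_sum_insert[OF insert(1,2)] q_def
    using insert sx q0 by (intro add_mono mult_left_mono insert.IH) (auto simp: q_def)
  also note *
  also have "q - s x = 1 - (\<Sum>y\<in>insert x F. s y)" using insert(1,2) by (simp add: q_def)
  finally show ?case .
qed

text \<open>The factorials are harmless: after removing finitely many indices the weights have sum
  below \<open>1\<close>, where the bound of \<open>weighted_fact_sum_le\<close> applies, and the removed indices
  are put back one at a time by the recursion.\<close>

lemma fact_card_prod_summable:
  fixes s :: "'i \<Rightarrow> real"
  assumes nonneg: "\<And>i. i \<in> I \<Longrightarrow> s i \<ge> 0" and s: "s summable_on I"
  shows "(\<lambda>J. fact (card J) * (\<Prod>k\<in>J. s k)) summable_on {J. finite J \<and> J \<subseteq> I}"
proof -
  obtain L where L: "(s has_sum L) I" using s by (auto simp: summable_on_def)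
  then obtain N where N: "finite N" "N \<subseteq> I" "dist (sum s N) L \<le> 1/2"
    using has_sum_finite_approximation[OF L, of "1/2"] by auto
  have tail: "\<exists>C. \<forall>F. finite F \<and> F \<subseteq> I - N \<longrightarrow> weighted_fact_sum s m F \<le> C" for m
  proof (intro exI allI impI)
    fix F assume F: "finite F \<and> F \<subseteq> I - N"
    have "sum s (N \<union> F) \<le> L" by (rule finite_sum_le_has_sum[OF L]) (use N F nonneg in auto)
    moreover have "sum s (N \<union> F) = sum s N + sum s F"
      by (rule sum.union_disjoint) (use N F in auto)
    ultimately have le: "sum s F \<le> 1/2" using N(3) unfolding dist_real_def by linarith
    have "weighted_fact_sum s m F \<le> fact m / (1 - sum s F) ^ Suc m"
      by (rule weighted_fact_sum_le) (use F nonneg le in auto)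
    also have "\<dots> \<le> fact m / (1/2) ^ Suc m"
      using le by (intro divide_left_mono power_mono mult_pos_pos zero_less_power) auto
    finally show "weighted_fact_sum s m F \<le> fact m / (1/2) ^ Suc m" .
  qed
  have "\<exists>C. \<forall>F. finite F \<and> F \<subseteq> (I - N) \<union> N' \<longrightarrow> weighted_fact_sum s m F \<le> C"
    if "finite N'" "N' \<subseteq> N" for m N'
    using that
  proof (induction N' arbitrary: m rule: finite_induct)
    case empty
    then show ?case using tail by simp
  next
    case (insert x N')
    obtain C where C: "\<And>F. finite F \<Longrightarrow> F \<subseteq> (I - N) \<union> N' \<Longrightarrow> weighted_fact_sum s m F \<le> C"
      using insert by fastforce
    obtain C' where C': "\<And>F. finite F \<Longrightarrow> F \<subseteq> (I - N) \<union> N' \<Longrightarrow> weighted_fact_sum s (Suc m) F \<le> C'"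
      using insert by fastforce
    have sx: "s x \<ge> 0" using insert N nonneg by auto
    have C'0: "C' \<ge> 0" using C'[of "{}"] by (auto simp: weighted_fact_sum_def intro: order_trans[OF _ C'[of "{}"]])
    show ?case
    proof (intro exI allI impI)
      fix F assume F: "finite F \<and> F \<subseteq> (I - N) \<union> insert x N'"
      show "weighted_fact_sum s m F \<le> C + s x * C'"
      proof (cases "x \<in> F")
        case True
        then have F': "F = insert x (F - {x})" "finite (F - {x})" "F - {x} \<subseteq> (I - N) \<union> N'"
          using F by auto
        have "weighted_fact_sum s m F
            = weighted_fact_sum s m (F - {x}) + s x * weighted_fact_sum s (Suc m) (F - {x})"
          using weighted_fact_sum_insert[OF F'(2), of x s m] F'(1) by simp
        also have "\<dots> \<le> C + s x * C'"
          using F' sx by (intro add_mono mult_left_mono C C') auto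
        finally show ?thesis .
      next
        case False
        then have "weighted_fact_sum s m F \<le> C" using F by (intro C) auto
        then show ?thesis using sx C'0 by (simp add: add_increasing2)
      qed
    qed
  qed
  from this[OF N(1) subset_refl, of 0] N(2)
  obtain C where C: "\<And>F. finite F \<Longrightarrow> F \<subseteq> I \<Longrightarrow> weighted_fact_sum s 0 F \<le> C"
    by (auto simp: Un_absorb2)
  show ?thesis
  proof (rule nonneg_bounded_partial_sums_imp_summable_on)
    show "fact (card J) * (\<Prod>k\<in>J. s k) \<ge> 0" if "J \<in> {J. finite J \<and> J \<subseteq> I}" for J
      using that nonneg by (auto intro!: mult_nonneg_nonneg prod_nonneg)
    show "\<forall>\<^sub>F \<Phi> in finite_subsets_at_top {J. finite J \<and> J \<subseteq> I}.
        (\<Sum>J\<in>\<Phi>. fact (card J) * (\<Prod>k\<in>J. s k)) \<le> C"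
    proof (rule eventually_finite_subsets_at_top_weakI)
      fix \<Phi> assume \<Phi>: "finite \<Phi>" "\<Phi> \<subseteq> {J. finite J \<and> J \<subseteq> I}"
      then have un: "finite (\<Union>\<Phi>)" "\<Union>\<Phi> \<subseteq> I" by auto
      have "(\<Sum>J\<in>\<Phi>. fact (card J) * (\<Prod>k\<in>J. s k)) \<le> weighted_fact_sum s 0 (\<Union>\<Phi>)"
        unfolding weighted_fact_sum_def add_0
      proof (rule sum_mono2)
        fix J assume "J \<in> Pow (\<Union>\<Phi>) - \<Phi>"
        then have "s k \<ge> 0" if "k \<in> J" for k using that un(2) nonneg by blast
        then show "0 \<le> fact (card J) * (\<Prod>k\<in>J. s k)" by (intro mult_nonneg_nonneg prod_nonneg) auto
      qed (use un(1) in auto)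
      also have "\<dots> \<le> C" using C un by blast
      finally show "(\<Sum>J\<in>\<Phi>. fact (card J) * (\<Prod>k\<in>J. s k)) \<le> C" .
    qed
  qed
qed


section \<open>A Cauchy-Binet formula for infinite matrices\<close>

definition leibniz_det :: "'a set \<Rightarrow> ('a \<Rightarrow> 'a \<Rightarrow> complex) \<Rightarrow> complex"
  where "leibniz_det S M = (\<Sum>p | p permutes S. of_int (sign p) * (\<Prod>e\<in>S. M e (p e)))"

lemma bij_betw_map_permutation:
  assumes "bij_betw f A B"
  shows "bij_betw (map_permutation A f) {p. p permutes A} {p. p permutes B}"
proof (rule bij_betw_byWitness[where f' = "map_permutation B (inv_into A f)"])
  note inv = bij_betw_inv_into[OF assms]
  show "\<forall>p\<in>{p. p permutes A}. map_permutation B (inv_into A f) (map_permutation A f p) = p"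
    by (intro ballI map_permutation_compose_inv[OF assms])
      (simp_all add: bij_betw_inv_into_left[OF assms])
  show "\<forall>p\<in>{p. p permutes B}. map_permutation A f (map_permutation B (inv_into A f) p) = p"
    by (intro ballI map_permutation_compose_inv[OF inv])
      (simp_all add: bij_betw_inv_into_right[OF assms])
  show "map_permutation A f ` {p. p permutes A} \<subseteq> {p. p permutes B}"
    by (intro image_subsetI CollectI map_permutation_permutes[OF assms]) simp
  show "map_permutation B (inv_into A f) ` {p. p permutes B} \<subseteq> {p. p permutes A}"
    by (intro image_subsetI CollectI map_permutation_permutes[OF inv]) simp
qed

lemma leibniz_det_reindex:
  assumes S: "finite S" and inj: "inj_on g S"
  shows "leibniz_det (g ` S) M = leibniz_det S (\<lambda>e f. M (g e) (g f))"
  unfolding leibniz_det_def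
  by (subst sum.reindex_bij_betw[OF bij_betw_map_permutation[OF inj_on_imp_bij_betw[OF inj]], symmetric],
      rule sum.cong)
    (auto simp: prod.reindex[OF inj] sign_map_permutation[OF inj _ S] map_permutation_apply[OF inj])

text \<open>If no entry leads from \<open>A\<close> to \<open>B\<close>, a permutation with nonzero product maps \<open>A\<close> into \<open>A\<close>, so it
  is a product of a permutation of \<open>A\<close> and one of \<open>B\<close>.\<close>

lemma leibniz_det_block_triangular:
  fixes M :: "'a \<Rightarrow> 'a \<Rightarrow> complex"
  assumes fin: "finite A" "finite B" and disj: "A \<inter> B = {}"
    and zero: "\<And>e f. e \<in> A \<Longrightarrow> f \<in> B \<Longrightarrow> M e f = 0"
  shows "leibniz_det (A \<union> B) M = leibniz_det A M * leibniz_det B M"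
proof -
  let ?t = "\<lambda>p. of_int (sign p) * (\<Prod>e\<in>A \<union> B. M e (p e))"
  let ?P = "{p. p permutes A} \<times> {q. q permutes B}"
  have bij: "bij_betw (\<lambda>(p, q). p \<circ> q) ?P {p. p permutes (A \<union> B) \<and> p ` A \<subseteq> A}"
  proof (rule bij_betw_byWitness[where f' = "\<lambda>p. (\<lambda>x. if x \<in> A then p x else x, \<lambda>x. if x \<in> B then p x else x)"])
    have pq: "p (q x) = (if x \<in> A then p x else q x)" if "p permutes A" "q permutes B" for p q x
    proof (cases "x \<in> A")
      case True
      then have "x \<notin> B" using disj by auto
      then show ?thesis using True permutes_not_in[OF that(2)] by simp
    next
      case False
      then have "q x \<notin> A"
        using disj permutes_in_image[OF that(2), of x] permutes_not_in[OF that(2), of x] by auto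
      then show ?thesis using False permutes_not_in[OF that(1)] by simp
    qed
    show "\<forall>z\<in>?P. (\<lambda>p. (\<lambda>x. if x \<in> A then p x else x, \<lambda>x. if x \<in> B then p x else x)) ((\<lambda>(p, q). p \<circ> q) z) = z"
      using disj by (auto simp: fun_eq_iff pq permutes_not_in)
    have inA: "p x \<in> A \<longleftrightarrow> x \<in> A" "p x \<in> B \<longleftrightarrow> x \<in> B" if p: "p permutes (A \<union> B)" "p ` A \<subseteq> A" for p x
    proof -
      have "p ` A = A"
        using endo_inj_surj[OF fin(1) p(2)] permutes_inj[OF p(1)] inj_on_subset by blast
      then show A: "p x \<in> A \<longleftrightarrow> x \<in> A" for x
        using permutes_inj[OF p(1)] by (metis image_iff injD)
      show "p x \<in> B \<longleftrightarrow> x \<in> B"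
        using A[of x] permutes_in_image[OF p(1), of x] disj by auto
    qed
    show "\<forall>p\<in>{p. p permutes (A \<union> B) \<and> p ` A \<subseteq> A}.
        (\<lambda>(p, q). p \<circ> q) (\<lambda>x. if x \<in> A then p x else x, \<lambda>x. if x \<in> B then p x else x) = p"
      using disj by (auto simp: fun_eq_iff inA permutes_not_in)
    show "(\<lambda>(p, q). p \<circ> q) ` ?P \<subseteq> {p. p permutes (A \<union> B) \<and> p ` A \<subseteq> A}"
    proof clarify
      fix p q assume pq': "p permutes A" "q permutes B"
      have "p \<circ> q permutes (A \<union> B)"
        by (rule permutes_compose[OF permutes_subset[OF pq'(2)] permutes_subset[OF pq'(1)]]) auto
      moreover have "(p \<circ> q) ` A \<subseteq> A" using pq[OF pq'] permutes_in_image[OF pq'(1)] by auto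
      ultimately show "p \<circ> q permutes (A \<union> B) \<and> (p \<circ> q) ` A \<subseteq> A" ..
    qed
    have restr: "(\<lambda>x. if x \<in> C then p x else x) permutes C"
      if "finite C" "inj p" "\<And>x. p x \<in> C \<longleftrightarrow> x \<in> C" for p :: "'a \<Rightarrow> 'a" and C
      by (rule inj_imp_permutes) (use that in \<open>auto simp: inj_def inj_on_def\<close>)
    show "(\<lambda>p. (\<lambda>x. if x \<in> A then p x else x, \<lambda>x. if x \<in> B then p x else x)) `
        {p. p permutes (A \<union> B) \<and> p ` A \<subseteq> A} \<subseteq> ?P"
      using fin inA permutes_inj by (intro image_subsetI SigmaI CollectI restr) blast+
  qed
  have "leibniz_det (A \<union> B) M = (\<Sum>p | p permutes (A \<union> B) \<and> p ` A \<subseteq> A. ?t p)"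
    unfolding leibniz_det_def
  proof (rule sum.mono_neutral_right)
    show "\<forall>p\<in>{p. p permutes (A \<union> B)} - {p. p permutes (A \<union> B) \<and> p ` A \<subseteq> A}. ?t p = 0"
    proof
      fix p assume "p \<in> {p. p permutes (A \<union> B)} - {p. p permutes (A \<union> B) \<and> p ` A \<subseteq> A}"
      then obtain e where "p permutes (A \<union> B)" "e \<in> A" "p e \<notin> A" by auto
      then have "e \<in> A \<union> B" "M e (p e) = 0" using zero permutes_in_image[of p "A \<union> B" e] by auto
      then have "(\<Prod>e\<in>A \<union> B. M e (p e)) = 0" using fin by (intro prod_zero) auto
      then show "?t p = 0" by simp
    qed
  qed (use fin in \<open>auto simp: finite_permutations\<close>)
  also have "\<dots> = (\<Sum>(p, q)\<in>?P. ?t (p \<circ> q))"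
    by (subst sum.reindex_bij_betw[OF bij, symmetric]) (simp add: case_prod_unfold)
  also have "\<dots> = (\<Sum>(p, q)\<in>?P. (of_int (sign p) * (\<Prod>e\<in>A. M e (p e))) * (of_int (sign q) * (\<Prod>e\<in>B. M e (q e))))"
  proof (rule sum.cong)
    fix z assume "z \<in> ?P"
    then obtain p q where z: "z = (p, q)" and pq: "p permutes A" "q permutes B" by auto
    then have "permutation p" "permutation q" using fin permutes_imp_permutation by blast+
    then have "sign (p \<circ> q) = sign p * sign q" by (rule sign_compose)
    moreover have "(\<Prod>e\<in>A. M e ((p \<circ> q) e)) = (\<Prod>e\<in>A. M e (p e))"
      by (rule prod.cong) (use disj pq(2) in \<open>auto simp: permutes_not_in[of q B] disjoint_iff\<close>)
    moreover have "(\<Prod>e\<in>B. M e ((p \<circ> q) e)) = (\<Prod>e\<in>B. M e (q e))"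
    proof (rule prod.cong)
      fix e assume "e \<in> B"
      then have "q e \<notin> A" using permutes_in_image[OF pq(2), of e] disj by auto
      then show "M e ((p \<circ> q) e) = M e (q e)" using permutes_not_in[OF pq(1)] by simp
    qed simp
    moreover have "(\<Prod>e\<in>A \<union> B. M e ((p \<circ> q) e)) = (\<Prod>e\<in>A. M e ((p \<circ> q) e)) * (\<Prod>e\<in>B. M e ((p \<circ> q) e))"
      by (rule prod.union_disjoint) (use fin disj in auto)
    ultimately have "?t (p \<circ> q) = (of_int (sign p) * (\<Prod>e\<in>A. M e (p e))) * (of_int (sign q) * (\<Prod>e\<in>B. M e (q e)))"
      by (simp add: mult_ac)
    then show "(case z of (p, q) \<Rightarrow> ?t (p \<circ> q))
        = (case z of (p, q) \<Rightarrow> (of_int (sign p) * (\<Prod>e\<in>A. M e (p e))) * (of_int (sign q) * (\<Prod>e\<in>B. M e (q e))))"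
      by (simp add: z)
  qed simp
  also have "\<dots> = leibniz_det A M * leibniz_det B M"
    by (simp add: leibniz_det_def sum_product sum.cartesian_product)
  finally show ?thesis .
qed

lemma principal_minor_eq: "principal_minor T S = leibniz_det S (\<lambda>e f. cinner e (T *\<^sub>V f))"
  by (simp add: principal_minor_def leibniz_det_def)

text \<open>A finite matching between rows and columns carries the term that it contributes to the
  expansion of a principal minor of the product of the matrices \<open>a\<close> and \<open>b\<^sup>T\<close>. A matching treats
  rows and columns alike, so that the same family of terms expands the minors of both products.\<close>

definition matchings :: "'x set \<Rightarrow> 'k set \<Rightarrow> ('x \<times> 'k) set set"
  where "matchings X I = {M. finite M \<and> M \<subseteq> X \<times> I \<and> inj_on fst M \<and> inj_on snd M}"

definition matching_term :: "('x \<Rightarrow> 'k \<Rightarrow> complex) \<Rightarrow> ('x \<Rightarrow> 'k \<Rightarrow> complex) \<Rightarrow> ('x \<times> 'k) set \<Rightarrow> complex"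
  where "matching_term a b M = (\<Prod>m\<in>M. a (fst m) (snd m)) *
    (\<Sum>p | p permutes M. of_int (sign p) * (\<Prod>m\<in>M. b (fst (p m)) (snd m)))"

lemma matching_term_graph:
  assumes S: "finite S"
  shows "matching_term a b ((\<lambda>e. (e, \<kappa> e)) ` S)
    = (\<Sum>p | p permutes S. of_int (sign p) * (\<Prod>e\<in>S. a e (\<kappa> e) * b (p e) (\<kappa> e)))"
proof -
  define G where "G e = (e, \<kappa> e)" for e
  have inj: "inj_on G S" by (auto simp: G_def inj_on_def)
  have G: "fst (G e) = e" "snd (G e) = \<kappa> e" for e by (simp_all add: G_def)
  from inj have bij: "bij_betw G S (G ` S)" by (rule inj_on_imp_bij_betw)
  note bijp = bij_betw_map_permutation[OF bij]
  have "matching_term a b (G ` S) = (\<Prod>e\<in>S. a e (\<kappa> e)) *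
      (\<Sum>p | p permutes S. of_int (sign (map_permutation S G p)) * (\<Prod>e\<in>S. b (fst (map_permutation S G p (G e))) (\<kappa> e)))"
    unfolding matching_term_def
    by (subst sum.reindex_bij_betw[OF bijp, symmetric])
      (simp add: prod.reindex[OF inj] G)
  also have "\<dots> = (\<Prod>e\<in>S. a e (\<kappa> e)) * (\<Sum>p | p permutes S. of_int (sign p) * (\<Prod>e\<in>S. b (p e) (\<kappa> e)))"
    by (intro arg_cong2[where f = "(*)"] sum.cong prod.cong HOL.refl)
      (auto simp: sign_map_permutation[OF inj _ S] map_permutation_apply[OF inj] G)
  also have "\<dots> = (\<Sum>p | p permutes S. of_int (sign p) * (\<Prod>e\<in>S. a e (\<kappa> e) * b (p e) (\<kappa> e)))"
    by (simp add: sum_distrib_left prod.distrib mult.left_commute)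
  finally show ?thesis by (simp add: G_def)
qed

text \<open>Composing \<open>p\<close> with the transposition of two rows on which \<open>\<kappa>\<close> agrees changes the sign but
  not the product.\<close>

lemma alternating_sum_non_injective:
  assumes S: "finite S" and \<kappa>: "\<not> inj_on \<kappa> S"
  shows "(\<Sum>p | p permutes S. of_int (sign p) * (\<Prod>e\<in>S. a e (\<kappa> e) * b (p e) (\<kappa> e))) = (0::complex)"
proof -
  obtain x y where xy: "x \<in> S" "y \<in> S" "x \<noteq> y" "\<kappa> x = \<kappa> y" using \<kappa> by (auto simp: inj_on_def)
  define \<tau> where "\<tau> = Transposition.transpose x y"
  have \<tau>: "\<tau> permutes S" unfolding \<tau>_def by (rule permutes_swap_id) (use xy in auto)
  have \<kappa>\<tau>: "\<kappa> (\<tau> e) = \<kappa> e" for e using xy by (auto simp: \<tau>_def Transposition.transpose_def)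
  have \<tau>\<tau>: "\<tau> (\<tau> e) = e" for e by (simp add: \<tau>_def)
  define D where "D = (\<Sum>p | p permutes S. of_int (sign p) * (\<Prod>e\<in>S. b (p e) (\<kappa> e)))"
  have "D = (\<Sum>p | p permutes S. of_int (sign (p \<circ> \<tau>)) * (\<Prod>e\<in>S. b ((p \<circ> \<tau>) e) (\<kappa> e)))"
    unfolding D_def by (rule sum_permutations_compose_right[OF \<tau>])
  also have "\<dots> = (\<Sum>p | p permutes S. - (of_int (sign p) * (\<Prod>e\<in>S. b (p e) (\<kappa> e))))"
  proof (rule sum.cong)
    fix p assume "p \<in> {p. p permutes S}"
    then have "permutation p" using S by (auto intro: permutes_imp_permutation)
    then have "sign (p \<circ> \<tau>) = - sign p"
      using xy by (simp add: \<tau>_def sign_compose permutation_swap_id sign_swap_id)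
    moreover have "(\<Prod>e\<in>S. b ((p \<circ> \<tau>) e) (\<kappa> e)) = (\<Prod>e\<in>S. b (p e) (\<kappa> e))"
      by (rule prod.reindex_bij_witness[of _ \<tau> \<tau>])
        (use permutes_in_image[OF \<tau>] in \<open>auto simp: \<kappa>\<tau> \<tau>\<tau>\<close>)
    ultimately show "of_int (sign (p \<circ> \<tau>)) * (\<Prod>e\<in>S. b ((p \<circ> \<tau>) e) (\<kappa> e))
        = - (of_int (sign p) * (\<Prod>e\<in>S. b (p e) (\<kappa> e)))" by simp
  qed simp
  also have "\<dots> = - D" by (simp add: D_def sum_negf)
  finally have "D = 0" by simp
  moreover have "(\<Sum>p | p permutes S. of_int (sign p) * (\<Prod>e\<in>S. a e (\<kappa> e) * b (p e) (\<kappa> e)))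
      = (\<Prod>e\<in>S. a e (\<kappa> e)) * D"
    by (simp add: D_def sum_distrib_left prod.distrib mult.left_commute)
  ultimately show ?thesis by simp
qed

lemma bij_betw_graph_matchings:
  assumes "finite S" "S \<subseteq> X"
  shows "bij_betw (\<lambda>\<kappa>. (\<lambda>e. (e, \<kappa> e)) ` S) {\<kappa> \<in> S \<rightarrow>\<^sub>E I. inj_on \<kappa> S} {M \<in> matchings X I. fst ` M = S}"
proof (rule bij_betwI')
  fix \<kappa> \<kappa>' assume "\<kappa> \<in> {\<kappa> \<in> S \<rightarrow>\<^sub>E I. inj_on \<kappa> S}" "\<kappa>' \<in> {\<kappa> \<in> S \<rightarrow>\<^sub>E I. inj_on \<kappa> S}"
  then show "((\<lambda>e. (e, \<kappa> e)) ` S = (\<lambda>e. (e, \<kappa>' e)) ` S) = (\<kappa> = \<kappa>')"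
    by (auto intro!: PiE_ext[of \<kappa> S "\<lambda>_. I"] dest: equalityD1)
next
  fix \<kappa> assume "\<kappa> \<in> {\<kappa> \<in> S \<rightarrow>\<^sub>E I. inj_on \<kappa> S}"
  then show "(\<lambda>e. (e, \<kappa> e)) ` S \<in> {M \<in> matchings X I. fst ` M = S}"
    using assms by (force simp: matchings_def inj_on_def image_iff)
next
  fix M assume "M \<in> {M \<in> matchings X I. fst ` M = S}"
  then have M: "M \<subseteq> X \<times> I" "inj_on fst M" "inj_on snd M" "fst ` M = S" by (auto simp: matchings_def)
  define \<kappa> where "\<kappa> = (\<lambda>e\<in>S. THE k. (e, k) \<in> M)"
  have \<kappa>: "\<kappa> e = k" if "(e, k) \<in> M" for e k
  proof -
    have "(THE k. (e, k) \<in> M) = k"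
    proof (rule the_equality)
      fix k' assume "(e, k') \<in> M"
      then show "k' = k" using inj_onD[OF M(2), of "(e, k')" "(e, k)"] that by simp
    qed fact
    moreover have "e \<in> S" using that M(4) by (metis fst_conv imageI)
    ultimately show ?thesis by (simp add: \<kappa>_def)
  qed
  have in_M: "(e, \<kappa> e) \<in> M" if e: "e \<in> S" for e
  proof -
    obtain k where "(e, k) \<in> M" using e M(4) by auto
    then show ?thesis using \<kappa> by simp
  qed
  have "M = (\<lambda>e. (e, \<kappa> e)) ` S"
  proof (intro equalityI subsetI)
    fix m assume m: "m \<in> M"
    then have "fst m \<in> S" "\<kappa> (fst m) = snd m" using M(4) \<kappa>[of "fst m" "snd m"] by auto
    then show "m \<in> (\<lambda>e. (e, \<kappa> e)) ` S" by (intro image_eqI[of _ _ "fst m"]) auto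
  qed (use in_M in auto)
  moreover have "\<kappa> \<in> S \<rightarrow>\<^sub>E I" using in_M M(1) by (auto simp: \<kappa>_def)
  moreover have "inj_on \<kappa> S"
    using in_M M(3) by (intro inj_onI) (metis fst_conv inj_onD snd_conv)
  ultimately show "\<exists>\<kappa>\<in>{\<kappa> \<in> S \<rightarrow>\<^sub>E I. inj_on \<kappa> S}. M = (\<lambda>e. (e, \<kappa> e)) ` S" by blast
qed

lemma has_sum_sum_PiE:
  fixes c :: "'p \<Rightarrow> complex" and m :: "'p \<Rightarrow> 'e \<Rightarrow> 'k \<Rightarrow> complex"
  assumes "finite P" "finite S"
    and "\<And>p e. p \<in> P \<Longrightarrow> e \<in> S \<Longrightarrow> (\<lambda>k. norm (m p e k)) summable_on I"
    and "\<And>p e. p \<in> P \<Longrightarrow> e \<in> S \<Longrightarrow> (m p e has_sum N p e) I"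
  shows "((\<lambda>\<kappa>. \<Sum>p\<in>P. c p * (\<Prod>e\<in>S. m p e (\<kappa> e))) has_sum (\<Sum>p\<in>P. c p * (\<Prod>e\<in>S. N p e))) (S \<rightarrow>\<^sub>E I)"
  using assms(1,3,4)
proof (induction P rule: finite_induct)
  case (insert p P)
  have "((\<lambda>\<kappa>. c p * (\<Prod>e\<in>S. m p e (\<kappa> e))) has_sum c p * (\<Prod>e\<in>S. N p e)) (S \<rightarrow>\<^sub>E I)"
    by (intro has_sum_cmult_right has_sum_prod_PiE assms(2) insert.prems) auto
  then have "((\<lambda>\<kappa>. c p * (\<Prod>e\<in>S. m p e (\<kappa> e)) + (\<Sum>p\<in>P. c p * (\<Prod>e\<in>S. m p e (\<kappa> e)))) has_sum
      c p * (\<Prod>e\<in>S. N p e) + (\<Sum>p\<in>P. c p * (\<Prod>e\<in>S. N p e))) (S \<rightarrow>\<^sub>E I)"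
    by (rule has_sum_add) (use insert in auto)
  then show ?case using insert(1,2) by simp
qed simp

text \<open>A matching with row set \<open>S\<close> is the graph of an injective map \<open>S \<rightarrow> I\<close>. The other maps \<open>\<kappa>: S \<rightarrow> I\<close> have
  alternating sum zero and may be added, so that the sum over all \<open>\<kappa>\<close> factors into the entries of the
  product matrix. The bound for the sum of absolute values is the same computation without signs.\<close>

lemma has_sum_matchings_row:
  fixes a b :: "'x \<Rightarrow> 'k \<Rightarrow> complex"
  assumes S: "finite S" "S \<subseteq> X"
    and abs: "\<And>e f. e \<in> S \<Longrightarrow> f \<in> S \<Longrightarrow> (\<lambda>k. norm (a e k * b f k)) summable_on I"
    and N: "\<And>e f. e \<in> S \<Longrightarrow> f \<in> S \<Longrightarrow> ((\<lambda>k. a e k * b f k) has_sum N e f) I"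
  shows "(matching_term a b has_sum leibniz_det S N) {M \<in> matchings X I. fst ` M = S}"
    and "\<exists>w. ((\<lambda>M. norm (matching_term a b M)) has_sum w) {M \<in> matchings X I. fst ` M = S} \<and>
      w \<le> (\<Sum>p | p permutes S. \<Prod>e\<in>S. \<Sum>\<^sub>\<infinity>k\<in>I. norm (a e k * b (p e) k))"
proof -
  define t where "t \<kappa> = (\<Sum>p | p permutes S. of_int (sign p) * (\<Prod>e\<in>S. a e (\<kappa> e) * b (p e) (\<kappa> e)))" for \<kappa>
  define u where "u \<kappa> = (\<Sum>p | p permutes S. 1 * (\<Prod>e\<in>S. complex_of_real (norm (a e (\<kappa> e) * b (p e) (\<kappa> e)))))" for \<kappa>
  define w where "w = (\<Sum>p | p permutes S. \<Prod>e\<in>S. \<Sum>\<^sub>\<infinity>k\<in>I. norm (a e k * b (p e) k))"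
  note bij = bij_betw_graph_matchings[OF S, of I]
  have mt: "matching_term a b ((\<lambda>e. (e, \<kappa> e)) ` S) = t \<kappa>" for \<kappa>
    by (simp add: matching_term_graph[OF S(1)] t_def)
  have perm: "p e \<in> S" if "p permutes S" "e \<in> S" for p e
    using that by (simp add: permutes_in_image)
  have "(t has_sum leibniz_det S N) (S \<rightarrow>\<^sub>E I)"
    unfolding t_def leibniz_det_def
    by (rule has_sum_sum_PiE[where m = "\<lambda>p e k. a e k * b (p e) k" and N = "\<lambda>p e. N e (p e)"])
      (use finite_permutations[OF S(1)] S(1) in \<open>auto intro: abs N perm simp del: norm_mult\<close>)
  also have "?this \<longleftrightarrow> (t has_sum leibniz_det S N) {\<kappa> \<in> S \<rightarrow>\<^sub>E I. inj_on \<kappa> S}"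
    by (rule has_sum_cong_neutral)
      (auto simp: t_def alternating_sum_non_injective[OF S(1)])
  also have "\<dots> \<longleftrightarrow> ((\<lambda>\<kappa>. matching_term a b ((\<lambda>e. (e, \<kappa> e)) ` S)) has_sum leibniz_det S N)
      {\<kappa> \<in> S \<rightarrow>\<^sub>E I. inj_on \<kappa> S}"
    by (simp add: mt)
  also have "\<dots> \<longleftrightarrow> (matching_term a b has_sum leibniz_det S N) {M \<in> matchings X I. fst ` M = S}"
    by (rule has_sum_reindex_bij_betw[OF bij])
  finally show "(matching_term a b has_sum leibniz_det S N) {M \<in> matchings X I. fst ` M = S}" .

  have re: "((\<lambda>k. complex_of_real (norm (a e k * b (p e) k))) has_sum
      complex_of_real (\<Sum>\<^sub>\<infinity>k\<in>I. norm (a e k * b (p e) k))) I" if "p permutes S" "e \<in> S" for p e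
    by (rule has_sum_of_real[OF has_sum_infsum[OF abs[OF that(2) perm[OF that]]]])
  have "(u has_sum (\<Sum>p | p permutes S. 1 * (\<Prod>e\<in>S. complex_of_real (\<Sum>\<^sub>\<infinity>k\<in>I. norm (a e k * b (p e) k)))))
      (S \<rightarrow>\<^sub>E I)"
    unfolding u_def
    by (rule has_sum_sum_PiE[where m = "\<lambda>p e k. complex_of_real (norm (a e k * b (p e) k))"
          and N = "\<lambda>p e. complex_of_real (\<Sum>\<^sub>\<infinity>k\<in>I. norm (a e k * b (p e) k))"])
      (use finite_permutations[OF S(1)] S(1) in
        \<open>auto intro: abs perm re simp del: norm_mult\<close>)
  then have u: "((\<lambda>\<kappa>. Re (u \<kappa>)) has_sum w) (S \<rightarrow>\<^sub>E I)"
    unfolding w_def by (drule_tac has_sum_Re) (simp flip: of_real_prod of_real_sum)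
  have t_le: "norm (t \<kappa>) \<le> Re (u \<kappa>)" for \<kappa>
  proof -
    have "norm (t \<kappa>) \<le> (\<Sum>p | p permutes S. norm (of_int (sign p) * (\<Prod>e\<in>S. a e (\<kappa> e) * b (p e) (\<kappa> e)) :: complex))"
      unfolding t_def by (rule norm_sum)
    also have "\<dots> = (\<Sum>p | p permutes S. \<Prod>e\<in>S. norm (a e (\<kappa> e) * b (p e) (\<kappa> e)))"
      by (intro sum.cong HOL.refl) (simp add: norm_mult sign_def flip: prod_norm)
    also have "\<dots> = Re (u \<kappa>)"
      by (simp add: u_def flip: of_real_prod of_real_sum of_real_mult)
    finally show ?thesis .
  qed
  have t_summable: "(\<lambda>\<kappa>. norm (t \<kappa>)) summable_on (S \<rightarrow>\<^sub>E I)"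
    by (rule Infinite_Sum.abs_summable_on_comparison_test'[of "\<lambda>\<kappa>. Re (u \<kappa>)"])
      (use u t_le in \<open>auto simp: summable_on_def\<close>)
  then have sub: "(\<lambda>\<kappa>. norm (t \<kappa>)) summable_on {\<kappa> \<in> S \<rightarrow>\<^sub>E I. inj_on \<kappa> S}"
    by (rule summable_on_subset) auto
  define v where "v = infsum (\<lambda>\<kappa>. norm (t \<kappa>)) {\<kappa> \<in> S \<rightarrow>\<^sub>E I. inj_on \<kappa> S}"
  have "v \<le> w"
    unfolding v_def
    by (rule has_sum_mono_neutral[OF has_sum_infsum[OF sub] u])
      (use t_le order_trans[OF norm_ge_zero t_le] in auto)
  moreover have "((\<lambda>\<kappa>. norm (t \<kappa>)) has_sum v) {\<kappa> \<in> S \<rightarrow>\<^sub>E I. inj_on \<kappa> S}"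
    unfolding v_def using sub by (rule has_sum_infsum)
  then have "((\<lambda>M. norm (matching_term a b M)) has_sum v) {M \<in> matchings X I. fst ` M = S}"
    by (subst has_sum_reindex_bij_betw[OF bij, symmetric])
      (simp add: mt)
  ultimately show "\<exists>w. ((\<lambda>M. norm (matching_term a b M)) has_sum w) {M \<in> matchings X I. fst ` M = S} \<and>
      w \<le> (\<Sum>p | p permutes S. \<Prod>e\<in>S. \<Sum>\<^sub>\<infinity>k\<in>I. norm (a e k * b (p e) k))"
    unfolding w_def by blast
qed

lemma matchings_swap: "(\<lambda>M. prod.swap ` M) ` matchings X I = matchings I X"
proof -
  have "prod.swap ` M \<in> matchings I X" if "M \<in> matchings X I" for M and X :: "'x set" and I :: "'y set"
    using that by (auto simp: matchings_def inj_on_def)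
  from this[of _ X I] this[of _ I X] show ?thesis
    by (force simp: image_iff image_image intro: bexI[of _ "prod.swap ` _"])
qed

text \<open>Replacing \<open>p\<close> by its inverse moves the permutation from the row index to the column index.\<close>

lemma matching_term_swap:
  assumes M: "finite M"
  shows "matching_term (\<lambda>k e. a e k) (\<lambda>k e. b e k) (prod.swap ` M) = matching_term a b M"
proof -
  have inj: "inj_on prod.swap M" by (auto simp: inj_on_def)
  then have bij: "bij_betw prod.swap M (prod.swap ` M)" by (rule inj_on_imp_bij_betw)
  note bijp = bij_betw_map_permutation[OF bij]
  have "(\<Sum>p | p permutes prod.swap ` M. of_int (sign p) * (\<Prod>m\<in>prod.swap ` M. b (snd m) (fst (p m))))
      = (\<Sum>p | p permutes M. of_int (sign p) * (\<Prod>m\<in>M. b (fst m) (snd (p m))))"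
    by (subst sum.reindex_bij_betw[OF bijp, symmetric], rule sum.cong)
      (auto simp: prod.reindex[OF inj] sign_map_permutation[OF inj _ M] map_permutation_apply[OF inj])
  also have "\<dots> = (\<Sum>p | p permutes M. of_int (sign (inv p)) * (\<Prod>m\<in>M. b (fst m) (snd (inv p m))))"
    by (rule sum_permutations_inverse)
  also have "\<dots> = (\<Sum>p | p permutes M. of_int (sign p) * (\<Prod>m\<in>M. b (fst (p m)) (snd m)))"
  proof (rule sum.cong)
    fix p assume "p \<in> {p. p permutes M}"
    then have p: "p permutes M" by simp
    have "(\<Prod>m\<in>M. b (fst m) (snd (inv p m))) = (\<Prod>m\<in>M. b (fst (p m)) (snd m))"
      by (rule prod.reindex_bij_witness[of _ p "inv p"])
        (use p permutes_in_image[OF p] permutes_in_image[OF permutes_inv[OF p]]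
          permutes_inverses[OF p] in auto)
    moreover have "sign (inv p) = sign p"
      using p M permutation_permutes sign_inverse by blast
    ultimately show "of_int (sign (inv p)) * (\<Prod>m\<in>M. b (fst m) (snd (inv p m)))
        = of_int (sign p) * (\<Prod>m\<in>M. b (fst (p m)) (snd m))" by simp
  qed simp
  finally show ?thesis
    unfolding matching_term_def by (simp add: prod.reindex[OF inj])
qed

lemma has_sum_matchings_column:
  fixes a b :: "'x \<Rightarrow> 'k \<Rightarrow> complex"
  assumes J: "finite J" "J \<subseteq> I"
    and abs: "\<And>k l. k \<in> J \<Longrightarrow> l \<in> J \<Longrightarrow> (\<lambda>e. norm (a e k * b e l)) summable_on X"
    and N: "\<And>k l. k \<in> J \<Longrightarrow> l \<in> J \<Longrightarrow> ((\<lambda>e. a e k * b e l) has_sum N k l) X"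
  shows "(matching_term a b has_sum leibniz_det J N) {M \<in> matchings X I. snd ` M = J}"
    and "\<exists>w. ((\<lambda>M. norm (matching_term a b M)) has_sum w) {M \<in> matchings X I. snd ` M = J} \<and>
      w \<le> (\<Sum>p | p permutes J. \<Prod>k\<in>J. \<Sum>\<^sub>\<infinity>e\<in>X. norm (a e k * b e (p k)))"
proof -
  have bij: "bij_betw (\<lambda>M. prod.swap ` M) {M \<in> matchings X I. snd ` M = J} {M \<in> matchings I X. fst ` M = J}"
  proof (rule bij_betw_byWitness[where f' = "\<lambda>M. prod.swap ` M"])
    show "(\<lambda>M. prod.swap ` M) ` {M \<in> matchings X I. snd ` M = J} \<subseteq> {M \<in> matchings I X. fst ` M = J}"
      using matchings_swap[of X I] by (intro image_subsetI) (simp add: image_image[of fst] image_eqI flip: matchings_swap[of X])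
    show "(\<lambda>M. prod.swap ` M) ` {M \<in> matchings I X. fst ` M = J} \<subseteq> {M \<in> matchings X I. snd ` M = J}"
      using matchings_swap[of I X] by (intro image_subsetI) (simp add: image_image[of snd] image_eqI flip: matchings_swap[of I])
  qed (auto simp: image_image)
  define t where "t = matching_term (\<lambda>k e. a e k) (\<lambda>k e. b e k)"
  have t: "t (prod.swap ` M) = matching_term a b M" if "M \<in> matchings X I" for M
    unfolding t_def by (rule matching_term_swap) (use that in \<open>simp add: matchings_def\<close>)
  note rows = has_sum_matchings_row[OF J, of "\<lambda>k e. a e k" "\<lambda>k e. b e k" X N, OF abs N]
  have "(t has_sum leibniz_det J N) {M \<in> matchings I X. fst ` M = J}"
    unfolding t_def by (rule rows(1))
  then have "((\<lambda>M. t (prod.swap ` M)) has_sum leibniz_det J N) {M \<in> matchings X I. snd ` M = J}"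
    by (subst has_sum_reindex_bij_betw[OF bij])
  also have "?this \<longleftrightarrow> (matching_term a b has_sum leibniz_det J N) {M \<in> matchings X I. snd ` M = J}"
    by (rule has_sum_cong) (simp add: t)
  finally show "(matching_term a b has_sum leibniz_det J N) {M \<in> matchings X I. snd ` M = J}" .
  obtain w where w: "((\<lambda>M. norm (t M)) has_sum w) {M \<in> matchings I X. fst ` M = J}"
      "w \<le> (\<Sum>p | p permutes J. \<Prod>k\<in>J. \<Sum>\<^sub>\<infinity>e\<in>X. norm (a e k * b e (p k)))"
    unfolding t_def using rows(2) by blast
  from w(1) have "((\<lambda>M. norm (t (prod.swap ` M))) has_sum w) {M \<in> matchings X I. snd ` M = J}"
    by (subst has_sum_reindex_bij_betw[OF bij])
  also have "?this \<longleftrightarrow> ((\<lambda>M. norm (matching_term a b M)) has_sum w) {M \<in> matchings X I. snd ` M = J}"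
    by (rule has_sum_cong) (simp add: t)
  finally have "((\<lambda>M. norm (matching_term a b M)) has_sum w) {M \<in> matchings X I. snd ` M = J}" .
  with w(2) show "\<exists>w. ((\<lambda>M. norm (matching_term a b M)) has_sum w) {M \<in> matchings X I. snd ` M = J} \<and>
      w \<le> (\<Sum>p | p permutes J. \<Prod>k\<in>J. \<Sum>\<^sub>\<infinity>e\<in>X. norm (a e k * b e (p k)))" by blast
qed

lemma has_sum_fibres:
  fixes f :: "'a \<Rightarrow> complex"
  assumes f: "(f has_sum d) A" and g: "\<And>x. x \<in> A \<Longrightarrow> g x \<in> B"
    and h: "\<And>y. y \<in> B \<Longrightarrow> (f has_sum h y) {x \<in> A. g x = y}"
  shows "(h has_sum d) B"
proof -
  have "bij_betw snd (SIGMA y:B. {x \<in> A. g x = y}) A"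
    by (rule bij_betw_byWitness[where f' = "\<lambda>x. (g x, x)"]) (use g in auto)
  then have "((\<lambda>z. f (snd z)) has_sum d) (SIGMA y:B. {x \<in> A. g x = y})"
    using f has_sum_reindex_bij_betw by blast
  then show ?thesis by (rule has_sum_SigmaD) (simp add: h)
qed

text \<open>The terms of all matchings are absolutely summable, because those with a given set \<open>J\<close> of
  columns contribute at most \<open>|J|! \<Prod>\<^bsub>k\<in>J\<^esub> s k\<close>. So they may be grouped by rows or by columns,
  and the two groupings are the sums of the principal minors of the two products of \<open>a\<close> and \<open>b\<close>.\<close>

theorem sum_principal_minors_commute:
  fixes a b :: "'x \<Rightarrow> 'k \<Rightarrow> complex"
  assumes s: "\<And>k. k \<in> I \<Longrightarrow> s k = \<alpha> k * \<beta> k" "\<And>k. k \<in> I \<Longrightarrow> \<alpha> k \<ge> 0" "\<And>k. k \<in> I \<Longrightarrow> \<beta> k \<ge> 0" "s summable_on I"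
    and row_abs: "\<And>e f. e \<in> X \<Longrightarrow> f \<in> X \<Longrightarrow> (\<lambda>k. norm (a e k * b f k)) summable_on I"
    and row: "\<And>e f. e \<in> X \<Longrightarrow> f \<in> X \<Longrightarrow> ((\<lambda>k. a e k * b f k) has_sum P e f) I"
    and col_abs: "\<And>k l. k \<in> I \<Longrightarrow> l \<in> I \<Longrightarrow> (\<lambda>e. norm (a e k * b e l)) summable_on X"
    and col_le: "\<And>k l. k \<in> I \<Longrightarrow> l \<in> I \<Longrightarrow> (\<Sum>\<^sub>\<infinity>e\<in>X. norm (a e k * b e l)) \<le> \<alpha> k * \<beta> l"
    and col: "\<And>k l. k \<in> I \<Longrightarrow> l \<in> I \<Longrightarrow> ((\<lambda>e. a e k * b e l) has_sum Q k l) X"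
  shows "((\<lambda>S. leibniz_det S P) has_sum (\<Sum>\<^sub>\<infinity>J | finite J \<and> J \<subseteq> I. leibniz_det J Q)) {S. finite S \<and> S \<subseteq> X}"
proof -
  define t where "t = matching_term a b"
  define w where "w J = infsum (\<lambda>M. norm (t M)) {M \<in> matchings X I. snd ` M = J}" for J
  have fibre: "((\<lambda>M. norm (t M)) has_sum w J) {M \<in> matchings X I. snd ` M = J}"
      "norm (w J) \<le> fact (card J) * (\<Prod>k\<in>J. s k)" if J: "finite J" "J \<subseteq> I" for J
  proof -
    obtain v where v: "((\<lambda>M. norm (t M)) has_sum v) {M \<in> matchings X I. snd ` M = J}"
        "v \<le> (\<Sum>p | p permutes J. \<Prod>k\<in>J. \<Sum>\<^sub>\<infinity>e\<in>X. norm (a e k * b e (p k)))"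
      unfolding t_def using has_sum_matchings_column(2)[OF J, of a b X Q] col_abs col J(2)
      by (metis (no_types, lifting) subsetD)
    have "(\<Sum>p | p permutes J. \<Prod>k\<in>J. \<Sum>\<^sub>\<infinity>e\<in>X. norm (a e k * b e (p k)))
        \<le> (\<Sum>p | p permutes J. \<Prod>k\<in>J. s k)"
    proof (rule sum_mono)
      fix p assume "p \<in> {p. p permutes J}"
      then have p: "p permutes J" by simp
      then have pJ: "p k \<in> I" if "k \<in> J" for k using that J(2) permutes_in_image[OF p] by auto
      have "(\<Prod>k\<in>J. \<Sum>\<^sub>\<infinity>e\<in>X. norm (a e k * b e (p k))) \<le> (\<Prod>k\<in>J. \<alpha> k * \<beta> (p k))"
        using J(2) pJ by (intro prod_mono conjI infsum_nonneg col_le) auto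
      also have "\<dots> = (\<Prod>k\<in>J. \<alpha> k) * (\<Prod>k\<in>J. \<beta> (p k))" by (rule prod.distrib)
      also have "(\<Prod>k\<in>J. \<beta> (p k)) = (\<Prod>k\<in>J. \<beta> k)"
        by (rule prod.reindex_bij_betw[OF permutes_imp_bij[OF p]])
      also have "(\<Prod>k\<in>J. \<alpha> k) * (\<Prod>k\<in>J. \<beta> k) = (\<Prod>k\<in>J. s k)"
        unfolding prod.distrib[symmetric] using J(2) s(1) by (intro prod.cong) auto
      finally show "(\<Prod>k\<in>J. \<Sum>\<^sub>\<infinity>e\<in>X. norm (a e k * b e (p k))) \<le> (\<Prod>k\<in>J. s k)" .
    qed
    also have "\<dots> = fact (card J) * (\<Prod>k\<in>J. s k)"
      using card_permutations[OF HOL.refl J(1)] by simp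
    finally have "v \<le> fact (card J) * (\<Prod>k\<in>J. s k)" using v(2) by linarith
    moreover have "w J = v" unfolding w_def using v(1) by (rule infsumI)
    moreover have "v \<ge> 0" using v(1) by (rule has_sum_nonneg) simp
    ultimately show "((\<lambda>M. norm (t M)) has_sum w J) {M \<in> matchings X I. snd ` M = J}"
      "norm (w J) \<le> fact (card J) * (\<Prod>k\<in>J. s k)" using v(1) by auto
  qed
  have "(\<lambda>J. norm (w J)) summable_on {J. finite J \<and> J \<subseteq> I}"
  proof (rule Infinite_Sum.abs_summable_on_comparison_test'[OF fact_card_prod_summable])
    show "s k \<ge> 0" if "k \<in> I" for k using that s by simp
  qed (use fibre(2) s in auto)
  then have "w summable_on {J. finite J \<and> J \<subseteq> I}" by (rule abs_summable_summable)
  then have "(\<lambda>z. norm (t (snd z))) summable_on (SIGMA J:{J. finite J \<and> J \<subseteq> I}. {M \<in> matchings X I. snd ` M = J})"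
    by (rule summable_on_SigmaI[rotated]) (use fibre(1) in auto)
  moreover have mJ: "snd ` M \<in> {J. finite J \<and> J \<subseteq> I}" "fst ` M \<in> {S. finite S \<and> S \<subseteq> X}"
    if "M \<in> matchings X I" for M
    using that by (auto simp: matchings_def)
  have "bij_betw snd (SIGMA J:{J. finite J \<and> J \<subseteq> I}. {M \<in> matchings X I. snd ` M = J}) (matchings X I)"
    by (rule bij_betw_byWitness[where f' = "\<lambda>M. (snd ` M, M)"]) (use mJ in auto)
  ultimately have "(\<lambda>M. norm (t M)) summable_on matchings X I"
    using summable_on_reindex_bij_betw[of snd _ "matchings X I" "\<lambda>M. norm (t M)"] by blast
  then obtain d where d: "(t has_sum d) (matchings X I)"
    using abs_summable_summable summable_on_def by blast
  have "((\<lambda>J. leibniz_det J Q) has_sum d) {J. finite J \<and> J \<subseteq> I}"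
  proof (rule has_sum_fibres[OF d mJ(1)])
    fix J assume "J \<in> {J. finite J \<and> J \<subseteq> I}"
    then show "(t has_sum leibniz_det J Q) {M \<in> matchings X I. snd ` M = J}"
      unfolding t_def by (intro has_sum_matchings_column(1)) (auto intro: col_abs col simp del: norm_mult)
  qed
  then have "(\<Sum>\<^sub>\<infinity>J | finite J \<and> J \<subseteq> I. leibniz_det J Q) = d" by (rule infsumI)
  moreover have "((\<lambda>S. leibniz_det S P) has_sum d) {S. finite S \<and> S \<subseteq> X}"
  proof (rule has_sum_fibres[OF d mJ(2)])
    fix S assume "S \<in> {S. finite S \<and> S \<subseteq> X}"
    then show "(t has_sum leibniz_det S P) {M \<in> matchings X I. fst ` M = S}"
      unfolding t_def by (intro has_sum_matchings_row(1)) (auto intro: row_abs row simp del: norm_mult)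
  qed
  ultimately show ?thesis by simp
qed


section \<open>Nuclear expansions and the Fredholm determinant\<close>

text \<open>An expansion \<open>T = \<Sum>\<^sub>i \<langle>u i, \<cdot>\<rangle> v i\<close> with \<open>\<Sum>\<^sub>i \<parallel>u i\<parallel> \<parallel>v i\<parallel> < \<infinity>\<close>. This
  property passes to compositions with bounded operators, and to sums by juxtaposing two
  expansions, for which the type of the index set is left open.\<close>

definition nuclear_expansion ::
  "'i set \<Rightarrow> ('i \<Rightarrow> 'a::complex_inner) \<Rightarrow> ('i \<Rightarrow> 'b::complex_inner) \<Rightarrow> ('a \<Rightarrow>\<^sub>C\<^sub>L 'b) \<Rightarrow> bool"
  where "nuclear_expansion I u v T \<longleftrightarrow> (\<lambda>i. norm (u i) * norm (v i)) summable_on I \<and>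
    (\<forall>x y. ((\<lambda>i. cinner y (v i) * cinner (u i) x) has_sum cinner y (T *\<^sub>V x)) I)"

lemma nuclear_expansion_zero: "nuclear_expansion {} u v 0"
  by (simp add: nuclear_expansion_def)

lemma nuclear_expansion_scaleC:
  assumes "nuclear_expansion I u v T"
  shows "nuclear_expansion I u (\<lambda>i. c *\<^sub>C v i) (c *\<^sub>C T)"
proof -
  have "(\<lambda>i. cmod c * (norm (u i) * norm (v i))) summable_on I"
    using assms by (intro summable_on_cmult_right) (simp add: nuclear_expansion_def)
  moreover have "((\<lambda>i. c * (cinner y (v i) * cinner (u i) x)) has_sum c * cinner y (T *\<^sub>V x)) I" for x y
    using assms by (intro has_sum_cmult_right) (simp add: nuclear_expansion_def)
  ultimately show ?thesis
    by (simp add: nuclear_expansion_def norm_scaleC cinner_scaleC_right mult_ac)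
qed

lemma nuclear_expansion_add:
  fixes I :: "'i set" and J :: "'j set"
  assumes S: "nuclear_expansion I u v S" and T: "nuclear_expansion J u' v' T"
  shows "nuclear_expansion (I <+> J) (case_sum u u') (case_sum v v') (S + T)"
proof -
  have disj: "Inl ` I \<inter> Inr ` J = {}" by auto
  have Inl: "(f has_sum s) (Inl ` I) \<longleftrightarrow> ((\<lambda>i. f (Inl i)) has_sum s) I"
    and Inr: "(f has_sum s) (Inr ` J) \<longleftrightarrow> ((\<lambda>i. f (Inr i)) has_sum s) J"
    for f :: "'i + 'j \<Rightarrow> 'x::{comm_monoid_add,topological_space}" and s
    using has_sum_reindex[of Inl I f s] has_sum_reindex[of Inr J f s] by (simp_all add: o_def)
  have "(\<lambda>i. norm (case_sum u u' i) * norm (case_sum v v' i)) summable_on (Inl ` I \<union> Inr ` J)"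
    by (rule summable_on_Un_disjoint[OF _ _ disj])
      (use S T in \<open>simp_all add: summable_on_def nuclear_expansion_def Inl Inr\<close>)
  moreover have "((\<lambda>i. cinner y (case_sum v v' i) * cinner (case_sum u u' i) x) has_sum
      cinner y (S *\<^sub>V x) + cinner y (T *\<^sub>V x)) (Inl ` I \<union> Inr ` J)" for x y
    by (rule has_sum_Un_disjoint[OF _ _ disj])
      (use S T in \<open>simp_all add: nuclear_expansion_def Inl Inr\<close>)
  ultimately show ?thesis
    by (simp add: nuclear_expansion_def Plus_def cinner_add_right)
qed

lemma nuclear_expansion_compose_left:
  fixes A :: "'b::chilbert_space \<Rightarrow>\<^sub>C\<^sub>L 'c::complex_inner"
  assumes T: "nuclear_expansion I u v T"
  shows "nuclear_expansion I u (\<lambda>i. A *\<^sub>V v i) (A o\<^sub>C\<^sub>L T)"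
proof -
  obtain C where C: "C > 0" "\<And>x. norm (A *\<^sub>V x) \<le> norm x * C" using cblinfun_norm_bound by blast
  have "(\<lambda>i. (norm (u i) * norm (v i)) * C) summable_on I"
    using T by (intro summable_on_cmult_left) (simp add: nuclear_expansion_def)
  then have "(\<lambda>i. norm (u i) * norm (A *\<^sub>V v i)) summable_on I"
    by (rule summable_on_comparison_test) (use C(2) in \<open>simp_all add: mult.assoc mult_left_mono\<close>)
  moreover have "((\<lambda>i. cinner y (A *\<^sub>V v i) * cinner (u i) x) has_sum cinner y ((A o\<^sub>C\<^sub>L T) *\<^sub>V x)) I" for x y
    using T unfolding nuclear_expansion_def by (simp flip: cinner_adj_left)
  ultimately show ?thesis by (simp add: nuclear_expansion_def)
qed

lemma nuclear_expansion_compose_right: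
  fixes A :: "'c::chilbert_space \<Rightarrow>\<^sub>C\<^sub>L 'a::chilbert_space"
  assumes T: "nuclear_expansion I u v T"
  shows "nuclear_expansion I (\<lambda>i. adj A *\<^sub>V u i) v (T o\<^sub>C\<^sub>L A)"
proof -
  obtain C where C: "C > 0" "\<And>x. norm (adj A *\<^sub>V x) \<le> norm x * C" using cblinfun_norm_bound by blast
  have "(\<lambda>i. C * (norm (u i) * norm (v i))) summable_on I"
    using T by (intro summable_on_cmult_right) (simp add: nuclear_expansion_def)
  then have "(\<lambda>i. norm (adj A *\<^sub>V u i) * norm (v i)) summable_on I"
    by (rule summable_on_comparison_test)
      (use C(2) in \<open>simp_all add: mult.assoc[symmetric] mult_right_mono mult.commute[of C]\<close>)
  then show ?thesis
    using T by (simp add: nuclear_expansion_def cinner_adj_left)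
qed

lemma parseval_abs_summable:
  assumes B: "is_onb B"
  shows "(\<lambda>e. norm (cinner e x * cinner y e)) summable_on B"
    and "(\<Sum>\<^sub>\<infinity>e\<in>B. norm (cinner e x * cinner y e)) \<le> norm x * norm y"
proof -
  have "(\<lambda>e. cinner e x * cinner y e) summable_on B"
    using has_sum_parseval[OF B, of y x] by (auto simp: summable_on_def mult.commute)
  then show s: "(\<lambda>e. norm (cinner e x * cinner y e)) summable_on B"
    by (simp only: summable_on_iff_abs_summable_on_complex)
  have nrm: "L2_set (\<lambda>e. cmod (cinner e z)) F \<le> norm z" if F: "finite F" "F \<subseteq> B" for F z
    unfolding L2_set_def
    using finite_sum_le_has_sum[OF has_sum_parseval_norm[OF B, of z] F] by (simp add: real_le_lsqrt)
  show "(\<Sum>\<^sub>\<infinity>e\<in>B. norm (cinner e x * cinner y e)) \<le> norm x * norm y"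
  proof (rule infsum_le_finite_sums[OF s])
    fix F assume F: "finite F" "F \<subseteq> B"
    have "cmod (cinner y e) = cmod (cinner e y)" for e by (metis cinner_commute complex_mod_cnj)
    then have "(\<Sum>e\<in>F. norm (cinner e x * cinner y e)) = (\<Sum>e\<in>F. \<bar>cmod (cinner e x)\<bar> * \<bar>cmod (cinner e y)\<bar>)"
      by (simp add: norm_mult)
    also have "\<dots> \<le> L2_set (\<lambda>e. cmod (cinner e x)) F * L2_set (\<lambda>e. cmod (cinner e y)) F"
      by (rule L2_set_mult_ineq)
    also have "\<dots> \<le> norm x * norm y" using F by (intro mult_mono nrm) auto
    finally show "(\<Sum>e\<in>F. norm (cinner e x * cinner y e)) \<le> norm x * norm y" .
  qed
qed

text \<open>A principal minor in an orthonormal basis is a minor of the product of the matrices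
  \<open>\<langle>e, v i\<rangle>\<close> and \<open>\<langle>u i, f\<rangle>\<close>. The product in the opposite order is the matrix \<open>\<langle>u j, v i\<rangle>\<close> by
  Parseval, which no longer involves the basis.\<close>

lemma principal_minors_nuclear:
  assumes T: "nuclear_expansion I u v T" and B: "is_onb B"
  shows "(principal_minor T has_sum
      (\<Sum>\<^sub>\<infinity>J | finite J \<and> J \<subseteq> I. leibniz_det J (\<lambda>i j. cinner (u j) (v i)))) {S. finite S \<and> S \<subseteq> B}"
proof -
  have "((\<lambda>S. leibniz_det S (\<lambda>e f. cinner e (T *\<^sub>V f))) has_sum
      (\<Sum>\<^sub>\<infinity>J | finite J \<and> J \<subseteq> I. leibniz_det J (\<lambda>i j. cinner (u j) (v i)))) {S. finite S \<and> S \<subseteq> B}"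
  proof (rule sum_principal_minors_commute[where a = "\<lambda>e i. cinner e (v i)" and b = "\<lambda>f i. cinner (u i) f"
        and s = "\<lambda>i. norm (v i) * norm (u i)" and \<alpha> = "\<lambda>i. norm (v i)" and \<beta> = "\<lambda>i. norm (u i)"])
    show "(\<lambda>i. norm (v i) * norm (u i)) summable_on I"
      using T by (simp add: nuclear_expansion_def mult.commute)
    fix e f
    show "((\<lambda>i. cinner e (v i) * cinner (u i) f) has_sum cinner e (T *\<^sub>V f)) I"
      using T by (simp add: nuclear_expansion_def)
    then show "(\<lambda>i. norm (cinner e (v i) * cinner (u i) f)) summable_on I"
      by (metis has_sum_imp_summable summable_on_iff_abs_summable_on_complex)
  next
    fix i j
    show "((\<lambda>e. cinner e (v i) * cinner (u j) e) has_sum cinner (u j) (v i)) B"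
      using has_sum_parseval[OF B, of "u j" "v i"] by (simp add: mult.commute)
  qed (use parseval_abs_summable[OF B] in auto)
  then show ?thesis by (simp add: principal_minor_eq[abs_def])
qed

lemma onb_exists: "\<exists>B::'a::chilbert_space set. is_onb B"
  using orthonormal_extends_to_onb[of "{}"] by (metis empty_iff orthonormal_def)

theorem has_sum_fredholm_det:
  fixes T :: "'a::chilbert_space \<Rightarrow>\<^sub>C\<^sub>L 'a"
  assumes T: "nuclear_expansion I u v T" and B: "is_onb B"
  shows "(principal_minor T has_sum fredholm_det T) {S. finite S \<and> S \<subseteq> B}"
proof -
  define d where "d = (\<Sum>\<^sub>\<infinity>J | finite J \<and> J \<subseteq> I. leibniz_det J (\<lambda>i j. cinner (u j) (v i)))"
  have d: "(principal_minor T has_sum d) {S. finite S \<and> S \<subseteq> C}" if "is_onb C" for C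
    unfolding d_def by (rule principal_minors_nuclear[OF T that])
  have "fredholm_det T = d"
    unfolding fredholm_det_def
    by (rule the_equality) (use d B has_sum_unique in blast)+
  then show ?thesis using d[OF B] by simp
qed

lemma fredholm_det_eqI:
  fixes T :: "'a::chilbert_space \<Rightarrow>\<^sub>C\<^sub>L 'a"
  assumes "nuclear_expansion I u v T" "is_onb B"
    and "(principal_minor T has_sum d) {S. finite S \<and> S \<subseteq> B}"
  shows "fredholm_det T = d"
  using has_sum_fredholm_det[OF assms(1,2)] assms(3) has_sum_unique by blast

lemma fredholm_det_zero: "fredholm_det (0 :: 'a::chilbert_space \<Rightarrow>\<^sub>C\<^sub>L 'a) = 1"
proof -
  obtain B :: "'a set" where B: "is_onb B" using onb_exists by blast
  have "(principal_minor (0 :: 'a \<Rightarrow>\<^sub>C\<^sub>L 'a) has_sum 1) {S. finite S \<and> S \<subseteq> B}"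
    by (rule has_sum_finite_neutralI[of "{{}}"]) (auto simp: principal_minor_def sign_id power_0_left split: if_splits)
  then show ?thesis by (rule fredholm_det_eqI[OF nuclear_expansion_zero B])
qed


section \<open>Singular values\<close>

lemma span_orthonormal_finite:
  assumes on: "orthonormal B" and F: "finite F" "F \<subseteq> B"
  shows "complex_vector.independent F" 
    and "complex_vector.dim (complex_vector.span F) = card F"
proof -
  show ind: "complex_vector.independent F"
    unfolding complex_vector.independent_explicit_module
  proof (intro allI impI)
    fix t c a assume t: "finite t" "t \<subseteq> F" "(\<Sum>b\<in>t. c b *\<^sub>C b) = 0" "a \<in> t"
    then have "cinner a (\<Sum>b\<in>t. c b *\<^sub>C b) = c a"
      using cinner_sum_orthonormal[OF on t(1), of a c] F(2) by auto
    then show "c a = 0" using t(3) by simp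
  qed
  show "complex_vector.dim (complex_vector.span F) = card F"
    by (rule complex_vector.dim_span_eq_card_independent[OF ind])
qed

text \<open>Pairing the eigenvalue equation with a basis vector \<open>b\<close> gives \<open>s\<^sup>2 \<langle>b, x\<rangle> = \<parallel>T b\<parallel>\<^sup>2 \<langle>b, x\<rangle>\<close>, so only basis
  vectors with \<open>\<parallel>T b\<parallel> = s\<close> occur in \<open>x\<close>. Finiteness makes the algebraic span sufficient.\<close>

lemma sv_space_eq_span:
  fixes T :: "'a::chilbert_space \<Rightarrow>\<^sub>C\<^sub>L 'b::complex_inner"
  assumes B: "is_onb B"
    and eig: "\<And>b. b \<in> B \<Longrightarrow> adj T *\<^sub>V T *\<^sub>V b = complex_of_real ((norm (T *\<^sub>V b))\<^sup>2) *\<^sub>C b"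
    and s: "s > 0" and fin: "finite {b\<in>B. norm (T *\<^sub>V b) = s}"
  shows "sv_space T s = complex_vector.span {b\<in>B. norm (T *\<^sub>V b) = s}"
proof -
  let ?F = "{b\<in>B. norm (T *\<^sub>V b) = s}"
  show ?thesis
  proof (intro equalityI subsetI)
    fix x assume "x \<in> sv_space T s"
    then have x: "adj T *\<^sub>V T *\<^sub>V x = complex_of_real (s\<^sup>2) *\<^sub>C x" by (simp add: sv_space_def)
    have 0: "cinner b x = 0" if b: "b \<in> B" "b \<notin> ?F" for b
    proof -
      have "complex_of_real (s\<^sup>2) * cinner b x = cinner (adj T *\<^sub>V T *\<^sub>V b) x"
        using arg_cong[OF x, of "cinner b"] by (simp add: cinner_scaleC_right cinner_adj_right cinner_adj_left)
      also have "\<dots> = complex_of_real ((norm (T *\<^sub>V b))\<^sup>2) * cinner b x"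
        unfolding eig[OF b(1)] by (simp add: cinner_scaleC_left)
      finally have "complex_of_real (s\<^sup>2 - (norm (T *\<^sub>V b))\<^sup>2) * cinner b x = 0"
        by (simp add: algebra_simps)
      moreover have "s\<^sup>2 \<noteq> (norm (T *\<^sub>V b))\<^sup>2" using b s by auto
      ultimately show ?thesis by (simp only: mult_eq_0_iff of_real_eq_0_iff right_minus_eq) blast
    qed
    have "((\<lambda>b. cinner b x *\<^sub>C b) has_sum (\<Sum>b\<in>?F. cinner b x *\<^sub>C b)) B"
      by (rule has_sum_finite_neutralI[of ?F]) (use fin 0 in auto)
    then have "x = (\<Sum>b\<in>?F. cinner b x *\<^sub>C b)"
      using has_sum_fourier[OF B, of x] has_sum_unique by blast
    also have "\<dots> \<in> complex_vector.span ?F"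
      by (intro complex_vector.span_sum complex_vector.span_scale complex_vector.span_base)
    finally show "x \<in> complex_vector.span ?F" .
  next
    fix x assume "x \<in> complex_vector.span ?F"
    then show "x \<in> sv_space T s"
    proof (induction rule: complex_vector.span_induct_alt)
      case base
      then show ?case by (simp add: sv_space_def cblinfun_zero)
    next
      case (step c b y)
      then show ?case using eig[of b]
        by (auto simp: sv_space_def cblinfun_add cblinfun_scaleC scaleC_add_right scaleC_scaleC mult.commute)
    qed
  qed
qed

text \<open>The eigenspaces of \<open>T\<^sup>*T\<close> are spanned by disjoint parts of the basis, and the dimensions of those
  with \<open>s \<ge> t\<close> add up to the number of basis vectors in their union.\<close>

lemma sv_count_eigenbasis:
  fixes T :: "'a::chilbert_space \<Rightarrow>\<^sub>C\<^sub>L 'b::complex_inner"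
  assumes B: "is_onb B"
    and eig: "\<And>b. b \<in> B \<Longrightarrow> adj T *\<^sub>V T *\<^sub>V b = complex_of_real ((norm (T *\<^sub>V b))\<^sup>2) *\<^sub>C b"
    and t: "t > 0" and fin: "finite {b\<in>B. t \<le> norm (T *\<^sub>V b)}"
  shows "sv_count T t = card {b\<in>B. t \<le> norm (T *\<^sub>V b)}"
proof -
  have on: "orthonormal B" using B by (simp add: is_onb_iff)
  let ?L = "{b\<in>B. t \<le> norm (T *\<^sub>V b)}"
  let ?F = "\<lambda>s. {b\<in>B. norm (T *\<^sub>V b) = s}"
  have finF: "finite (?F s)" if "s \<ge> t" for s
    by (rule finite_subset[OF _ fin]) (use that in auto)
  have sv: "sv_space T s = complex_vector.span (?F s)" "complex_vector.dim (sv_space T s) = card (?F s)"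
    if "s \<ge> t" for s
  proof -
    show 1: "sv_space T s = complex_vector.span (?F s)"
      by (rule sv_space_eq_span[OF B eig]) (use that t finF in auto)
    show "complex_vector.dim (sv_space T s) = card (?F s)"
      unfolding 1 by (rule span_orthonormal_finite(2)[OF on finF]) (use that in auto)
  qed
  have "{s. t \<le> s \<and> sv_space T s \<noteq> {0}} = (\<lambda>b. norm (T *\<^sub>V b)) ` ?L"
  proof (intro equalityI subsetI)
    fix s assume s: "s \<in> {s. t \<le> s \<and> sv_space T s \<noteq> {0}}"
    then have "?F s \<noteq> {}" using sv(1)[of s] complex_vector.span_empty by fastforce
    then show "s \<in> (\<lambda>b. norm (T *\<^sub>V b)) ` ?L" using s by auto
  next
    fix s assume "s \<in> (\<lambda>b. norm (T *\<^sub>V b)) ` ?L"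
    then obtain b where b: "b \<in> B" "t \<le> norm (T *\<^sub>V b)" "s = norm (T *\<^sub>V b)" by auto
    then have "b \<in> sv_space T s" using sv(1)[of s] by (auto intro: complex_vector.span_base)
    moreover have "b \<noteq> 0" using orthonormal_norm[OF on b(1)] by auto
    ultimately show "s \<in> {s. t \<le> s \<and> sv_space T s \<noteq> {0}}" using b by auto
  qed
  then have "sv_count T t = (\<Sum>s\<in>(\<lambda>b. norm (T *\<^sub>V b)) ` ?L. card {b\<in>?L. norm (T *\<^sub>V b) = s})"
    unfolding sv_count_def
  proof (rule sum.cong)
    fix s assume "s \<in> (\<lambda>b. norm (T *\<^sub>V b)) ` ?L"
    then have "s \<ge> t" by auto
    moreover from this have "?F s = {b\<in>?L. norm (T *\<^sub>V b) = s}" by auto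
    ultimately show "complex_vector.dim (sv_space T s) = card {b\<in>?L. norm (T *\<^sub>V b) = s}"
      by (simp only: sv(2))
  qed
  also have "\<dots> = card ?L"
    using sum.image_gen[OF fin, of "\<lambda>_. 1::nat" "\<lambda>b. norm (T *\<^sub>V b)"] by simp
  finally show ?thesis .
qed

lemma singular_value_ge:
  assumes bdd: "bdd_above {t. 0 < t \<and> j \<le> sv_count T t}"
  shows "singular_value T j \<ge> 0" and "0 < t \<Longrightarrow> j \<le> sv_count T t \<Longrightarrow> singular_value T j \<ge> t"
  unfolding singular_value_def using bdd by (auto intro!: cSup_upper)

lemma sv_count_cong_singular_value:
  assumes "\<And>t. t > 0 \<Longrightarrow> sv_count S t = sv_count T t"
  shows "singular_value S j = singular_value T j"
proof -
  have "{t. 0 < t \<and> j \<le> sv_count S t} = {t. 0 < t \<and> j \<le> sv_count T t}" using assms by auto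
  then show ?thesis by (simp add: singular_value_def)
qed

text \<open>If \<open>b\<close> has the smallest \<open>\<parallel>T b\<parallel>\<close> in \<open>F\<close>, all of \<open>F\<close> is counted by \<open>sv_count T (\<parallel>T b\<parallel>)\<close>, so \<open>\<parallel>T b\<parallel>\<close> is at
  most the singular value with index \<open>card F\<close>. The other vectors follow by induction.\<close>

lemma sum_norm_eigenbasis_le:
  fixes T :: "'a::chilbert_space \<Rightarrow>\<^sub>C\<^sub>L 'b::complex_inner"
  assumes B: "is_onb B"
    and eig: "\<And>b. b \<in> B \<Longrightarrow> adj T *\<^sub>V T *\<^sub>V b = complex_of_real ((norm (T *\<^sub>V b))\<^sup>2) *\<^sub>C b"
    and fin: "\<And>t. t > 0 \<Longrightarrow> finite {b\<in>B. t \<le> norm (T *\<^sub>V b)}"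
    and F: "finite F" "F \<subseteq> B"
  shows "(\<Sum>b\<in>F. norm (T *\<^sub>V b)) \<le> (\<Sum>j<card F. singular_value T (Suc j))"
proof -
  obtain C where C: "C > 0" "\<And>x. norm (T *\<^sub>V x) \<le> norm x * C" using cblinfun_norm_bound by blast
  have on: "orthonormal B" using B by (simp add: is_onb_iff)
  have bdd: "bdd_above {t. 0 < t \<and> Suc j \<le> sv_count T t}" for j
  proof (rule bdd_aboveI[of _ C])
    fix t assume "t \<in> {t. 0 < t \<and> Suc j \<le> sv_count T t}"
    then have "{b\<in>B. t \<le> norm (T *\<^sub>V b)} \<noteq> {}"
      using sv_count_eigenbasis[OF B eig, of t] fin by fastforce
    then obtain b where "b \<in> B" "t \<le> norm (T *\<^sub>V b)" by auto
    then show "t \<le> C" using C(2)[of b] orthonormal_norm[OF on] by simp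
  qed
  show ?thesis
    using F
  proof (induction "card F" arbitrary: F)
    case (Suc n)
    then have "F \<noteq> {}" by auto
    define b where "b = arg_min_on (\<lambda>b. norm (T *\<^sub>V b)) F"
    have b: "b \<in> F" unfolding b_def by (rule arg_min_if_finite(1)[OF Suc.prems(1) \<open>F \<noteq> {}\<close>])
    have min: "norm (T *\<^sub>V b) \<le> norm (T *\<^sub>V c)" if "c \<in> F" for c
      unfolding b_def by (rule arg_min_least[OF Suc.prems(1) \<open>F \<noteq> {}\<close> that])
    have "norm (T *\<^sub>V b) \<le> singular_value T (Suc n)"
    proof (cases "T *\<^sub>V b = 0")
      case True
      then show ?thesis using singular_value_ge(1)[OF bdd] by simp
    next
      case False
      then have pos: "norm (T *\<^sub>V b) > 0" by simp
      have "F \<subseteq> {c\<in>B. norm (T *\<^sub>V b) \<le> norm (T *\<^sub>V c)}" using min Suc.prems(2) by auto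
      then have "card F \<le> card {c\<in>B. norm (T *\<^sub>V b) \<le> norm (T *\<^sub>V c)}"
        by (rule card_mono[OF fin[OF pos]])
      then have "card F \<le> sv_count T (norm (T *\<^sub>V b))"
        by (simp only: sv_count_eigenbasis[OF B eig pos fin[OF pos]])
      then show ?thesis using singular_value_ge(2)[OF bdd pos, of n] unfolding Suc.hyps(2) by simp
    qed
    moreover have "card (F - {b}) = n" using Suc.hyps(2) b Suc.prems(1) by simp
    moreover have "(\<Sum>c\<in>F - {b}. norm (T *\<^sub>V c)) \<le> (\<Sum>j<card (F - {b}). singular_value T (Suc j))"
      by (rule Suc.hyps(1)) (use Suc.prems calculation(2) in auto)
    ultimately show ?case
      using sum.remove[OF Suc.prems(1) b, of "\<lambda>c. norm (T *\<^sub>V c)"] Suc.hyps(2)[symmetric] by simp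
  qed auto
qed

text \<open>The Fourier expansion in an eigenbasis of \<open>T\<^sup>*T\<close> is \<open>T = \<Sum>\<^sub>b \<langle>b, \<cdot>\<rangle> T b\<close>, where the norms \<open>\<parallel>T b\<parallel>\<close> are
  the singular values.\<close>

lemma trace_class_nuclear_expansion:
  fixes T :: "'a::chilbert_space \<Rightarrow>\<^sub>C\<^sub>L 'b::complex_inner"
  assumes T: "trace_class T"
  obtains B where "nuclear_expansion B (\<lambda>b. b) (\<lambda>b. T *\<^sub>V b) T"
proof -
  have comp: "compact_op T" and s: "summable (\<lambda>j. singular_value T (Suc j) powr 1)"
    using T by (auto simp: schatten_def)
  obtain B where B: "is_onb B"
      and eig: "\<And>b. b \<in> B \<Longrightarrow> adj T *\<^sub>V T *\<^sub>V b = complex_of_real ((norm (T *\<^sub>V b))\<^sup>2) *\<^sub>C b"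
    using compact_op_eigenbasis[OF comp] by blast
  have on: "orthonormal B" using B by (simp add: is_onb_iff)
  have fin: "finite {b\<in>B. t \<le> norm (T *\<^sub>V b)}" if "t > 0" for t
    by (rule finite_large_images[OF comp _ eigenbasis_images_orthogonal[OF on _ _ _ eig] that])
      (simp_all add: orthonormal_norm[OF on])
  have le: "(\<Sum>b\<in>F. norm (T *\<^sub>V b)) \<le> (\<Sum>j. singular_value T (Suc j) powr 1)" if "finite F" "F \<subseteq> B" for F
  proof -
    have "(\<Sum>b\<in>F. norm (T *\<^sub>V b)) \<le> (\<Sum>j<card F. singular_value T (Suc j))"
      by (rule sum_norm_eigenbasis_le[OF B eig fin that])
    also have "\<dots> \<le> (\<Sum>j<card F. singular_value T (Suc j) powr 1)"
    proof (rule sum_mono)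
      show "x \<le> x powr 1" for x :: real
        by (cases "x > 0") (auto simp: powr_def intro: order_trans[OF _ exp_ge_zero])
    qed
    also have "\<dots> \<le> (\<Sum>j. singular_value T (Suc j) powr 1)"
      by (rule sum_le_suminf[OF s]) auto
    finally show ?thesis .
  qed
  have "(\<lambda>b. norm (T *\<^sub>V b)) summable_on B"
  proof (rule nonneg_bounded_partial_sums_imp_summable_on)
    show "\<forall>\<^sub>F F in finite_subsets_at_top B.
        (\<Sum>b\<in>F. norm (T *\<^sub>V b)) \<le> (\<Sum>j. singular_value T (Suc j) powr 1)"
      by (rule eventually_finite_subsets_at_top_weakI) (rule le)
  qed simp
  then have "(\<lambda>b. norm b * norm (T *\<^sub>V b)) summable_on B"
    by (rule summable_on_cong[THEN iffD1, rotated]) (simp add: orthonormal_norm[OF on])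
  moreover have "((\<lambda>b. cinner y (T *\<^sub>V b) * cinner b x) has_sum cinner y (T *\<^sub>V x)) B" for x y
    using has_sum_bounded_linear[OF bounded_linear_cinner_right[of y] has_sum_cblinfun_fourier[OF B, of x T]]
    by (simp add: o_def cinner_scaleC_right mult.commute)
  ultimately show ?thesis
    by (intro that[of B]) (simp add: nuclear_expansion_def)
qed


section \<open>Block operators\<close>

lemma norm_axis: "norm (axis k x :: 'h::real_inner ^ 'n::finite) = norm x"
  unfolding norm_eq_sqrt_inner inner_axis_axis by simp

lemma axis_add: "axis k (x + y) = axis k x + (axis k y :: 'h::comm_monoid_add ^ 'n)"
  by (simp add: vec_eq_iff axis_def)

lemma axis_scaleC: "axis k (c *\<^sub>C x) = c *\<^sub>C (axis k x :: 'h::complex_inner ^ 'n::finite)"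
  by (simp add: vec_eq_iff axis_def scaleC_vec_def)

lemma axis_zero [simp]: "axis k 0 = (0 :: 'h::zero ^ 'n)"
  by (simp add: vec_eq_iff axis_def)

lemma cinner_axis_left: "cinner (axis k x) (y :: 'h::complex_inner ^ 'n::finite) = cinner x (y $ k)"
proof -
  have "cinner (axis k x) y = (\<Sum>i\<in>UNIV. if i = k then cinner x (y $ k) else 0)"
    unfolding cinner_vec_def by (rule sum.cong) (auto simp: axis_def)
  then show ?thesis by simp
qed

lemma cinner_axis_right: "cinner (y :: 'h::complex_inner ^ 'n::finite) (axis k x) = cinner (y $ k) x"
  by (metis cinner_axis_left cinner_commute)

definition emb :: "'n::finite \<Rightarrow> ('h::complex_inner \<Rightarrow>\<^sub>C\<^sub>L ('h ^ 'n))"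
  where "emb k = Cblinfun (axis k)"

definition coord :: "'n::finite \<Rightarrow> (('h::complex_inner ^ 'n) \<Rightarrow>\<^sub>C\<^sub>L 'h)"
  where "coord k = Cblinfun (\<lambda>x. x $ k)"

lemma emb_apply [simp]: "emb k *\<^sub>V x = axis k x"
  unfolding emb_def
proof (rule Cblinfun_apply)
  show "bounded_linear (axis k :: 'a \<Rightarrow> 'a ^ 'b)"
    by (rule bounded_linear_intro[where K = 1])
      (simp_all add: axis_add axis_scaleC scaleR_scaleC norm_axis)
qed (rule axis_scaleC)

lemma coord_apply [simp]: "coord k *\<^sub>V x = x $ k"
  unfolding coord_def
  by (rule Cblinfun_apply) (simp_all add: bounded_linear_vec_nth scaleC_vec_def)

lemma block_apply: "block T i k *\<^sub>V x = (T *\<^sub>V axis k x) $ i"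
  by transfer simp

lemma block_eq: "block T i k = coord i o\<^sub>C\<^sub>L (T o\<^sub>C\<^sub>L emb k)"
  by (rule cblinfun_eqI) (simp add: block_apply)

lemma block_scaleC: "block (c *\<^sub>C T) i k = c *\<^sub>C block T i k"
  by (rule cblinfun_eqI) (simp add: block_apply scaleC_vec_def)

lemma block_add: "block (S + T) i k = block S i k + block T i k"
  by (rule cblinfun_eqI) (simp add: block_apply)

definition single_block :: "'n::finite \<Rightarrow> 'n \<Rightarrow> ('h::complex_inner \<Rightarrow>\<^sub>C\<^sub>L 'h) \<Rightarrow> ('h, 'n) block_op"
  where "single_block i k A = emb i o\<^sub>C\<^sub>L (A o\<^sub>C\<^sub>L coord k)"

lemma single_block_apply: "single_block i k A *\<^sub>V x = axis i (A *\<^sub>V (x $ k))"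
  by (simp add: single_block_def)

lemma block_single_block:
  "block (single_block i k A) i' k' = (if i' = i \<and> k' = k then A else 0)"
  by (rule cblinfun_eqI) (auto simp: block_apply single_block_apply axis_def cblinfun_zero)

lemma only_nonzero_single_block: "A \<noteq> 0 \<Longrightarrow> only_nonzero_block (single_block i k A) i k"
  by (auto simp: only_nonzero_block_def block_single_block)

lemma single_block_compose:
  "single_block i j A o\<^sub>C\<^sub>L single_block k l B = (if j = k then single_block i l (A o\<^sub>C\<^sub>L B) else 0)"
  by (rule cblinfun_eqI) (auto simp: single_block_apply axis_def cblinfun_zero vec_eq_iff)

lemma adj_single_block:
  fixes A :: "'h::chilbert_space \<Rightarrow>\<^sub>C\<^sub>L 'h"
  shows "adj (single_block i k A) = single_block k i (adj A)"
  by (rule adj_eqI) (simp add: single_block_apply cinner_axis_left cinner_axis_right cinner_adj_right)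

lemma compact_single_block: "compact_op A \<Longrightarrow> compact_op (single_block i k A)"
  unfolding single_block_def by (intro compact_op_compose_left compact_op_compose_right)

lemma dim_linear_image:
  assumes f: "Vector_Spaces.linear scaleC scaleC f" and inj: "inj f"
  shows "complex_vector.dim (f ` V) = complex_vector.dim V"
proof -
  interpret f: Vector_Spaces.linear scaleC scaleC f by fact
  obtain B where B: "B \<subseteq> V" "complex_vector.independent B" "V \<subseteq> complex_vector.span B"
      "card B = complex_vector.dim V"
    using complex_vector.basis_exists by blast
  show ?thesis
  proof (rule complex_vector.dim_unique)
    show "f ` B \<subseteq> f ` V" using B(1) by blast
    show "f ` V \<subseteq> complex_vector.span (f ` B)" using B(3) by (rule f.spans_image)
    show "complex_vector.independent (f ` B)" using B(2) inj by (rule f.independent_inj_image)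
    show "card (f ` B) = complex_vector.dim V"
      using B(4) inj card_image[of f B] inj_on_subset by fastforce
  qed
qed

text \<open>For \<open>t \<noteq> 0\<close> the eigenspace of \<open>T\<^sup>*T\<close> for \<open>t\<^sup>2\<close> lies in the summand \<open>k\<close>, where it is that of \<open>A\<close>.\<close>

lemma singular_value_single_block:
  fixes A :: "'h::chilbert_space \<Rightarrow>\<^sub>C\<^sub>L 'h"
  shows "singular_value (single_block i k A) j = singular_value A j"
proof (rule sv_count_cong_singular_value)
  fix t :: real assume t: "t > 0"
  have sp: "sv_space (single_block i k A) s = axis k ` sv_space A s" if s: "s \<ge> t" for s
  proof -
    have iff: "x \<in> sv_space (single_block i k A) s \<longleftrightarrow>
        axis k (adj A *\<^sub>V A *\<^sub>V (x $ k)) = complex_of_real (s\<^sup>2) *\<^sub>C x" for x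
      by (simp add: sv_space_def adj_single_block single_block_apply)
    show ?thesis
    proof (intro equalityI subsetI)
      fix x assume "x \<in> sv_space (single_block i k A) s"
      then have x: "axis k (adj A *\<^sub>V A *\<^sub>V (x $ k)) $ l = complex_of_real (s\<^sup>2) *\<^sub>C (x $ l)" for l
        using iff by (simp add: scaleC_vec_def)
      have "x $ l = 0" if "l \<noteq> k" for l
        using x[of l] that s t by (simp add: axis_def)
      then have "x = axis k (x $ k)" by (auto simp: vec_eq_iff axis_def)
      moreover have "x $ k \<in> sv_space A s" using x[of k] by (simp add: sv_space_def)
      ultimately show "x \<in> axis k ` sv_space A s" by blast
    next
      fix x assume "x \<in> axis k ` sv_space A s"
      then obtain y where y: "x = axis k y" "y \<in> sv_space A s" by blast
      have "x $ k = y" by (simp add: y(1) axis_def)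
      then show "x \<in> sv_space (single_block i k A) s"
        unfolding iff using y by (simp add: sv_space_def axis_scaleC)
    qed
  qed
  have lin: "Vector_Spaces.linear scaleC scaleC (axis k :: 'h \<Rightarrow> 'h ^ 'a)"
    by unfold_locales (simp_all add: axis_add axis_scaleC)
  have inj: "inj (axis k :: 'h \<Rightarrow> 'h ^ 'a)" by (auto simp: inj_def axis_eq_axis)
  have "(axis k ` V = {0 :: 'h ^ 'a}) = (V = {0})" for V :: "'h set"
    using inj_image_eq_iff[OF inj, of V "{0}"] by simp
  then show "sv_count (single_block i k A) t = sv_count A t"
    unfolding sv_count_def
    by (intro sum.cong Collect_cong) (auto simp: sp dim_linear_image[OF lin inj])
qed


section \<open>The determinant of a block triangular operator\<close>

text \<open>A further member of an orthonormal basis containing these vectors would have all its components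
  orthogonal to \<open>B\<close>, hence zero.\<close>

lemma is_onb_axis:
  fixes B :: "'h::chilbert_space set"
  assumes B: "is_onb B"
  shows "is_onb (\<Union>i::'n::finite. axis i ` B)"
proof -
  have on: "orthonormal B" using B by (simp add: is_onb_iff)
  have "0 \<notin> B" using orthonormal_norm[OF on, of 0] by auto
  then have "orthonormal (\<Union>i::'n. axis i ` B)"
    using on by (auto simp: orthonormal_def cinner_axis_left axis_eq_axis) (auto simp: axis_def)
  then obtain C where C: "(\<Union>i::'n. axis i ` B) \<subseteq> C" "is_onb C"
    using orthonormal_extends_to_onb by blast
  have "c \<in> (\<Union>i::'n. axis i ` B)" if c: "c \<in> C" for c
  proof (rule ccontr)
    assume "c \<notin> (\<Union>i::'n. axis i ` B)"
    then have "cinner (axis i b) c = 0" if b: "b \<in> B" for i b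
    proof -
      have "axis i b \<in> C" "axis i b \<noteq> c" using b C(1) \<open>c \<notin> (\<Union>i::'n. axis i ` B)\<close> by blast+
      then show ?thesis using C(2) c orthonormal_cinner[of C "axis i b" c] by (simp add: is_onb_iff)
    qed
    then have zero: "cinner b (c $ i) = 0" if "b \<in> B" for i b
      using that by (simp add: cinner_axis_left)
    have "c $ i = 0" for i
    proof -
      have "((\<lambda>b. cinner b (c $ i) *\<^sub>C b) has_sum 0) B"
        by (rule has_sum_0) (simp add: zero)
      then show ?thesis using has_sum_fourier[OF B, of "c $ i"] has_sum_unique by blast
    qed
    then have "c = 0" by (simp add: vec_eq_iff)
    then show False using orthonormal_norm[of C c] C(2) c by (simp add: is_onb_iff)
  qed
  then have "C = (\<Union>i::'n. axis i ` B)" using C(1) by blast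
  then show ?thesis using C(2) by simp
qed

text \<open>In a basis adapted to the decomposition, every principal minor of a block triangular operator
  is a product of principal minors of the diagonal blocks, and a finite subset of the basis is an
  arbitrary choice of a finite subset for each summand. So the Fredholm series is the product of
  the Fredholm series of the diagonal blocks.\<close>

theorem fredholm_det_block_triangular:
  fixes T :: "('h::chilbert_space, 'n::finite) block_op" and r :: nat
  assumes T: "nuclear_expansion I u v T" and idx: "bij_betw idx {0..r} (UNIV :: 'n set)"
    and tri: "(\<forall>i\<le>r. \<forall>k\<le>r. i < k \<longrightarrow> block T (idx i) (idx k) = 0) \<or>
      (\<forall>i\<le>r. \<forall>k\<le>r. k < i \<longrightarrow> block T (idx i) (idx k) = 0)"
  shows "fredholm_det T = (\<Prod>j=0..r. fredholm_det (block T (idx j) (idx j)))"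
proof -
  obtain B :: "'h set" where B: "is_onb B" using onb_exists by blast
  define E where "E = (\<Union>i::'n. axis i ` B)"
  define M where "M e f = cinner e (T *\<^sub>V f)" for e f
  define part where "part S i = {b\<in>B. axis i b \<in> S}" for S :: "('h ^ 'n) set" and i
  have B0: "b \<noteq> 0" if "b \<in> B" for b
    using orthonormal_norm[of B b] B that by (auto simp: is_onb_iff)
  have M_axis: "M (axis i b) (axis k c) = cinner b (block T i k *\<^sub>V c)" for i k b c
    by (simp add: M_def cinner_axis_left block_apply)
  have minor: "principal_minor T S = (\<Prod>i\<in>UNIV. principal_minor (block T i i) (part S i))"
    if S: "finite S" "S \<subseteq> E" for S
  proof -
    define U where "U j = axis (idx j) ` part S (idx j)" for j
    have fin_part: "finite (part S i)" for i
    proof (rule finite_imageD)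
      show "finite (axis i ` part S i :: ('h ^ 'n) set)"
        by (rule finite_subset[OF _ S(1)]) (auto simp: part_def)
    qed (auto simp: inj_on_def axis_eq_axis)
    have U_det: "leibniz_det (U j) M = principal_minor (block T (idx j) (idx j)) (part S (idx j))" for j
    proof -
      have "inj_on (axis (idx j) :: 'h \<Rightarrow> 'h ^ 'n) (part S (idx j))" by (auto simp: inj_on_def axis_eq_axis)
      then show ?thesis
        unfolding U_def by (simp add: leibniz_det_reindex fin_part M_axis principal_minor_eq)
    qed
    have idx_eq: "idx i = idx j \<longleftrightarrow> i = j" if "i \<le> r" "j \<le> r" for i j
      using inj_on_eq_iff[OF bij_betw_imp_inj_on[OF idx]] that by simp
    have "leibniz_det (\<Union>j<m. U j) M = (\<Prod>j<m. leibniz_det (U j) M)" if "m \<le> Suc r" for m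
      using that
    proof (induction m)
      case 0
      then show ?case by (simp add: leibniz_det_def sign_id)
    next
      case (Suc m)
      then have m: "m \<le> r" by simp
      let ?A = "\<Union>j<m. U j"
      have fin: "finite ?A" "finite (U m)" using fin_part by (auto simp: U_def)
      have disj: "?A \<inter> U m = {}"
      proof (rule ccontr)
        assume "?A \<inter> U m \<noteq> {}"
        then obtain e where "e \<in> ?A" "e \<in> U m" by blast
        then obtain j b c where "j < m" "b \<in> part S (idx j)" "axis (idx j) b = axis (idx m) c"
          by (auto simp: U_def) metis
        moreover have "b \<noteq> 0" using calculation(2) B0 by (auto simp: part_def)
        ultimately show False using idx_eq[of j m] m by (auto simp: axis_eq_axis)
      qed
      have "leibniz_det (?A \<union> U m) M = leibniz_det ?A M * leibniz_det (U m) M"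
        using tri
      proof
        assume lower: "\<forall>i\<le>r. \<forall>k\<le>r. i < k \<longrightarrow> block T (idx i) (idx k) = 0"
        show ?thesis
          by (rule leibniz_det_block_triangular[OF fin disj])
            (use lower m in \<open>auto simp: U_def M_axis\<close>)
      next
        assume upper: "\<forall>i\<le>r. \<forall>k\<le>r. k < i \<longrightarrow> block T (idx i) (idx k) = 0"
        have "U m \<inter> ?A = {}" using disj by blast
        then have "leibniz_det (U m \<union> ?A) M = leibniz_det (U m) M * leibniz_det ?A M"
          by (rule leibniz_det_block_triangular[OF fin(2,1)])
            (use upper m in \<open>auto simp: U_def M_axis\<close>)
        then show ?thesis by (simp add: Un_commute mult.commute)
      qed
      moreover have "(\<Union>j<Suc m. U j) = ?A \<union> U m" by (auto simp: lessThan_Suc)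
      ultimately show ?case using Suc by simp
    qed
    from this[of "Suc r"]
    have "leibniz_det (\<Union>j<Suc r. U j) M
        = (\<Prod>j\<in>{0..r}. principal_minor (block T (idx j) (idx j)) (part S (idx j)))"
      by (simp add: U_det lessThan_Suc_atMost atMost_atLeast0)
    also have "\<dots> = (\<Prod>i\<in>UNIV. principal_minor (block T i i) (part S i))"
      by (rule prod.reindex_bij_betw[OF idx])
    also have "(\<Union>j<Suc r. U j) = S"
    proof (intro equalityI subsetI)
      fix e assume e: "e \<in> S"
      then obtain i b where ib: "e = axis i b" "b \<in> B" using S(2) by (auto simp: E_def)
      obtain j where "j \<le> r" "i = idx j" using bij_betw_imp_surj_on[OF idx] by fastforce
      then show "e \<in> (\<Union>j<Suc r. U j)" using e ib by (auto simp: U_def part_def)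
    qed (auto simp: U_def part_def)
    finally show ?thesis by (simp add: principal_minor_eq M_def[abs_def])
  qed
  define F where "F = {P. finite P \<and> P \<subseteq> B}"
  have bij: "bij_betw part {S. finite S \<and> S \<subseteq> E} (PiE UNIV (\<lambda>_::'n. F))"
  proof (rule bij_betw_byWitness[where f' = "\<lambda>g. \<Union>i. axis i ` g i"])
    show "\<forall>S\<in>{S. finite S \<and> S \<subseteq> E}. (\<Union>i. axis i ` part S i) = S"
      by (fastforce simp: part_def E_def)
    show "\<forall>g\<in>PiE UNIV (\<lambda>_::'n. F). part (\<Union>i. axis i ` g i) = g"
    proof
      fix g assume "g \<in> PiE UNIV (\<lambda>_::'n. F)"
      then have gB: "b \<in> B" if "b \<in> g i" for b i using that by (auto simp: F_def PiE_def Pi_def)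
      have "b \<in> part (\<Union>i. axis i ` g i) i \<longleftrightarrow> b \<in> g i" for i b
        using gB B0 by (auto simp: part_def axis_eq_axis)
      then show "part (\<Union>i. axis i ` g i) = g" by blast
    qed
    show "part ` {S. finite S \<and> S \<subseteq> E} \<subseteq> PiE UNIV (\<lambda>_. F)"
    proof (intro image_subsetI PiE_I)
      fix S i assume S: "S \<in> {S. finite S \<and> S \<subseteq> E}"
      have "finite (part S i)"
      proof (rule finite_imageD)
        show "finite (axis i ` part S i :: ('h ^ 'n) set)"
          by (rule finite_subset[of _ S]) (use S in \<open>auto simp: part_def\<close>)
      qed (auto simp: inj_on_def axis_eq_axis)
      then show "part S i \<in> F" by (auto simp: F_def part_def)
    qed simp
    show "(\<lambda>g. \<Union>i. axis i ` g i) ` PiE UNIV (\<lambda>_::'n. F) \<subseteq> {S. finite S \<and> S \<subseteq> E}"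
      by (force simp: F_def E_def PiE_def Pi_def)
  qed
  have diag: "(principal_minor (block T i i) has_sum fredholm_det (block T i i)) F" for i
    unfolding F_def block_eq
    by (rule has_sum_fredholm_det[OF nuclear_expansion_compose_left[OF nuclear_expansion_compose_right[OF T]] B])
  have "((\<lambda>g. \<Prod>i\<in>UNIV. principal_minor (block T i i) (g i)) has_sum
      (\<Prod>i\<in>UNIV. fredholm_det (block T i i))) (PiE UNIV (\<lambda>_::'n. F))"
  proof (rule has_sum_prod_PiE)
    fix i :: 'n
    show "(\<lambda>P. norm (principal_minor (block T i i) P)) summable_on F"
      using has_sum_imp_summable[OF diag[of i]] summable_on_iff_abs_summable_on_complex by blast
  qed (simp_all add: diag)
  then have "((\<lambda>S. \<Prod>i\<in>UNIV. principal_minor (block T i i) (part S i)) has_sum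
      (\<Prod>i\<in>UNIV. fredholm_det (block T i i))) {S. finite S \<and> S \<subseteq> E}"
    by (subst has_sum_reindex_bij_betw[OF bij])
  also have "?this \<longleftrightarrow> (principal_minor T has_sum (\<Prod>i\<in>UNIV. fredholm_det (block T i i))) {S. finite S \<and> S \<subseteq> E}"
    by (rule has_sum_cong) (simp add: minor)
  finally have "fredholm_det T = (\<Prod>i\<in>UNIV. fredholm_det (block T i i))"
    using fredholm_det_eqI[OF T is_onb_axis[OF B]] by (simp add: E_def)
  also have "\<dots> = (\<Prod>j=0..r. fredholm_det (block T (idx j) (idx j)))"
    by (rule prod.reindex_bij_betw[OF idx, symmetric])
  finally show ?thesis .
qed


section \<open>Factorisation of a compact operator into compact factors\<close>

primrec op_prod :: "(nat \<Rightarrow> ('h::complex_inner \<Rightarrow>\<^sub>C\<^sub>L 'h)) \<Rightarrow> nat \<Rightarrow> ('h \<Rightarrow>\<^sub>C\<^sub>L 'h)" where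
  "op_prod A 0 = id_cblinfun"
| "op_prod A (Suc j) = A (Suc j) o\<^sub>C\<^sub>L op_prod A j"

lemma op_prod_zero_factor:
  assumes "A j = 0" "1 \<le> j" "j \<le> r"
  shows "op_prod A r = 0"
  using assms(3)
proof (induction r rule: dec_induct)
  case base
  then obtain i where "j = Suc i" using assms(2) by (cases j) auto
  then show ?case using assms(1) by (intro cblinfun_eqI) simp
next
  case (step n)
  then show ?case by (intro cblinfun_eqI) (simp add: cblinfun_zero)
qed

text \<open>With \<open>K = V |K|\<close> the polar decomposition, the factors are \<open>|K|\<^bsup>1/r\<^esup>\<close>, taken \<open>r - 1\<close> times, and
  \<open>V |K|\<^bsup>1/r\<^esup>\<close>. They are defined through their values on an orthonormal basis of eigenvectors of
  \<open>K\<^sup>*K\<close>, and are compact because the \<open>r\<close>-th roots of the norms \<open>\<parallel>K b\<parallel>\<close> vanish at infinity when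
  these norms do.\<close>

lemma compact_op_factorization:
  fixes K :: "'h::chilbert_space \<Rightarrow>\<^sub>C\<^sub>L 'h"
  assumes K: "compact_op K" and r: "r \<ge> 1"
  obtains A where "\<And>j. compact_op (A j)" "op_prod A r = K"
proof -
  obtain B where B: "is_onb B"
      and eig: "\<And>b. b \<in> B \<Longrightarrow> adj K *\<^sub>V K *\<^sub>V b = complex_of_real ((norm (K *\<^sub>V b))\<^sup>2) *\<^sub>C b"
    using compact_op_eigenbasis[OF K] by blast
  have on: "orthonormal B" using B by (simp add: is_onb_iff)
  have nB: "norm b = 1" if "b \<in> B" for b using orthonormal_norm[OF on that] .
  have orthK: "cinner (K *\<^sub>V b) (K *\<^sub>V c) = 0" if "b \<in> B" "c \<in> B" "b \<noteq> c" for b c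
    by (rule eigenbasis_images_orthogonal[OF on that eig[OF that(1)]])
  obtain C where C: "C > 0" "\<And>x. norm (K *\<^sub>V x) \<le> norm x * C" using cblinfun_norm_bound by blast
  define w where "w b = root r (norm (K *\<^sub>V b))" for b
  have w0: "w b \<ge> 0" for b using r by (simp add: w_def)
  have wr: "w b ^ r = norm (K *\<^sub>V b)" for b using r by (simp add: w_def)
  have w_le: "w b \<le> root r C" if "b \<in> B" for b
    unfolding w_def using r C(2)[of b] nB[OF that] by (intro real_root_le_mono) auto
  have fin: "finite {b\<in>B. w b \<ge> \<epsilon>}" if \<epsilon>: "\<epsilon> > 0" for \<epsilon>
  proof (rule finite_subset)
    show "finite {b\<in>B. norm (K *\<^sub>V b) \<ge> \<epsilon> ^ r}"
      by (rule finite_large_images[OF K _ orthK]) (use nB \<epsilon> in auto)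
    show "{b\<in>B. w b \<ge> \<epsilon>} \<subseteq> {b\<in>B. norm (K *\<^sub>V b) \<ge> \<epsilon> ^ r}"
      using \<epsilon> by (auto simp flip: wr intro: power_mono)
  qed
  have compactI: "compact_op T" if "\<And>b c. b \<in> B \<Longrightarrow> c \<in> B \<Longrightarrow> b \<noteq> c \<Longrightarrow> cinner (T *\<^sub>V b) (T *\<^sub>V c) = 0"
      "\<And>b. b \<in> B \<Longrightarrow> norm (T *\<^sub>V b) \<le> w b" for T :: "'h \<Rightarrow>\<^sub>C\<^sub>L 'h"
  proof (rule compact_op_if_images_vanish[OF B that(1)])
    fix \<epsilon> :: real assume "\<epsilon> > 0"
    show "finite {b\<in>B. norm (T *\<^sub>V b) \<ge> \<epsilon>}"
      by (rule finite_subset[OF _ fin[OF \<open>\<epsilon> > 0\<close>]]) (use that(2) in \<open>auto intro: order_trans\<close>)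
  qed auto
  have scaled: "cinner (c *\<^sub>C x) (d *\<^sub>C y) = 0" if "cinner x y = 0" for c d and x y :: 'h
    using that by (simp add: cinner_scaleC_left cinner_scaleC_right)
  have orthB: "cinner b c = 0" if "b \<in> B" "c \<in> B" "b \<noteq> c" for b c
    using orthonormal_cinner[OF on that(1,2)] that(3) by simp
  have normV: "norm (complex_of_real (w b / norm (K *\<^sub>V b)) *\<^sub>C (K *\<^sub>V b)) \<le> w b" for b
    using w0[of b] by (simp add: norm_scaleC norm_divide)
  obtain D :: "'h \<Rightarrow>\<^sub>C\<^sub>L 'h" where D: "\<And>b. b \<in> B \<Longrightarrow> D *\<^sub>V b = complex_of_real (w b) *\<^sub>C b"
    by (rule operator_on_onb_exists[OF B, of "\<lambda>b. complex_of_real (w b) *\<^sub>C b" "root r C"])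
      (use w_le w0 nB in \<open>auto simp: norm_scaleC intro: scaled orthB\<close>)
  obtain V :: "'h \<Rightarrow>\<^sub>C\<^sub>L 'h" where
      V: "\<And>b. b \<in> B \<Longrightarrow> V *\<^sub>V b = complex_of_real (w b / norm (K *\<^sub>V b)) *\<^sub>C (K *\<^sub>V b)"
    by (rule operator_on_onb_exists[OF B, of "\<lambda>b. complex_of_real (w b / norm (K *\<^sub>V b)) *\<^sub>C (K *\<^sub>V b)" "root r C"])
      (use order_trans[OF normV w_le] in \<open>blast intro: scaled orthK\<close>)+
  define A where "A j = (if j < r then D else V)" for j
  have "compact_op D" by (rule compactI) (use D w0 nB in \<open>auto simp: norm_scaleC intro: scaled orthB\<close>)
  moreover have "compact_op V"
  proof (rule compactI)
    show "norm (V *\<^sub>V b) \<le> w b" if "b \<in> B" for b using normV V[OF that] by simp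
  qed (simp only: V, blast intro: scaled orthK)
  ultimately have A: "compact_op (A j)" for j by (simp add: A_def)
  have "op_prod A r = K"
  proof (rule cblinfun_eq_on_onb[OF B])
    fix b assume b: "b \<in> B"
    have lower: "op_prod A j *\<^sub>V b = complex_of_real (w b ^ j) *\<^sub>C b" if "j < r" for j
      using that
    proof (induction j)
      case (Suc j)
      then show ?case
        by (simp add: A_def cblinfun_scaleC D[OF b] scaleC_scaleC mult.commute)
    qed (simp add: scaleC_one)
    obtain m where m: "r = Suc m" using r by (cases r) auto
    have "op_prod A r *\<^sub>V b = V *\<^sub>V (complex_of_real (w b ^ m) *\<^sub>C b)"
      using lower[of m] by (simp add: m A_def)
    also have "\<dots> = complex_of_real (w b ^ r / norm (K *\<^sub>V b)) *\<^sub>C (K *\<^sub>V b)"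
      by (simp add: cblinfun_scaleC V[OF b] scaleC_scaleC m mult.commute)
    also have "\<dots> = K *\<^sub>V b" by (cases "K *\<^sub>V b = 0") (simp_all add: wr scaleC_one)
    finally show "op_prod A r *\<^sub>V b = K *\<^sub>V b" .
  qed
  then show ?thesis using A that by blast
qed


section \<open>Diagonal operators\<close>

lemma infinite_onb:
  fixes B :: "'h::complex_inner set"
  assumes B: "is_onb B" and inf: "\<nexists>F::'h set. finite F \<and> complex_vector.span F = UNIV"
  shows "infinite B"
proof
  assume fin: "finite B"
  have "x \<in> complex_vector.span B" for x
  proof -
    have "x = (\<Sum>b\<in>B. cinner b x *\<^sub>C b)"
      using has_sum_fourier[OF B, of x] fin by (simp add: has_sum_finite_iff)
    also have "\<dots> \<in> complex_vector.span B"
      by (intro complex_vector.span_sum complex_vector.span_scale complex_vector.span_base)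
    finally show ?thesis .
  qed
  then show False using fin inf by blast
qed

lemma antimono_null_nonneg:
  fixes \<sigma> :: "nat \<Rightarrow> real"
  assumes "antimono \<sigma>" "\<sigma> \<longlonglongrightarrow> 0"
  shows "\<sigma> j \<ge> 0"
  by (rule LIMSEQ_le_const2[OF assms(2)]) (use assms(1) in \<open>auto simp: antimono_def\<close>)

text \<open>The operator acts by \<open>\<sigma>\<close> on a sequence \<open>e\<close> of distinct members of an orthonormal basis \<open>B\<close>, and
  vanishes on the others. The basis and the diagonal entries \<open>d\<close> are recorded because the Fredholm
  series of \<open>K\<^sup>*K\<close> can be read off from them.\<close>

lemma diagonal_operator_exists:
  fixes \<sigma> :: "nat \<Rightarrow> real"
  assumes inf: "\<nexists>F::'h::chilbert_space set. finite F \<and> complex_vector.span F = UNIV"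
    and \<sigma>: "antimono \<sigma>" "\<sigma> \<longlonglongrightarrow> 0"
  obtains K :: "'h::chilbert_space \<Rightarrow>\<^sub>C\<^sub>L 'h" and B and e :: "nat \<Rightarrow> 'h" and d :: "'h \<Rightarrow> real"
  where "compact_op K" "\<And>j. singular_value K (Suc j) = \<sigma> j"
    and "is_onb B" "inj e" "range e \<subseteq> B" "\<And>j. d (e j) = \<sigma> j" "\<And>b. d b \<ge> 0"
    and "\<And>b. b \<in> B \<Longrightarrow> (adj K o\<^sub>C\<^sub>L K) *\<^sub>V b = complex_of_real ((d b)\<^sup>2) *\<^sub>C b"
proof -
  obtain B :: "'h set" where B: "is_onb B" using onb_exists by blast
  have on: "orthonormal B" using B by (simp add: is_onb_iff)
  have nB: "norm b = 1" if "b \<in> B" for b using orthonormal_norm[OF on that] .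
  have orthB: "cinner b c = 0" if "b \<in> B" "c \<in> B" "b \<noteq> c" for b c
    using orthonormal_cinner[OF on that(1,2)] that(3) by simp
  obtain e :: "nat \<Rightarrow> 'h" where e: "inj e" "range e \<subseteq> B"
    using infinite_countable_subset[OF infinite_onb[OF B inf]] by blast
  note \<sigma>0 = antimono_null_nonneg[OF \<sigma>]
  define d where "d b = (if b \<in> range e then \<sigma> (inv e b) else 0)" for b
  have de: "d (e j) = \<sigma> j" for j using e(1) by (simp add: d_def)
  have d0: "d b \<ge> 0" for b using \<sigma>0 by (simp add: d_def)
  have d_le: "d b \<le> \<sigma> 0" for b using \<sigma>(1) \<sigma>0[of 0] by (auto simp: d_def antimono_def)
  have large: "{b\<in>B. t \<le> d b} = e ` {j. t \<le> \<sigma> j}" if "t > 0" for t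
    using that e(2) by (auto simp: d_def inv_f_f[OF e(1)] inj_eq[OF e(1)] split: if_splits)
  have fin: "finite {j. t \<le> \<sigma> j}" if "t > 0" for t
  proof -
    have "\<forall>\<^sub>F j in sequentially. \<sigma> j < t" using order_tendstoD(2)[OF \<sigma>(2) that] .
    then obtain N where "\<And>j. j \<ge> N \<Longrightarrow> \<sigma> j < t" by (auto simp: eventually_sequentially)
    then have "{j. t \<le> \<sigma> j} \<subseteq> {..<N}" by (force simp: not_less[symmetric])
    then show ?thesis by (rule finite_subset) simp
  qed
  obtain K :: "'h \<Rightarrow>\<^sub>C\<^sub>L 'h" where K: "\<And>b. b \<in> B \<Longrightarrow> K *\<^sub>V b = complex_of_real (d b) *\<^sub>C b"
    by (rule operator_on_onb_exists[OF B, of "\<lambda>b. complex_of_real (d b) *\<^sub>C b" "\<sigma> 0"])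
      (use d_le d0 nB orthB in \<open>auto simp: norm_scaleC cinner_scaleC_left cinner_scaleC_right\<close>)
  have nK: "norm (K *\<^sub>V b) = d b" if "b \<in> B" for b
    using that d0 by (simp add: K norm_scaleC nB)
  have finK: "finite {b\<in>B. t \<le> norm (K *\<^sub>V b)}" if "t > 0" for t
  proof -
    have "{b\<in>B. t \<le> norm (K *\<^sub>V b)} = {b\<in>B. t \<le> d b}" using nK by auto
    then show ?thesis using large[OF that] fin[OF that] by simp
  qed
  have "compact_op K"
    by (rule compact_op_if_images_vanish[OF B _ finK])
      (use orthB in \<open>auto simp: K cinner_scaleC_left cinner_scaleC_right\<close>)
  have adjK: "adj K *\<^sub>V b = complex_of_real (d b) *\<^sub>C b" if b: "b \<in> B" for b
  proof -
    have c: "cinner c (adj K *\<^sub>V b) = cinner c (complex_of_real (d b) *\<^sub>C b)" if "c \<in> B" for c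
      using that b orthB by (cases "b = c") (auto simp: cinner_adj_right K cinner_scaleC_left cinner_scaleC_right)
    have "((\<lambda>c. cinner c (adj K *\<^sub>V b) *\<^sub>C c) has_sum (complex_of_real (d b) *\<^sub>C b)) B"
      by (rule has_sum_cong[THEN iffD1, OF _ has_sum_fourier[OF B]]) (simp add: c)
    then show ?thesis using has_sum_fourier[OF B, of "adj K *\<^sub>V b"] has_sum_unique by blast
  qed
  have KK: "(adj K o\<^sub>C\<^sub>L K) *\<^sub>V b = complex_of_real ((d b)\<^sup>2) *\<^sub>C b" if "b \<in> B" for b
    using that by (simp add: K adjK cblinfun_scaleC scaleC_scaleC power2_eq_square)
  have eig: "adj K *\<^sub>V K *\<^sub>V b = complex_of_real ((norm (K *\<^sub>V b))\<^sup>2) *\<^sub>C b" if "b \<in> B" for b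
    using KK[OF that] nK[OF that] by simp
  have count: "sv_count K t = card {j. t \<le> \<sigma> j}" if "t > 0" for t
  proof -
    have "sv_count K t = card {b\<in>B. t \<le> norm (K *\<^sub>V b)}"
      by (rule sv_count_eigenbasis[OF B eig that finK[OF that]])
    also have "{b\<in>B. t \<le> norm (K *\<^sub>V b)} = {b\<in>B. t \<le> d b}" using nK by auto
    also have "\<dots> = e ` {j. t \<le> \<sigma> j}" by (rule large[OF that])
    also have "card (e ` {j. t \<le> \<sigma> j}) = card {j. t \<le> \<sigma> j}"
      by (rule card_image[OF inj_on_subset[OF e(1)]]) simp
    finally show ?thesis .
  qed
  have "singular_value K (Suc j) = \<sigma> j" for j
  proof -
    have "Suc j \<le> card {i. t \<le> \<sigma> i} \<longleftrightarrow> t \<le> \<sigma> j" if t: "t > 0" for t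
    proof
      assume "t \<le> \<sigma> j"
      then have "{..j} \<subseteq> {i. t \<le> \<sigma> i}" using \<sigma>(1) by (auto simp: antimono_def intro: order_trans)
      then show "Suc j \<le> card {i. t \<le> \<sigma> i}" using card_mono[OF fin[OF t], of "{..j}"] by simp
    next
      assume le: "Suc j \<le> card {i. t \<le> \<sigma> i}"
      show "t \<le> \<sigma> j"
      proof (rule ccontr)
        assume "\<not> t \<le> \<sigma> j"
        then have "{i. t \<le> \<sigma> i} \<subseteq> {..<j}"
          using \<sigma>(1) by (auto simp: antimono_def not_le[symmetric]) (meson linorder_not_le order.trans)
        then show False using card_mono[of "{..<j}" "{i. t \<le> \<sigma> i}"] le by simp
      qed
    qed
    then have eq: "insert 0 {t. 0 < t \<and> Suc j \<le> sv_count K t} = {0..\<sigma> j}"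
      using count \<sigma>0[of j] by auto
    show ?thesis unfolding singular_value_def eq using \<sigma>0[of j] by simp
  qed
  with \<open>compact_op K\<close> show ?thesis using that B e de d0 KK by blast
qed


section \<open>Representations of the free Lie algebra\<close>

primrec lie_term_eval :: "('q \<Rightarrow> ('a::complex_inner \<Rightarrow>\<^sub>C\<^sub>L 'a)) \<Rightarrow> 'q lie_term \<Rightarrow> ('a \<Rightarrow>\<^sub>C\<^sub>L 'a)" where
  "lie_term_eval X LZero = 0"
| "lie_term_eval X (LGen q) = X q"
| "lie_term_eval X (LAdd s t) = lie_term_eval X s + lie_term_eval X t"
| "lie_term_eval X (LScale c t) = c *\<^sub>C lie_term_eval X t"
| "lie_term_eval X (LBracket s t) = commutator (lie_term_eval X s) (lie_term_eval X t)"

lemma commutator_apply: "commutator S T *\<^sub>V x = S *\<^sub>V T *\<^sub>V x - T *\<^sub>V S *\<^sub>V x"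
  by (simp add: commutator_def)

lemma lie_term_eval_cong: "lie_eq s t \<Longrightarrow> lie_term_eval X s = lie_term_eval X t"
proof (induction rule: lie_eq.induct)
  case (add_neg x)
  then show ?case by (simp add: scaleC_minus1)
next
  case (jacobi x y z)
  then show ?case
    by (intro cblinfun_eqI) (simp add: commutator_apply cblinfun_add cblinfun_diff)
qed (auto intro!: cblinfun_eqI simp: commutator_apply cblinfun_add cblinfun_diff cblinfun_scaleC
    cblinfun_zero scaleC_add_right scaleC_add_left scaleC_scaleC scaleC_one
    complex_vector.scale_right_diff_distrib algebra_simps)

lift_definition free_lie_eval :: "('q \<Rightarrow> ('a::complex_inner \<Rightarrow>\<^sub>C\<^sub>L 'a)) \<Rightarrow> 'q free_lie \<Rightarrow> ('a \<Rightarrow>\<^sub>C\<^sub>L 'a)"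
  is lie_term_eval
  by (rule lie_term_eval_cong)

lemma free_lie_eval_gen: "free_lie_eval X (lie_gen q) = X q"
  by transfer simp

lemma free_lie_eval_bracket:
  "free_lie_eval X (lie_bracket x y) = commutator (free_lie_eval X x) (free_lie_eval X y)"
  by transfer simp

lemma free_lie_eval_zero: "free_lie_eval X 0 = 0"
  by transfer simp

lemma lie_hom_free_lie_eval: "lie_hom (free_lie_eval X)"
  unfolding lie_hom_def by (intro conjI allI; transfer) simp_all

lemma depth_word_1: "depth_word (Suc 0) = lie_gen 1"
  by (simp add: depth_word_def)

lemma depth_word_Suc: "j \<ge> 1 \<Longrightarrow> depth_word (Suc j) = lie_bracket (lie_gen (Suc j)) (depth_word j)"
  by (simp add: depth_word_def)

lemma depth_word_homogeneous:
  assumes "1 \<le> j" "j \<le> r"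
  shows "lie_homogeneous {1..r} j (depth_word j)"
  using assms
proof (induction j rule: dec_induct)
  case base
  then show ?case using lie_homogeneous.gen[of 1 "{1..r}"] by (simp add: depth_word_1)
next
  case (step j)
  then have "lie_homogeneous {1..r} (1 + j) (lie_bracket (lie_gen (Suc j)) (depth_word j))"
    by (intro lie_homogeneous.bracket lie_homogeneous.gen) auto
  then show ?case using step by (simp add: depth_word_Suc)
qed

lemma free_lie_eval_depth_word:
  assumes W: "depth_model idx r X W" and j: "1 \<le> j" "j \<le> r"
  shows "free_lie_eval X (depth_word j) = W j"
  using j
proof (induction j rule: dec_induct)
  case base
  then show ?case using W by (simp add: depth_word_1 free_lie_eval_gen depth_model_def)
next
  case (step j)
  then have "W (Suc j) = commutator (X (Suc j)) (W j)" using W by (simp add: depth_model_def)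
  then show ?case using step by (simp add: depth_word_Suc free_lie_eval_bracket free_lie_eval_gen)
qed


section \<open>The block model of a compact operator\<close>

text \<open>For blocks on the subdiagonal only one of the two products in each commutator survives, so the
  iterated commutator is the composition of the blocks.\<close>

lemma depth_model_exists:
  fixes K :: "'h::chilbert_space \<Rightarrow>\<^sub>C\<^sub>L 'h" and idx :: "nat \<Rightarrow> 'n::finite"
  assumes K: "compact_op K" "K \<noteq> 0" and r: "r \<ge> 1" and idx: "inj_on idx {0..r}"
  obtains X W where "depth_model idx r X W" "W r = single_block (idx r) (idx 0) K"
proof -
  obtain A where A: "\<And>j. compact_op (A j)" "op_prod A r = K"
    using compact_op_factorization[OF K(1) r] by blast
  define X where "X j = single_block (idx j) (idx (j - 1)) (A j)" for j
  define W where "W j = single_block (idx j) (idx 0) (op_prod A j)" for j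
  have A0: "A j \<noteq> 0" if "1 \<le> j" "j \<le> r" for j
    using op_prod_zero_factor[of A j r] that A(2) K(2) by blast
  have "W 1 = X 1" by (auto simp: W_def X_def intro!: cblinfun_eqI arg_cong[where f = "single_block _ _"])
  moreover have "W j = commutator (X j) (W (j - 1))" if j: "j \<in> {2..r}" for j
  proof -
    obtain i where i: "j = Suc i" using j by (cases j) auto
    have "idx 0 \<noteq> idx j" using inj_on_eq_iff[OF idx, of 0 j] j by auto
    then show ?thesis by (simp add: i X_def W_def commutator_def single_block_compose)
  qed
  ultimately have "depth_model idx r X W"
    using A(1) A0 by (auto simp: depth_model_def X_def only_nonzero_single_block block_single_block)
  then show ?thesis using that A(2) by (simp add: W_def)
qed

lemma nuclear_expansion_single_block:
  assumes "nuclear_expansion I u v A"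
  obtains u' v' where "nuclear_expansion I u' v' (single_block i k (A :: 'h::chilbert_space \<Rightarrow>\<^sub>C\<^sub>L 'h))"
  unfolding single_block_def
  using nuclear_expansion_compose_left[OF nuclear_expansion_compose_right[OF assms]] by blast

lemma fredholm_det_diagonal_block:
  fixes A :: "'h::chilbert_space \<Rightarrow>\<^sub>C\<^sub>L 'h" and idx :: "nat \<Rightarrow> 'n::finite"
  assumes A: "nuclear_expansion I u v A" and idx: "bij_betw idx {0..r} (UNIV :: 'n set)"
  shows "fredholm_det (z *\<^sub>C single_block (idx 0) (idx 0) A) = fredholm_det (z *\<^sub>C A)"
proof -
  obtain u' v' where "nuclear_expansion I u' v' (single_block (idx 0) (idx 0) A)"
    using nuclear_expansion_single_block[OF A] .
  note nuc = nuclear_expansion_scaleC[OF this, of z]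
  have eq: "idx i = idx 0 \<longleftrightarrow> i = 0" if "i \<le> r" for i
    using inj_on_eq_iff[OF bij_betw_imp_inj_on[OF idx]] that by simp
  have zero: "z *\<^sub>C (0 :: 'h \<Rightarrow>\<^sub>C\<^sub>L 'h) = 0" by (rule complex_vector.scale_zero_right)
  have "fredholm_det (z *\<^sub>C single_block (idx 0) (idx 0) A)
      = (\<Prod>j=0..r. fredholm_det (block (z *\<^sub>C single_block (idx 0) (idx 0) A) (idx j) (idx j)))"
    by (rule fredholm_det_block_triangular[OF nuc idx])
      (auto simp: block_scaleC block_single_block eq zero)
  also have "\<dots> = (\<Prod>j=0..r. if j = 0 then fredholm_det (z *\<^sub>C A) else 1)"
    by (rule prod.cong) (auto simp: block_scaleC block_single_block eq zero fredholm_det_zero)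
  also have "\<dots> = fredholm_det (z *\<^sub>C A)" by simp
  finally show ?thesis .
qed

lemma fredholm_det_off_diagonal_block:
  fixes A :: "'h::chilbert_space \<Rightarrow>\<^sub>C\<^sub>L 'h" and idx :: "nat \<Rightarrow> 'n::finite"
  assumes A: "nuclear_expansion I u v A" and idx: "bij_betw idx {0..r} (UNIV :: 'n set)" and r: "r \<ge> 1"
  shows "fredholm_det (z *\<^sub>C single_block (idx r) (idx 0) A) = 1"
proof -
  obtain u' v' where "nuclear_expansion I u' v' (single_block (idx r) (idx 0) A)"
    using nuclear_expansion_single_block[OF A] .
  note nuc = nuclear_expansion_scaleC[OF this, of z]
  have eq: "idx i = idx k \<longleftrightarrow> i = k" if "i \<le> r" "k \<le> r" for i k
    using inj_on_eq_iff[OF bij_betw_imp_inj_on[OF idx]] that by simp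
  have zero: "z *\<^sub>C (0 :: 'h \<Rightarrow>\<^sub>C\<^sub>L 'h) = 0" by (rule complex_vector.scale_zero_right)
  have "fredholm_det (z *\<^sub>C single_block (idx r) (idx 0) A)
      = (\<Prod>j=0..r. fredholm_det (block (z *\<^sub>C single_block (idx r) (idx 0) A) (idx j) (idx j)))"
    by (rule fredholm_det_block_triangular[OF nuc idx])
      (use r in \<open>auto simp: block_scaleC block_single_block eq zero\<close>)
  also have "\<dots> = (\<Prod>j=0..r. 1)"
    by (rule prod.cong) (use r in \<open>auto simp: block_scaleC block_single_block eq zero fredholm_det_zero\<close>)
  finally show ?thesis by simp
qed

lemma unitarily_equiv_refl: "unitarily_equiv (K :: 'h::complex_inner \<Rightarrow>\<^sub>C\<^sub>L 'h) K"
proof -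
  have "adj (id_cblinfun :: 'h \<Rightarrow>\<^sub>C\<^sub>L 'h) = id_cblinfun" by (rule adj_eqI) simp
  then show ?thesis
    unfolding unitarily_equiv_def unitary_def
    by (intro exI[of _ id_cblinfun]) (auto intro: cblinfun_eqI)
qed


section \<open>Prescribing the singular values\<close>

lemma principal_minor_diagonal:
  assumes on: "orthonormal B" and S: "finite S" "S \<subseteq> B"
    and T: "\<And>b. b \<in> B \<Longrightarrow> T *\<^sub>V b = \<mu> b *\<^sub>C b"
  shows "principal_minor T S = (\<Prod>b\<in>S. \<mu> b)"
proof -
  have off: "cinner e (T *\<^sub>V f) = (if e = f then \<mu> e else 0)" if "e \<in> S" "f \<in> S" for e f
  proof -
    have "e \<in> B" "f \<in> B" using that S(2) by auto
    then show ?thesis by (simp add: T cinner_scaleC_right orthonormal_cinner[OF on])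
  qed
  have "principal_minor T S = (\<Sum>p | p permutes S. if p = id then (\<Prod>b\<in>S. \<mu> b) else 0)"
    unfolding principal_minor_def
  proof (rule sum.cong)
    fix p assume "p \<in> {p. p permutes S}"
    then have p: "p permutes S" by simp
    show "of_int (sign p) * (\<Prod>e\<in>S. cinner e (T *\<^sub>V p e)) = (if p = id then (\<Prod>b\<in>S. \<mu> b) else 0)"
    proof (cases "p = id")
      case True
      then show ?thesis by (auto simp: off sign_id intro!: prod.cong)
    next
      case False
      then obtain e where "p e \<noteq> e" by (auto simp: fun_eq_iff)
      then have "e \<in> S" using permutes_not_in[OF p] by blast
      then have "p e \<in> S" using permutes_in_image[OF p] by blast
      then have "cinner e (T *\<^sub>V p e) = 0" using off \<open>e \<in> S\<close> \<open>p e \<noteq> e\<close> by simp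
      then have "(\<Prod>e\<in>S. cinner e (T *\<^sub>V p e)) = 0" using S(1) \<open>e \<in> S\<close> by (intro prod_zero) auto
      then show ?thesis using False by simp
    qed
  qed simp
  also have "\<dots> = (\<Prod>b\<in>S. \<mu> b)"
    using finite_permutations[OF S(1)] by (simp add: permutes_id)
  finally show ?thesis .
qed

text \<open>All terms of the Fredholm series of a diagonal operator with nonnegative entries are
  nonnegative, so each of them bounds the determinant from below.\<close>

lemma fredholm_det_diagonal_ge:
  fixes T :: "'h::chilbert_space \<Rightarrow>\<^sub>C\<^sub>L 'h"
  assumes T: "nuclear_expansion I u v T" and B: "is_onb B"
    and diag: "\<And>b. b \<in> B \<Longrightarrow> T *\<^sub>V b = complex_of_real (\<mu> b) *\<^sub>C b" and nonneg: "\<And>b. \<mu> b \<ge> 0"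
    and F: "finite F" "F \<subseteq> B"
  shows "(\<Prod>b\<in>F. \<mu> b) \<le> Re (fredholm_det T)"
proof -
  have on: "orthonormal B" using B by (simp add: is_onb_iff)
  have minor: "Re (principal_minor T S) = (\<Prod>b\<in>S. \<mu> b)" if "finite S" "S \<subseteq> B" for S
    using principal_minor_diagonal[OF on that, of T "\<lambda>b. complex_of_real (\<mu> b)"] diag
    by (simp flip: of_real_prod)
  have "(\<Sum>S\<in>{F}. Re (principal_minor T S)) \<le> Re (fredholm_det T)"
  proof (rule finite_sum_le_has_sum[OF has_sum_Re[OF has_sum_fredholm_det[OF T B]]])
    show "0 \<le> Re (principal_minor T S)" if "S \<in> {S. finite S \<and> S \<subseteq> B} - {F}" for S
      using that minor nonneg by (auto intro!: prod_nonneg)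
  qed (use F in auto)
  then show ?thesis using minor[OF F] by simp
qed

lemma prescribed_singular_values:
  fixes idx :: "nat \<Rightarrow> 'n::finite" and \<sigma> :: "nat \<Rightarrow> real"
  assumes r: "r \<ge> 1" and idx: "bij_betw idx {0..r} (UNIV :: 'n set)"
    and inf: "\<nexists>F::'h::chilbert_space set. finite F \<and> complex_vector.span F = UNIV"
    and \<sigma>: "antimono \<sigma>" "\<sigma> \<longlonglongrightarrow> 0" "0 < \<sigma> 0"
  obtains X W :: "nat \<Rightarrow> ('h::chilbert_space, 'n) block_op"
  where "depth_model idx r X W" "W r \<noteq> 0" "\<And>j. singular_value (W r) (Suc j) = \<sigma> j"
    "\<And>p. schatten p (W r) \<longleftrightarrow> summable (\<lambda>j. \<sigma> j powr p)"
    "\<And>a n. trace_class (W r) \<Longrightarrow>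
      (\<Prod>j<n. (a * \<sigma> j)\<^sup>2) \<le> Re (fredholm_det (complex_of_real (a\<^sup>2) *\<^sub>C (adj (W r) o\<^sub>C\<^sub>L W r)))"
proof -
  obtain K :: "'h \<Rightarrow>\<^sub>C\<^sub>L 'h" and B e d where K: "compact_op K" "\<And>j. singular_value K (Suc j) = \<sigma> j"
      and B: "is_onb B" "inj e" "range e \<subseteq> B" and d: "\<And>j. d (e j) = \<sigma> j" "\<And>b. d b \<ge> 0"
      and KK: "\<And>b. b \<in> B \<Longrightarrow> (adj K o\<^sub>C\<^sub>L K) *\<^sub>V b = complex_of_real ((d b)\<^sup>2) *\<^sub>C b"
    using diagonal_operator_exists[OF inf \<sigma>(1,2)] by metis
  have e0: "e 0 \<in> B" using B(3) by auto
  then have "norm (e 0) = 1" using B(1) orthonormal_norm[of B "e 0"] by (simp add: is_onb_iff)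
  then have e0': "e 0 \<noteq> 0" by auto
  have K0: "K \<noteq> 0"
  proof
    assume "K = 0"
    then have "complex_of_real ((\<sigma> 0)\<^sup>2) *\<^sub>C e 0 = 0"
      using KK[OF e0] by (simp add: d cblinfun_zero)
    then show False using e0' \<sigma>(3) by simp
  qed
  obtain X and W :: "nat \<Rightarrow> ('h, 'n) block_op" where XW: "depth_model idx r X W" "W r = single_block (idx r) (idx 0) K"
    using depth_model_exists[OF K(1) K0 r bij_betw_imp_inj_on[OF idx]] by blast
  have sv: "singular_value (W r) (Suc j) = \<sigma> j" for j
    by (simp add: XW(2) singular_value_single_block K(2))
  have sch: "schatten p (W r) \<longleftrightarrow> summable (\<lambda>j. \<sigma> j powr p)" for p
    by (simp add: schatten_def sv) (simp add: XW(2) compact_single_block K(1))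
  show ?thesis
  proof (rule that[OF XW(1) _ sv sch])
    show "W r \<noteq> 0"
    proof
      assume "W r = 0"
      then have "block (W r) (idx r) (idx 0) = 0" by (intro cblinfun_eqI) (simp add: block_apply)
      then show False using K0 by (simp add: XW(2) block_single_block)
    qed
    fix a n assume "trace_class (W r)"
    then have "trace_class K" using sch[of 1] K by (simp add: schatten_def)
    then obtain C where "nuclear_expansion C (\<lambda>b. b) (\<lambda>b. K *\<^sub>V b) K"
      using trace_class_nuclear_expansion by blast
    note nuc = nuclear_expansion_compose_left[OF this, of "adj K"]
    have "adj (W r) o\<^sub>C\<^sub>L W r = single_block (idx 0) (idx 0) (adj K o\<^sub>C\<^sub>L K)"
      by (simp add: XW(2) adj_single_block single_block_compose)
    then have det: "fredholm_det (complex_of_real (a\<^sup>2) *\<^sub>C (adj (W r) o\<^sub>C\<^sub>L W r))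
        = fredholm_det (complex_of_real (a\<^sup>2) *\<^sub>C (adj K o\<^sub>C\<^sub>L K))"
      by (simp only: fredholm_det_diagonal_block[OF nuc idx])
    have "(\<Prod>j<n. (a * \<sigma> j)\<^sup>2) = (\<Prod>b\<in>e ` {..<n}. a\<^sup>2 * (d b)\<^sup>2)"
      by (subst prod.reindex[OF inj_on_subset[OF B(2)]]) (simp_all add: d power_mult_distrib)
    also have "\<dots> \<le> Re (fredholm_det (complex_of_real (a\<^sup>2) *\<^sub>C (adj K o\<^sub>C\<^sub>L K)))"
    proof (rule fredholm_det_diagonal_ge[OF nuclear_expansion_scaleC[OF nuc] B(1)])
      show "(complex_of_real (a\<^sup>2) *\<^sub>C (adj K o\<^sub>C\<^sub>L K)) *\<^sub>V b = complex_of_real (a\<^sup>2 * (d b)\<^sup>2) *\<^sub>C b"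
        if "b \<in> B" for b
        using KK[OF that] by (simp add: scaleC_scaleC)
    qed (use B(3) in auto)
    finally show "(\<Prod>j<n. (a * \<sigma> j)\<^sup>2)
        \<le> Re (fredholm_det (complex_of_real (a\<^sup>2) *\<^sub>C (adj (W r) o\<^sub>C\<^sub>L W r)))"
      by (simp only: det)
  qed
qed


section \<open>Step sequences\<close>

text \<open>For nonincreasing \<open>c\<close>, the nonincreasing sequence which takes the value at least \<open>c m\<close> on its first \<open>N m\<close> entries, and
  is minimal with this property. Choosing \<open>c\<close> and \<open>N\<close> independently prescribes the behaviour of
  counting functions and power sums along a sequence of scales.\<close>

definition step_seq :: "(nat \<Rightarrow> real) \<Rightarrow> (nat \<Rightarrow> nat) \<Rightarrow> nat \<Rightarrow> real"
  where "step_seq c N j = c (LEAST m. j < N m)"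

lemma step_seq:
  assumes c: "antimono c" "c \<longlonglongrightarrow> 0" "\<And>m. 0 < c m" and N: "\<And>m. m < N m"
  shows "antimono (step_seq c N)" "step_seq c N \<longlonglongrightarrow> 0" "0 < step_seq c N j"
    and "j < N m \<Longrightarrow> c m \<le> step_seq c N j"
    and "\<exists>m\<le>j. j < N m \<and> step_seq c N j = c m"
proof -
  define \<mu> where "\<mu> j = (LEAST m. j < N m)" for j
  have \<mu>: "j < N (\<mu> j)" "\<mu> j \<le> j" for j
    unfolding \<mu>_def using N[of j] by (rule LeastI, rule Least_le)
  have least: "\<mu> j \<le> m" if "j < N m" for j m unfolding \<mu>_def using that by (rule Least_le)
  have step: "step_seq c N j = c (\<mu> j)" for j by (simp add: step_seq_def \<mu>_def)
  show le: "c m \<le> step_seq c N j" if "j < N m" for j m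
    using least[OF that] c(1) by (simp add: step antimono_def)
  show anti: "antimono (step_seq c N)"
  proof (rule antimonoI)
    fix i j :: nat assume "i \<le> j"
    then have "i < N (\<mu> j)" using \<mu>(1)[of j] by simp
    then show "step_seq c N j \<le> step_seq c N i" using le by (simp add: step[of j])
  qed
  show pos: "0 < step_seq c N j" for j by (simp add: step c(3))
  show "\<exists>m\<le>j. j < N m \<and> step_seq c N j = c m" using \<mu> step by blast
  show "step_seq c N \<longlonglongrightarrow> 0"
  proof (rule LIMSEQ_I)
    fix e :: real assume "e > 0"
    then obtain M where M: "\<And>m. m \<ge> M \<Longrightarrow> c m < e"
      using order_tendstoD(2)[OF c(2)] by (auto simp: eventually_sequentially)
    have small: "step_seq c N j < e" if "j \<ge> (\<Sum>m<M. N m)" for j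
    proof -
      have "\<not> \<mu> j < M"
      proof
        assume "\<mu> j < M"
        then have "N (\<mu> j) \<le> (\<Sum>m<M. N m)" by (intro member_le_sum) auto
        then show False using \<mu>(1)[of j] that by simp
      qed
      then show ?thesis using M[of "\<mu> j"] by (simp add: step)
    qed
    show "\<exists>no. \<forall>j\<ge>no. norm (step_seq c N j - 0) < e"
      by (rule exI[of _ "\<Sum>m<M. N m"]) (use small pos in \<open>simp add: less_imp_le\<close>)
  qed
qed

lemma step_seq_powr_summable:
  assumes c: "antimono c" "c \<longlonglongrightarrow> 0" "\<And>m. 0 < c m" and N: "\<And>m. m < N m"
    and sum: "summable (\<lambda>m. real (N m) * c m powr s)"
  shows "summable (\<lambda>j. step_seq c N j powr s)"
proof (rule summableI_nonneg_bounded)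
  fix n
  have "(\<Sum>j<n. step_seq c N j powr s) \<le> (\<Sum>j<n. \<Sum>m<n. if j < N m then c m powr s else 0)"
  proof (rule sum_mono)
    fix j assume j: "j \<in> {..<n}"
    obtain m where m: "m \<le> j" "j < N m" "step_seq c N j = c m" using step_seq(5)[OF c N] by blast
    have "(if j < N m then c m powr s else 0) \<le> (\<Sum>m<n. if j < N m then c m powr s else 0)"
      by (rule member_le_sum) (use m(1) j in auto)
    then show "step_seq c N j powr s \<le> (\<Sum>m<n. if j < N m then c m powr s else 0)"
      using m by simp
  qed
  also have "\<dots> = (\<Sum>m<n. \<Sum>j<n. if j < N m then c m powr s else 0)" by (rule sum.swap)
  also have "\<dots> \<le> (\<Sum>m<n. real (N m) * c m powr s)"
  proof (rule sum_mono)
    fix m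
    have "(\<Sum>j<n. if j < N m then c m powr s else 0) = real (card ({..<n} \<inter> {..<N m})) * c m powr s"
      by (simp add: sum.If_cases lessThan_def)
    also have "card ({..<n} \<inter> {..<N m}) \<le> N m" using card_mono[of "{..<N m}" "{..<n} \<inter> {..<N m}"] by simp
    finally show "(\<Sum>j<n. if j < N m then c m powr s else 0) \<le> real (N m) * c m powr s"
      by (simp add: mult_right_mono)
  qed
  also have "\<dots> \<le> (\<Sum>m. real (N m) * c m powr s)"
    using sum by (rule sum_le_suminf) auto
  finally show "(\<Sum>j<n. step_seq c N j powr s) \<le> (\<Sum>m. real (N m) * c m powr s)" .
qed simp

lemma step_seq_powr_suminf_ge:
  assumes c: "antimono c" "c \<longlonglongrightarrow> 0" "\<And>m. 0 < c m" and N: "\<And>m. m < N m"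
    and sum: "summable (\<lambda>j. step_seq c N j powr s)" and s: "s > 0"
  shows "real (N m) * c m powr s \<le> (\<Sum>j. step_seq c N j powr s)"
proof -
  have "real (N m) * c m powr s = (\<Sum>j<N m. c m powr s)" by simp
  also have "\<dots> \<le> (\<Sum>j<N m. step_seq c N j powr s)"
    by (intro sum_mono powr_mono2) (use s c(3) less_imp_le step_seq(4)[OF c N] in auto)
  also have "\<dots> \<le> (\<Sum>j. step_seq c N j powr s)"
    using sum by (rule sum_le_suminf) auto
  finally show ?thesis .
qed

lemma not_bigo_along_sequence:
  fixes f g :: "'a \<Rightarrow> real"
  assumes x: "filterlim x F sequentially"
    and le: "\<And>m. real m * \<bar>g (x m)\<bar> \<le> \<bar>f (x m)\<bar>" and nz: "\<And>m. f (x m) \<noteq> 0"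
  shows "f \<notin> O[F](g)"
proof
  assume "f \<in> O[F](g)"
  then obtain C where "\<forall>\<^sub>F y in F. norm (f y) \<le> C * norm (g y)" by (elim landau_o.bigE)
  then have "\<forall>\<^sub>F m in sequentially. norm (f (x m)) \<le> C * norm (g (x m))"
    using x by (rule eventually_compose_filterlim)
  moreover have "\<forall>\<^sub>F m in sequentially. real m > C"
    using filterlim_real_sequentially by (auto simp: filterlim_at_top_dense)
  ultimately have "\<forall>\<^sub>F m::nat in sequentially. False"
  proof eventually_elim
    case (elim m)
    have "\<bar>g (x m)\<bar> \<noteq> 0" using elim(1) nz[of m] by auto
    then have "C * \<bar>g (x m)\<bar> < real m * \<bar>g (x m)\<bar>" using elim(2) by (intro mult_strict_right_mono) auto
    then show False using elim(1) le[of m] by simp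
  qed
  then show False by simp
qed


section \<open>Singular value sequences with prescribed behaviour\<close>

text \<open>There are at least \<open>(m+1)\<^bsup>m+1\<^esup>\<close> entries of size \<open>1/(m+1)\<close> or more, which contribute
  \<open>(m+1)\<^bsup>m+1-p\<^esup>\<close> to the sum of the \<open>p\<close>-th powers.\<close>

lemma slowly_decaying_sequence_exists:
  "\<exists>\<sigma>::nat \<Rightarrow> real. antimono \<sigma> \<and> \<sigma> \<longlonglongrightarrow> 0 \<and> (\<forall>j. 0 < \<sigma> j) \<and>
    (\<forall>p>0. \<not> summable (\<lambda>j. \<sigma> j powr p))"
proof -
  define c where "c m = 1 / real (Suc m)" for m
  define N :: "nat \<Rightarrow> nat" where "N m = Suc m ^ Suc m" for m
  have c: "antimono c" "c \<longlonglongrightarrow> 0" "\<And>m. 0 < c m"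
  proof -
    show "c \<longlonglongrightarrow> 0" unfolding c_def by (rule LIMSEQ_Suc[OF lim_1_over_n])
  qed (auto simp: c_def intro!: antimonoI frac_le)
  have N: "m < N m" for m
  proof -
    have "Suc m ^ 1 \<le> Suc m ^ Suc m" by (rule power_increasing) auto
    then show ?thesis unfolding N_def by simp
  qed
  have "\<not> summable (\<lambda>j. step_seq c N j powr p)" if p: "p > 0" for p
  proof
    assume sum: "summable (\<lambda>j. step_seq c N j powr p)"
    define L where "L = (\<Sum>j. step_seq c N j powr p)"
    obtain m where m: "real m \<ge> max p L" using real_arch_simple by blast
    have "real (Suc m) \<le> real (Suc m) powr (real (Suc m) - p)"
      using m powr_mono[of 1 "real (Suc m) - p" "real (Suc m)"] by simp
    also have "\<dots> = real (N m) * c m powr p"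
    proof -
      have "real (N m) = real (Suc m) powr real (Suc m)"
        by (simp only: N_def of_nat_power powr_realpow of_nat_0_less_iff zero_less_Suc)
      moreover have "c m powr p = 1 / real (Suc m) powr p"
        by (simp add: c_def powr_divide)
      ultimately show ?thesis by (simp only: powr_diff times_divide_eq_right mult_1_right)
    qed
    also have "\<dots> \<le> L" unfolding L_def by (rule step_seq_powr_suminf_ge[OF c N sum p])
    finally show False using m by simp
  qed
  then show ?thesis using step_seq(1-3)[OF c N] by (intro exI[of _ "step_seq c N"]) simp
qed

text \<open>The sequence stays above \<open>2\<^bsup>-m\<^esup>\<close> up to an index at which \<open>g\<close> has fallen below \<open>4\<^bsup>-m\<^esup>\<close>.\<close>

lemma dominating_sequence_exists:
  fixes g :: "nat \<Rightarrow> real"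
  assumes g: "g \<longlonglongrightarrow> 0"
  shows "\<exists>\<sigma>::nat \<Rightarrow> real. antimono \<sigma> \<and> \<sigma> \<longlonglongrightarrow> 0 \<and> (\<forall>j. 0 < \<sigma> j) \<and>
    (\<forall>f. (\<forall>j. f (Suc j) = \<sigma> j) \<longrightarrow> f \<notin> O(g))"
proof -
  define c :: "nat \<Rightarrow> real" where "c m = (1/2) ^ m" for m
  have c: "antimono c" "c \<longlonglongrightarrow> 0" "\<And>m. 0 < c m"
    unfolding c_def by (auto intro!: antimonoI power_decreasing LIMSEQ_realpow_zero)
  have "\<exists>n>m. \<bar>g n\<bar> \<le> (1/4) ^ m" for m
  proof -
    have "\<forall>\<^sub>F n in sequentially. \<bar>g n\<bar> < (1/4) ^ m"
      using tendsto_rabs_zero[OF g] by (rule order_tendstoD) simp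
    then have "\<forall>\<^sub>F n in sequentially. \<bar>g n\<bar> < (1/4) ^ m \<and> n > m"
      using eventually_gt_at_top by (rule eventually_conj)
    then show ?thesis by (auto simp: eventually_sequentially intro: less_imp_le)
  qed
  then obtain N where N: "\<And>m. m < N m" "\<And>m. \<bar>g (N m)\<bar> \<le> (1/4) ^ m" by metis
  have lim: "filterlim N at_top sequentially"
    by (rule filterlim_at_top_mono[OF filterlim_ident]) (use N(1) less_imp_le in \<open>auto intro!: always_eventually\<close>)
  have "f \<notin> O(g)" if f: "\<And>j. f (Suc j) = step_seq c N j" for f
  proof (rule not_bigo_along_sequence[OF lim])
    fix m
    obtain j where j: "N m = Suc j" using N(1)[of m] by (cases "N m") auto
    have fN: "f (N m) \<ge> c m" unfolding j f using step_seq(4)[OF c N(1), of j m] j by simp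
    have "real m * \<bar>g (N m)\<bar> \<le> 2 ^ m * (1/4) ^ m"
      using N(2)[of m] by (intro mult_mono) (auto simp: less_imp_le)
    also have "\<dots> = c m" by (simp add: c_def flip: power_mult_distrib)
    finally show "real m * \<bar>g (N m)\<bar> \<le> \<bar>f (N m)\<bar>" using fN by simp
    show "f (N m) \<noteq> 0" using fN c(3)[of m] by simp
  qed
  then show ?thesis using step_seq(1-3)[OF c N(1)] by (intro exI[of _ "step_seq c N"]) simp
qed

lemma dominated_sequence_exists:
  fixes g :: "nat \<Rightarrow> real"
  assumes g: "\<And>j. 0 < g j"
  shows "\<exists>\<sigma>::nat \<Rightarrow> real. antimono \<sigma> \<and> \<sigma> \<longlonglongrightarrow> 0 \<and> (\<forall>j. 0 < \<sigma> j) \<and>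
    (\<forall>f. (\<forall>j. f (Suc j) = \<sigma> j) \<longrightarrow> f \<in> o(g))"
proof -
  define \<mu> where "\<mu> j = Min (g ` {..Suc j})" for j
  define \<sigma> where "\<sigma> j = \<mu> j / real (Suc j)" for j
  have \<mu>: "0 < \<mu> j" "\<mu> j \<le> g (Suc j)" "\<mu> j \<le> g 0" for j
    using g by (auto simp: \<mu>_def intro!: Min_le)
  have anti: "antimono \<sigma>"
  proof (rule antimonoI)
    fix i j :: nat assume "i \<le> j"
    then have "\<mu> j \<le> \<mu> i" unfolding \<mu>_def by (intro Min_antimono) auto
    then show "\<sigma> j \<le> \<sigma> i"
      unfolding \<sigma>_def using \<open>i \<le> j\<close> \<mu>(1) less_imp_le by (intro frac_le) auto
  qed
  have lim: "\<sigma> \<longlonglongrightarrow> 0"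
  proof (rule Lim_null_comparison)
    show "\<forall>\<^sub>F j in sequentially. norm (\<sigma> j) \<le> g 0 * (1 / real (Suc j))"
    proof (intro always_eventually allI)
      show "norm (\<sigma> j) \<le> g 0 * (1 / real (Suc j))" for j
        using \<mu>(1)[of j] \<mu>(3)[of j] by (simp add: \<sigma>_def divide_right_mono)
    qed
    show "(\<lambda>j. g 0 * (1 / real (Suc j))) \<longlonglongrightarrow> 0"
      by (rule tendsto_mult_right_zero[OF LIMSEQ_Suc[OF lim_1_over_n]])
  qed
  have "f \<in> o(g)" if f: "\<And>j. f (Suc j) = \<sigma> j" for f
  proof (rule landau_o.smallI)
    fix \<epsilon> :: real assume \<epsilon>: "\<epsilon> > 0"
    have "\<forall>\<^sub>F j in sequentially. 1 / real (Suc j) < \<epsilon>"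
      by (rule order_tendstoD(2)[OF LIMSEQ_Suc[OF lim_1_over_n] \<epsilon>])
    then have "\<forall>\<^sub>F j in sequentially. norm (f (Suc j)) \<le> \<epsilon> * norm (g (Suc j))"
    proof eventually_elim
      case (elim j)
      have "\<sigma> j = 1 / real (Suc j) * \<mu> j" by (simp add: \<sigma>_def)
      also have "\<dots> \<le> \<epsilon> * g (Suc j)" using elim \<mu>[of j] \<epsilon> by (intro mult_mono) auto
      finally show ?case using \<mu>(1)[of j] g[of "Suc j"] by (simp add: f \<sigma>_def)
    qed
    then show "\<forall>\<^sub>F n in sequentially. norm (f n) \<le> \<epsilon> * norm (g n)"
      by (subst (asm) eventually_sequentially_Suc)
  qed
  moreover have "0 < \<sigma> j" for j using \<mu>(1)[of j] by (simp add: \<sigma>_def)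
  ultimately show ?thesis using anti lim by (intro exI[of _ \<sigma>]) simp
qed

text \<open>The quotients \<open>f (2 n) / f n\<close> tend to \<open>0\<close>, which is not a power of \<open>2\<close>.\<close>

lemma geometric_not_regularly_varying:
  assumes f: "\<And>j. f (Suc j) = (1/2 :: real) ^ j"
  shows "\<not> regularly_varying f"
proof
  assume "regularly_varying f"
  then obtain \<rho> where "\<forall>c>0. (\<lambda>n. f (nat \<lfloor>c * real n\<rfloor>) / f n) \<longlonglongrightarrow> c powr \<rho>"
    by (auto simp: regularly_varying_def)
  then have "(\<lambda>n. f (nat \<lfloor>2 * real n\<rfloor>) / f n) \<longlonglongrightarrow> 2 powr \<rho>" by simp
  then have "(\<lambda>n. f (nat \<lfloor>2 * real (Suc n)\<rfloor>) / f (Suc n)) \<longlonglongrightarrow> 2 powr \<rho>" by (rule LIMSEQ_Suc)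
  moreover have "f (nat \<lfloor>2 * real (Suc n)\<rfloor>) / f (Suc n) = (1/2) ^ Suc n" for n
  proof -
    have "2 * real (Suc n) = of_int (int (Suc (2 * n + 1)))" by simp
    then have "nat \<lfloor>2 * real (Suc n)\<rfloor> = Suc (2 * n + 1)" by (simp only: floor_of_int nat_int)
    moreover have "(1/2::real) ^ (2 * n + 1) = (1/2) ^ n * (1/2) ^ Suc n"
      by (simp only: power_add[symmetric]) (rule arg_cong[where f = "power _"], simp)
    ultimately show ?thesis by (simp only: f) simp
  qed
  ultimately have "(\<lambda>n. (1/2::real) ^ Suc n) \<longlonglongrightarrow> 2 powr \<rho>" by (simp only:)
  moreover have "(\<lambda>n. (1/2::real) ^ Suc n) \<longlonglongrightarrow> 0"
    by (rule LIMSEQ_Suc[OF LIMSEQ_realpow_zero]) auto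
  ultimately have "2 powr \<rho> = (0::real)" using LIMSEQ_unique by blast
  then show False by simp
qed

text \<open>At the exponents \<open>s m\<close> decreasing to \<open>\<alpha>\<close>, the \<open>m\<close>-th step contributes about \<open>G m\<close> to the power
  sum, where \<open>G m\<close> exceeds \<open>m |g (s m)|\<close>. The heights \<open>c m\<close> are so small that for every exponent
  \<open>s > \<alpha>\<close> the factor \<open>c m\<^bsup>s - s m\<^esup>\<close> eventually outweighs \<open>G m\<close>.\<close>

lemma mellin_sequence_exists:
  fixes g :: "real \<Rightarrow> real"
  assumes \<alpha>: "\<alpha> \<ge> 0"
  shows "\<exists>\<sigma>::nat \<Rightarrow> real. antimono \<sigma> \<and> \<sigma> \<longlonglongrightarrow> 0 \<and> (\<forall>j. 0 < \<sigma> j) \<and>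
    (\<forall>s. 0 < s \<longrightarrow> summable (\<lambda>j. \<sigma> j powr s) \<longleftrightarrow> \<alpha> < s) \<and>
    (\<lambda>s. \<Sum>j. \<sigma> j powr s) \<notin> O[at_right \<alpha>](g)"
proof -
  define s where "s m = \<alpha> + 1 / real (Suc m)" for m
  define G where "G m = real m * \<bar>g (s m)\<bar> + real (Suc m)" for m
  define y where "y m = (1/2) ^ m / G m" for m
  define c where "c m = (\<Prod>i\<le>m. y i ^ Suc i)" for m
  define N where "N m = nat \<lceil>G m * c m powr (- s m)\<rceil>" for m
  have G: "G m \<ge> real (Suc m)" for m by (simp add: G_def)
  then have G1: "G m \<ge> 1" for m by (rule order_trans[rotated]) simp
  then have G0: "0 \<le> G m" for m by (rule order_trans[rotated]) simp
  have y: "0 < y m" "y m \<le> (1/2) ^ m" "y m \<le> 1" for m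
  proof -
    show "0 < y m" using G1[of m] by (simp add: y_def)
    show le: "y m \<le> (1/2) ^ m" using G1[of m] by (simp add: y_def divide_le_eq)
    show "y m \<le> 1" by (rule order_trans[OF le]) (simp add: power_le_one)
  qed
  have c0: "0 < c m" for m unfolding c_def using y(1) by (intro prod_pos) auto
  \<comment> \<open>The product over \<open>i \<le> m\<close> makes \<open>c\<close> nonincreasing and keeps it below its last factor.\<close>
  have c_Suc: "c (Suc m) = c m * y (Suc m) ^ Suc (Suc m)" for m by (simp add: c_def)
  have c_anti: "antimono c"
  proof (rule decseq_SucI)
    fix m
    have "y (Suc m) ^ Suc (Suc m) \<le> 1" using y by (intro power_le_one) (auto simp: less_imp_le)
    then show "c (Suc m) \<le> c m" unfolding c_Suc using c0[of m] by (simp add: mult_left_le)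
  qed
  have c1: "c m \<le> 1" for m
    unfolding c_def by (rule prod_le_1) (use y in \<open>auto simp: less_imp_le simp del: power_Suc intro!: power_le_one\<close>)
  have c_le: "c m \<le> y m ^ Suc m" for m
  proof (cases m)
    case (Suc n)
    then show ?thesis using c1[of n] y(1)[of m] by (simp add: c_Suc mult_left_le_one_le c0 less_imp_le del: power_Suc)
  qed (simp add: c_def)
  have c_lim: "c \<longlonglongrightarrow> 0"
  proof (rule Lim_null_comparison)
    show "\<forall>\<^sub>F m in sequentially. norm (c m) \<le> (1/2) ^ m"
    proof (intro always_eventually allI)
      fix m
      have "y m ^ Suc m \<le> y m ^ 1" using y[of m] by (intro power_decreasing) auto
      then show "norm (c m) \<le> (1/2) ^ m" using c_le[of m] y(2)[of m] c0[of m] by simp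
    qed
  qed (rule LIMSEQ_realpow_zero, auto)
  note c = c_anti c_lim c0
  have s: "s m > \<alpha>" "s m > 0" for m using \<alpha> by (simp_all add: s_def add_nonneg_pos)
  have cs1: "c m powr (- s m) \<ge> 1" for m
  proof -
    have "c m powr s m \<le> 1" using c0[of m] c1[of m] s(2)[of m] by (intro powr_le1) auto
    then show ?thesis using c0[of m] by (simp add: powr_minus one_le_inverse)
  qed
  have N_ge: "real (N m) \<ge> G m * c m powr (- s m)" for m unfolding N_def by linarith
  have N_le: "real (N m) \<le> 2 * G m * c m powr (- s m)" for m
  proof -
    have "1 * 1 \<le> G m * c m powr (- s m)" using G0 G1 cs1 by (intro mult_mono) auto
    then show ?thesis unfolding N_def by linarith
  qed
  have N: "m < N m" for m
  proof -
    have "real (Suc m) * 1 \<le> G m * c m powr (- s m)" using G cs1 G1[of m] by (intro mult_mono) auto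
    from order_trans[OF this N_ge[of m]] have "real (Suc m) \<le> real (N m)" by simp
    then show ?thesis by simp
  qed
  have split: "c m powr (- s m) * c m powr t = c m powr (t - s m)" for m t
    by (simp flip: powr_add)
  have sum: "summable (\<lambda>j. step_seq c N j powr t)" if t: "t > \<alpha>" for t
  proof (rule step_seq_powr_summable[OF c N])
    define \<delta> where "\<delta> = (t - \<alpha>) / 2"
    have \<delta>: "\<delta> > 0" using t by (simp add: \<delta>_def)
    obtain M where M: "real M \<ge> 1 / \<delta>" using real_arch_simple by blast
    \<comment> \<open>The exponent \<open>Suc m\<close> in \<open>c m \<le> y m ^ Suc m\<close> absorbs \<open>\<delta>\<close> as soon as \<open>Suc m * \<delta> \<ge> 1\<close>.\<close>
    have bound: "norm (real (N m) * c m powr t) \<le> 2 * (1/2) ^ m" if m: "m \<ge> M" for m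
    proof -
      have ge: "real (Suc m) * \<delta> \<ge> 1"
      proof -
        have "1 / \<delta> \<le> real (Suc m)" using M m by simp
        then show ?thesis using \<delta> by (simp add: pos_divide_le_eq)
      qed
      then have "1 / real (Suc m) \<le> \<delta>" by (simp add: pos_divide_le_eq mult.commute)
      then have exp_le: "t - s m \<ge> \<delta>" unfolding s_def \<delta>_def by (simp add: field_simps)
      have "c m powr (t - s m) \<le> c m powr \<delta>"
        using exp_le c0[of m] c1[of m] by (intro powr_mono') auto
      also have "\<dots> \<le> (y m ^ Suc m) powr \<delta>" using c_le[of m] c0[of m] \<delta> by (intro powr_mono2) auto
      also have "\<dots> = y m powr (real (Suc m) * \<delta>)" using y(1)[of m] by (simp add: powr_powr flip: powr_realpow del: power_Suc)
      also have "\<dots> \<le> y m powr 1" using ge y[of m] by (intro powr_mono') auto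
      also have "\<dots> = y m" using y(1)[of m] by simp
      finally have *: "c m powr (t - s m) \<le> y m" .
      have "real (N m) * c m powr t \<le> 2 * G m * c m powr (- s m) * c m powr t"
        by (intro mult_right_mono N_le) auto
      also have "\<dots> = 2 * G m * c m powr (t - s m)" by (simp only: mult.assoc split)
      also have "\<dots> \<le> 2 * G m * y m" using * G1[of m] by (intro mult_left_mono) auto
      also have "\<dots> = 2 * (1/2) ^ m" using G1[of m] by (simp add: y_def)
      finally show ?thesis by simp
    qed
    have "summable (\<lambda>m. 2 * (1/2::real) ^ m)" by (intro summable_mult summable_geometric) simp
    then show "summable (\<lambda>m. real (N m) * c m powr t)"
      by (rule summable_comparison_test'[where N = M]) (rule bound)
  qed
  have nsum: "\<not> summable (\<lambda>j. step_seq c N j powr t)" if t: "0 < t" "t \<le> \<alpha>" for t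
  proof
    assume sum': "summable (\<lambda>j. step_seq c N j powr t)"
    obtain m where m: "real m \<ge> (\<Sum>j. step_seq c N j powr t)" using real_arch_simple by blast
    have "1 \<le> c m powr (t - s m)"
    proof -
      have "c m powr 0 \<le> c m powr (t - s m)"
        using t s(1)[of m] c0[of m] c1[of m] by (intro powr_mono') auto
      then show ?thesis using c0[of m] by simp
    qed
    then have "real (Suc m) * 1 \<le> G m * c m powr (t - s m)" using G G1[of m] by (intro mult_mono) auto
    also have "\<dots> = G m * c m powr (- s m) * c m powr t" by (simp only: mult.assoc split)
    also have "\<dots> \<le> real (N m) * c m powr t" by (intro mult_right_mono N_ge) auto
    also have "\<dots> \<le> (\<Sum>j. step_seq c N j powr t)" by (rule step_seq_powr_suminf_ge[OF c N sum' t(1)])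
    finally show False using m by simp
  qed
  have "(\<lambda>t. \<Sum>j. step_seq c N j powr t) \<notin> O[at_right \<alpha>](g)"
  proof (rule not_bigo_along_sequence)
    have "s \<longlonglongrightarrow> \<alpha> + 0"
      unfolding s_def by (intro tendsto_intros LIMSEQ_Suc[OF lim_1_over_n])
    then show "filterlim s (at_right \<alpha>) sequentially"
      using s(1) by (auto simp: filterlim_at intro!: always_eventually)
    fix m
    have "G m = G m * (c m powr (- s m) * c m powr s m)" using c0[of m] by (simp add: split)
    also have "\<dots> \<le> real (N m) * c m powr s m"
      unfolding mult.assoc[symmetric] by (intro mult_right_mono N_ge) auto
    also have "\<dots> \<le> (\<Sum>j. step_seq c N j powr s m)"
      by (rule step_seq_powr_suminf_ge[OF c N sum[OF s(1)] s(2)])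
    finally have ge: "G m \<le> (\<Sum>j. step_seq c N j powr s m)" .
    show "real m * \<bar>g (s m)\<bar> \<le> \<bar>\<Sum>j. step_seq c N j powr s m\<bar>" using ge by (simp add: G_def)
    show "(\<Sum>j. step_seq c N j powr s m) \<noteq> 0" using ge G1[of m] by linarith
  qed
  moreover have "summable (\<lambda>j. step_seq c N j powr t) \<longleftrightarrow> \<alpha> < t" if "0 < t" for t
    using sum nsum that by (auto simp: not_less[symmetric])
  ultimately show ?thesis using step_seq(1-3)[OF c N] by (intro exI[of _ "step_seq c N"]) simp
qed

text \<open>About \<open>2\<^bsup>-m\<^esup> a m\<close> singular values of size \<open>1 / a m\<close> are summable, and at \<open>e * a m\<close> each of them
  contributes at least \<open>1\<close> to the logarithm of the determinant. Since \<open>g\<close> is \<open>o(a)\<close>, the scale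
  \<open>a m\<close> can be chosen so large that \<open>m |g|\<close> stays below \<open>2\<^bsup>-m\<^esup> a m\<close> there.\<close>

lemma fredholm_sequence_exists:
  fixes g :: "real \<Rightarrow> real"
  assumes g: "g \<in> o[at_top](\<lambda>a. a)"
  shows "\<exists>\<sigma>::nat \<Rightarrow> real. antimono \<sigma> \<and> \<sigma> \<longlonglongrightarrow> 0 \<and> (\<forall>j. 0 < \<sigma> j) \<and>
    summable (\<lambda>j. \<sigma> j powr 1) \<and>
    (\<forall>D. (\<forall>a n. (\<Prod>j<n. (a * \<sigma> j)\<^sup>2) \<le> D a) \<longrightarrow> (\<lambda>a. 1 / 2 * ln (D a)) \<notin> O[at_top](g))"
proof -
  define \<epsilon> where "\<epsilon> m = 1 / (exp 1 * real (Suc m) * 2 ^ m)" for m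
  have \<epsilon>: "\<epsilon> m > 0" for m by (simp add: \<epsilon>_def)
  have "\<exists>A. \<forall>a\<ge>A. \<bar>g a\<bar> \<le> \<epsilon> m * \<bar>a\<bar>" for m
    using landau_o.smallD[OF g \<epsilon>[of m]] by (simp add: eventually_at_top_linorder)
  then obtain A where A: "\<And>m a. a \<ge> A m \<Longrightarrow> \<bar>g a\<bar> \<le> \<epsilon> m * \<bar>a\<bar>" by metis
  define a where "a m = (\<Sum>i\<le>m. \<bar>A i\<bar> + 2 ^ i * real (Suc i))" for m
  have a_ge: "a m \<ge> \<bar>A m\<bar> + 2 ^ m * real (Suc m)" for m
    unfolding a_def by (rule member_le_sum) auto
  have a_ge': "a m \<ge> 2 ^ m * real (Suc m)" "a m \<ge> A m" "a m \<ge> 2 ^ m" for m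
  proof -
    have "0 \<le> 2 ^ m * real (Suc m)" by simp
    then show *: "a m \<ge> 2 ^ m * real (Suc m)" "a m \<ge> A m" using a_ge[of m] by linarith+
    show "a m \<ge> 2 ^ m" by (rule order_trans[OF _ *(1)]) simp
  qed
  have a0: "a m > 0" for m by (rule less_le_trans[OF _ a_ge'(3)]) simp
  define c where "c m = 1 / a m" for m
  define N where "N m = nat \<lceil>a m / 2 ^ m\<rceil>" for m
  have c_anti: "antimono c"
  proof (rule antimonoI)
    fix i j :: nat assume "i \<le> j"
    then have "a i \<le> a j" unfolding a_def by (intro sum_mono2) auto
    then show "c j \<le> c i" using a0[of i] by (simp add: c_def frac_le)
  qed
  have c_le: "c m \<le> (1/2) ^ m" for m
    using a_ge'(3)[of m] by (simp add: c_def power_one_over frac_le)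
  have c0: "0 < c m" for m using a0[of m] by (simp add: c_def)
  have c_lim: "c \<longlonglongrightarrow> 0"
  proof (rule Lim_null_comparison)
    show "\<forall>\<^sub>F m in sequentially. norm (c m) \<le> (1/2) ^ m"
      using c_le c0 by (intro always_eventually allI) (simp add: less_imp_le)
  qed (rule LIMSEQ_realpow_zero, auto)
  note c = c_anti c_lim c0
  have N_ge: "real (N m) \<ge> a m / 2 ^ m" for m unfolding N_def by linarith
  have N_le: "real (N m) \<le> a m / 2 ^ m + 1" for m
    using a0[of m] unfolding N_def by (simp add: of_nat_ceiling)
  have N: "m < N m" for m
  proof -
    have "real (Suc m) \<le> a m / 2 ^ m" using a_ge'(1)[of m] by (simp add: pos_le_divide_eq mult.commute)
    then show ?thesis using N_ge[of m] by linarith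
  qed
  have sum: "summable (\<lambda>j. step_seq c N j powr 1)"
  proof (rule step_seq_powr_summable[OF c N])
    have "norm (real (N m) * c m powr 1) \<le> 2 * (1/2) ^ m" for m
    proof -
      have "real (N m) * c m \<le> (a m / 2 ^ m + 1) * c m" by (intro mult_right_mono N_le) (simp add: c0 less_imp_le)
      also have "\<dots> = (1/2) ^ m + c m" using a0[of m] by (simp add: c_def field_simps power_one_over)
      also have "\<dots> \<le> 2 * (1/2) ^ m" using c_le[of m] by simp
      finally show ?thesis using c0[of m] by simp
    qed
    then show "summable (\<lambda>m. real (N m) * c m powr 1)"
      by (rule summable_comparison_test'[where N = 0 and g = "\<lambda>m. 2 * (1/2) ^ m", rotated])
        (intro summable_mult summable_geometric, simp)
  qed
  have "(\<lambda>a. 1 / 2 * ln (D a)) \<notin> O[at_top](g)" if D: "\<And>a n. (\<Prod>j<n. (a * step_seq c N j)\<^sup>2) \<le> D a" for D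
  proof (rule not_bigo_along_sequence)
    have "filterlim a at_top sequentially"
    proof (rule filterlim_at_top_mono[OF filterlim_real_sequentially])
      show "\<forall>\<^sub>F m in sequentially. real m \<le> a m"
      proof (intro always_eventually allI)
        fix m
        have "real m \<le> 1 * real (Suc m)" by simp
        also have "\<dots> \<le> 2 ^ m * real (Suc m)" by (rule mult_right_mono) auto
        finally show "real m \<le> a m" using a_ge'(1)[of m] by linarith
      qed
    qed
    then show "filterlim (\<lambda>m. exp 1 * a m) at_top sequentially"
      by (intro filterlim_tendsto_pos_mult_at_top[OF tendsto_const]) auto
    fix m
    have "exp (2 * real (N m)) = (\<Prod>j<N m. (exp 1)\<^sup>2)"
      by (simp add: exp_of_nat_mult[symmetric] power_mult[symmetric] mult.commute)
    also have "\<dots> \<le> (\<Prod>j<N m. (exp 1 * a m * step_seq c N j)\<^sup>2)"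
    proof (intro prod_mono conjI power_mono)
      fix j assume "j \<in> {..<N m}"
      then have "a m * c m \<le> a m * step_seq c N j"
        using a0[of m] by (intro mult_left_mono step_seq(4)[OF c N]) auto
      then show "exp 1 \<le> exp 1 * a m * step_seq c N j" using a0[of m] by (simp add: c_def mult.assoc)
    qed auto
    also have "\<dots> \<le> D (exp 1 * a m)" by (rule D)
    finally have "2 * real (N m) \<le> ln (D (exp 1 * a m))"
      by (subst ln_ge_iff) (auto intro: less_le_trans[OF exp_gt_zero])
    then have ge: "real (N m) \<le> 1 / 2 * ln (D (exp 1 * a m))" by simp
    have "a m \<le> exp 1 * a m" using a0[of m] by simp
    then have "A m \<le> exp 1 * a m" using a_ge'(2)[of m] by linarith
    from A[OF this] have "\<bar>g (exp 1 * a m)\<bar> \<le> \<epsilon> m * (exp 1 * a m)"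
      using a0[of m] by (simp add: abs_mult)
    then have "real m * \<bar>g (exp 1 * a m)\<bar> \<le> real (Suc m) * (\<epsilon> m * (exp 1 * a m))"
      by (intro mult_mono) auto
    also have "\<dots> = a m / 2 ^ m" by (simp add: \<epsilon>_def del: of_nat_Suc)
    also note N_ge[of m]
    also note ge
    finally show "real m * \<bar>g (exp 1 * a m)\<bar> \<le> \<bar>1 / 2 * ln (D (exp 1 * a m))\<bar>" by simp
    show "1 / 2 * ln (D (exp 1 * a m)) \<noteq> 0" using ge N[of m] by linarith
  qed
  then show ?thesis using step_seq(1-3)[OF c N] sum by (intro exI[of _ "step_seq c N"] conjI allI impI) simp_all
qed


section \<open>The block model and its consequences\<close>

lemma compact_operator_block_model:
  fixes K :: "'h::chilbert_space \<Rightarrow>\<^sub>C\<^sub>L 'h" and idx :: "nat \<Rightarrow> 'n::finite"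
  assumes K: "compact_op K" "K \<noteq> 0" and r: "r \<ge> 1" and idx: "bij_betw idx {0..r} (UNIV :: 'n set)"
  shows "\<exists>X W :: nat \<Rightarrow> ('h, 'n) block_op.
      depth_model idx r X W \<and>
      only_nonzero_block (W r) (idx r) (idx 0) \<and>
      unitarily_equiv (block (W r) (idx r) (idx 0)) K \<and>
      depth_word r \<in> lie_part {1..r} r \<and> depth_word r \<noteq> 0 \<and>
      (\<exists>\<phi>. lie_hom \<phi> \<and> (\<forall>j\<in>{1..r}. \<phi> (lie_gen j) = X j) \<and> \<phi> (depth_word r) = W r) \<and>
      (\<forall>j\<ge>1. singular_value (W r) j = singular_value K j) \<and>
      W r o\<^sub>C\<^sub>L W r = 0 \<and>
      (trace_class K \<longrightarrow>
        (\<forall>z. fredholm_det (z *\<^sub>C W r) = 1) \<and>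
        (\<forall>z. fredholm_det (z\<^sup>2 *\<^sub>C (adj (W r) o\<^sub>C\<^sub>L W r)) =
             fredholm_det (z\<^sup>2 *\<^sub>C (adj K o\<^sub>C\<^sub>L K))) \<and>
        (\<forall>z. 1 / 2 * ln (fredholm_det (z\<^sup>2 *\<^sub>C (adj (W r) o\<^sub>C\<^sub>L W r))) =
             1 / 2 * ln (fredholm_det (z\<^sup>2 *\<^sub>C (adj K o\<^sub>C\<^sub>L K)))))"
proof -
  obtain X and W :: "nat \<Rightarrow> ('h, 'n) block_op"
    where XW: "depth_model idx r X W" and W: "W r = single_block (idx r) (idx 0) K"
    using depth_model_exists[OF K r bij_betw_imp_inj_on[OF idx]] by blast
  have ne: "idx r \<noteq> idx 0" using inj_on_eq_iff[OF bij_betw_imp_inj_on[OF idx], of r 0] r by simp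
  have eval: "free_lie_eval X (depth_word r) = W r"
    by (rule free_lie_eval_depth_word[OF XW r order_refl])
  have "W r \<noteq> 0"
  proof
    assume "W r = 0"
    then have "block (W r) (idx r) (idx 0) = 0" by (intro cblinfun_eqI) (simp add: block_apply)
    then show False using K(2) by (simp add: W block_single_block)
  qed
  have nuclear: "\<exists>B. nuclear_expansion B (\<lambda>b. b) (\<lambda>b. K *\<^sub>V b) K" if "trace_class K"
    using trace_class_nuclear_expansion[OF that] by blast
  have gram: "fredholm_det (z *\<^sub>C (adj (W r) o\<^sub>C\<^sub>L W r)) = fredholm_det (z *\<^sub>C (adj K o\<^sub>C\<^sub>L K))"
    if tc: "trace_class K" for z
  proof -
    obtain B where "nuclear_expansion B (\<lambda>b. b) (\<lambda>b. K *\<^sub>V b) K" using nuclear[OF tc] by blast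
    note nuc = nuclear_expansion_compose_left[OF this, of "adj K"]
    have "adj (W r) o\<^sub>C\<^sub>L W r = single_block (idx 0) (idx 0) (adj K o\<^sub>C\<^sub>L K)"
      by (simp add: W adj_single_block single_block_compose)
    then show ?thesis by (simp only: fredholm_det_diagonal_block[OF nuc idx])
  qed
  show ?thesis
  proof (rule exI[of _ X], rule exI[of _ W], intro conjI allI impI)
    show "depth_model idx r X W" by (rule XW)
    show "only_nonzero_block (W r) (idx r) (idx 0)" unfolding W by (rule only_nonzero_single_block[OF K(2)])
    show "unitarily_equiv (block (W r) (idx r) (idx 0)) K"
      by (simp add: W block_single_block unitarily_equiv_refl)
    show "depth_word r \<in> lie_part {1..r} r"
      using depth_word_homogeneous[OF r order_refl] by (simp add: lie_part_def)
    show "depth_word r \<noteq> 0" using eval \<open>W r \<noteq> 0\<close> by (auto simp: free_lie_eval_zero)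
    show "\<exists>\<phi>. lie_hom \<phi> \<and> (\<forall>j\<in>{1..r}. \<phi> (lie_gen j) = X j) \<and> \<phi> (depth_word r) = W r"
      by (intro exI[of _ "free_lie_eval X"]) (simp add: lie_hom_free_lie_eval free_lie_eval_gen eval)
    show "singular_value (W r) j = singular_value K j" for j
      by (simp add: W singular_value_single_block)
    show "W r o\<^sub>C\<^sub>L W r = 0" using ne by (simp add: W single_block_compose)
    show "fredholm_det (z *\<^sub>C W r) = 1" if tc: "trace_class K" for z
      using nuclear[OF tc] fredholm_det_off_diagonal_block[OF _ idx r] by (auto simp: W)
  qed (simp_all only: gram)
qed

lemma fredholm_det_triangular_perturbation:
  fixes D R :: "('h::chilbert_space, 'n::finite) block_op" and r :: nat
  assumes idx: "bij_betw idx {0..r} (UNIV :: 'n set)"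
    and tc: "trace_class D" "trace_class R" and D: "\<And>i k. i \<noteq> k \<Longrightarrow> block D i k = 0"
    and R: "(\<forall>i\<le>r. \<forall>k\<le>r. i \<le> k \<longrightarrow> block R (idx i) (idx k) = 0) \<or>
      (\<forall>i\<le>r. \<forall>k\<le>r. k \<le> i \<longrightarrow> block R (idx i) (idx k) = 0)"
  shows "fredholm_det (z *\<^sub>C (D + R)) = (\<Prod>j=0..r. fredholm_det (z *\<^sub>C block D (idx j) (idx j)))"
proof -
  obtain B where B: "nuclear_expansion B (\<lambda>b. b) (\<lambda>b. D *\<^sub>V b) D"
    using trace_class_nuclear_expansion[OF tc(1)] by blast
  obtain C where C: "nuclear_expansion C (\<lambda>b. b) (\<lambda>b. R *\<^sub>V b) R"
    using trace_class_nuclear_expansion[OF tc(2)] by blast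
  note nuc = nuclear_expansion_scaleC[OF nuclear_expansion_add[OF B C], of z]
  have zero: "z *\<^sub>C (0 :: 'h \<Rightarrow>\<^sub>C\<^sub>L 'h) = 0" by (rule complex_vector.scale_zero_right)
  have off: "block D (idx i) (idx k) = 0" if "i \<le> r" "k \<le> r" "i \<noteq> k" for i k
    using inj_on_eq_iff[OF bij_betw_imp_inj_on[OF idx], of i k] that by (intro D) simp
  have R_diag: "block R (idx i) (idx i) = 0" if "i \<le> r" for i using R that by auto
  have "fredholm_det (z *\<^sub>C (D + R)) = (\<Prod>j=0..r. fredholm_det (block (z *\<^sub>C (D + R)) (idx j) (idx j)))"
  proof (rule fredholm_det_block_triangular[OF nuc idx])
    show "(\<forall>i\<le>r. \<forall>k\<le>r. i < k \<longrightarrow> block (z *\<^sub>C (D + R)) (idx i) (idx k) = 0) \<or>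
        (\<forall>i\<le>r. \<forall>k\<le>r. k < i \<longrightarrow> block (z *\<^sub>C (D + R)) (idx i) (idx k) = 0)"
      using R by (auto simp: block_scaleC block_add off zero)
  qed
  also have "\<dots> = (\<Prod>j=0..r. fredholm_det (z *\<^sub>C block D (idx j) (idx j)))"
    by (rule prod.cong) (auto simp: block_scaleC block_add R_diag)
  finally show ?thesis .
qed

theorem theorem5p14:
  fixes r :: nat and idx :: "nat \<Rightarrow> 'n::finite"
  assumes r: "r \<ge> 1"
    and idx: "bij_betw idx {0..r} (UNIV :: 'n set)"
    and separable: "\<exists>S::'h::chilbert_space set. countable S \<and> closure S = UNIV"
  shows
    "(\<forall>K :: 'h \<Rightarrow>\<^sub>C\<^sub>L 'h. compact_op K \<and> K \<noteq> 0 \<longrightarrow>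
       (\<exists>X W :: nat \<Rightarrow> ('h, 'n) block_op.
          depth_model idx r X W \<and>
          only_nonzero_block (W r) (idx r) (idx 0) \<and>
          unitarily_equiv (block (W r) (idx r) (idx 0)) K \<and>
          depth_word r \<in> lie_part {1..r} r \<and> depth_word r \<noteq> 0 \<and>
          (\<exists>\<phi>. lie_hom \<phi> \<and> (\<forall>j\<in>{1..r}. \<phi> (lie_gen j) = X j) \<and> \<phi> (depth_word r) = W r) \<and>
          (\<forall>j\<ge>1. singular_value (W r) j = singular_value K j) \<and>
          W r o\<^sub>C\<^sub>L W r = 0 \<and>
          (trace_class K \<longrightarrow>
            (\<forall>z. fredholm_det (z *\<^sub>C W r) = 1) \<and>
            (\<forall>z. fredholm_det (z\<^sup>2 *\<^sub>C (adj (W r) o\<^sub>C\<^sub>L W r)) =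
                 fredholm_det (z\<^sup>2 *\<^sub>C (adj K o\<^sub>C\<^sub>L K))) \<and>
            (\<forall>z. 1 / 2 * ln (fredholm_det (z\<^sup>2 *\<^sub>C (adj (W r) o\<^sub>C\<^sub>L W r))) =
                 1 / 2 * ln (fredholm_det (z\<^sup>2 *\<^sub>C (adj K o\<^sub>C\<^sub>L K)))))))
     \<and> ((\<nexists>B::'h set. finite B \<and> complex_vector.span B = UNIV) \<longrightarrow>
         \<comment> \<open>every possible singular value sequence occurs\<close>
         (\<forall>\<sigma>::nat \<Rightarrow> real. antimono \<sigma> \<and> \<sigma> \<longlonglongrightarrow> 0 \<and> 0 < \<sigma> 0 \<longrightarrow>
            (\<exists>X W :: nat \<Rightarrow> ('h, 'n) block_op. depth_model idx r X W \<and> W r \<noteq> 0 \<and>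
               (\<forall>j. singular_value (W r) (Suc j) = \<sigma> j))) \<and>
         \<comment> \<open>no Schatten membership\<close>
         (\<exists>X W :: nat \<Rightarrow> ('h, 'n) block_op. depth_model idx r X W \<and> W r \<noteq> 0 \<and>
            (\<forall>p>0. \<not> schatten p (W r))) \<and>
         \<comment> \<open>no decay law, neither from above nor from below\<close>
         (\<forall>g::nat \<Rightarrow> real. g \<longlonglongrightarrow> 0 \<longrightarrow>
            (\<exists>X W :: nat \<Rightarrow> ('h, 'n) block_op. depth_model idx r X W \<and> W r \<noteq> 0 \<and>
               singular_value (W r) \<notin> O(g))) \<and>
         (\<forall>g::nat \<Rightarrow> real. (\<forall>j. 0 < g j) \<longrightarrow>
            (\<exists>X W :: nat \<Rightarrow> ('h, 'n) block_op. depth_model idx r X W \<and> W r \<noteq> 0 \<and>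
               (\<forall>j\<ge>1. 0 < singular_value (W r) j) \<and> singular_value (W r) \<in> o(g))) \<and>
         \<comment> \<open>no regular variation\<close>
         (\<exists>X W :: nat \<Rightarrow> ('h, 'n) block_op. depth_model idx r X W \<and> W r \<noteq> 0 \<and>
            (\<forall>j\<ge>1. 0 < singular_value (W r) j) \<and> \<not> regularly_varying (singular_value (W r))) \<and>
         \<comment> \<open>no Mellin order, whatever the abscissa\<close>
         (\<forall>\<alpha>\<ge>0. \<forall>g::real \<Rightarrow> real.
            (\<exists>X W :: nat \<Rightarrow> ('h, 'n) block_op. depth_model idx r X W \<and> W r \<noteq> 0 \<and>
               mellin_abscissa (W r) = ereal \<alpha> \<and> mellin_trace (W r) \<notin> O[at_right \<alpha>](g))) \<and>
         \<comment> \<open>no Fredholm growth beyond the bound \<open>o(a)\<close> valid for all trace-class operators\<close>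
         (\<forall>g::real \<Rightarrow> real. g \<in> o[at_top](\<lambda>a. a) \<longrightarrow>
            (\<exists>X W :: nat \<Rightarrow> ('h, 'n) block_op. depth_model idx r X W \<and> W r \<noteq> 0 \<and>
               trace_class (W r) \<and> fredholm_growth (W r) \<notin> O[at_top](g))))
     \<and> (\<forall>D R :: ('h, 'n) block_op.
          trace_class D \<and> trace_class R \<and>
          (\<forall>i k. i \<noteq> k \<longrightarrow> block D i k = 0) \<and>
          ((\<forall>i\<le>r. \<forall>k\<le>r. i \<le> k \<longrightarrow> block R (idx i) (idx k) = 0) \<or>
           (\<forall>i\<le>r. \<forall>k\<le>r. k \<le> i \<longrightarrow> block R (idx i) (idx k) = 0)) \<longrightarrow>
          (\<forall>z. fredholm_det (z *\<^sub>C (D + R)) =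
               (\<Prod>j=0..r. fredholm_det (z *\<^sub>C block D (idx j) (idx j)))))"
proof -
  let "?model \<and> ?prescribed \<and> ?triangular" = ?thesis
  have ?model
    by (intro allI impI, elim conjE) (rule compact_operator_block_model[OF _ _ r idx]; assumption)
  moreover let "?infinite \<longrightarrow> ?sequences" = ?prescribed
  have ?prescribed
  proof (rule impI)
    assume inf: "\<nexists>B::'h set. finite B \<and> complex_vector.span B = UNIV"
    have model: "\<exists>X W :: nat \<Rightarrow> ('h, 'n) block_op. depth_model idx r X W \<and> W r \<noteq> 0 \<and>
        (\<forall>j. singular_value (W r) (Suc j) = \<sigma> j) \<and>
        (\<forall>p. schatten p (W r) \<longleftrightarrow> summable (\<lambda>j. \<sigma> j powr p)) \<and>
        (trace_class (W r) \<longrightarrow> (\<forall>a n. (\<Prod>j<n. (a * \<sigma> j)\<^sup>2)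
          \<le> Re (fredholm_det (complex_of_real (a\<^sup>2) *\<^sub>C (adj (W r) o\<^sub>C\<^sub>L W r)))))"
      if "antimono \<sigma>" "\<sigma> \<longlonglongrightarrow> 0" "0 < \<sigma> 0" for \<sigma> :: "nat \<Rightarrow> real"
      by (rule prescribed_singular_values[OF r idx inf that], intro exI conjI allI impI) assumption+
    have pos: "\<forall>j\<ge>1. 0 < s j" if "\<forall>j. s (Suc j) = \<sigma> j" "\<forall>j. 0 < \<sigma> j" for s \<sigma> :: "nat \<Rightarrow> real"
    proof (intro allI impI)
      fix j :: nat assume "1 \<le> j"
      then obtain i where "j = Suc i" by (cases j) auto
      then show "0 < s j" using that by simp
    qed
    show ?sequences
    proof (intro conjI allI impI)
      fix \<sigma> :: "nat \<Rightarrow> real" assume "antimono \<sigma> \<and> \<sigma> \<longlonglongrightarrow> 0 \<and> 0 < \<sigma> 0"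
      then have "antimono \<sigma>" "\<sigma> \<longlonglongrightarrow> 0" "0 < \<sigma> 0" by simp_all
      from model[OF this]
      show "\<exists>X W :: nat \<Rightarrow> ('h, 'n) block_op. depth_model idx r X W \<and> W r \<noteq> 0 \<and>
          (\<forall>j. singular_value (W r) (Suc j) = \<sigma> j)"
        by (elim exE conjE) (intro exI conjI)
    next
      from slowly_decaying_sequence_exists obtain \<sigma> :: "nat \<Rightarrow> real"
        where \<sigma>: "antimono \<sigma>" "\<sigma> \<longlonglongrightarrow> 0" "\<forall>j. 0 < \<sigma> j" "\<forall>p>0. \<not> summable (\<lambda>j. \<sigma> j powr p)"
        by (elim exE conjE) (rule that)
      from model[OF \<sigma>(1,2) \<sigma>(3)[rule_format]] obtain X and W :: "nat \<Rightarrow> ('h, 'n) block_op"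
        where XW: "depth_model idx r X W" "W r \<noteq> 0" "\<forall>p. schatten p (W r) \<longleftrightarrow> summable (\<lambda>j. \<sigma> j powr p)"
        by (elim exE conjE) (rule that)
      have "\<forall>p>0. \<not> schatten p (W r)" using XW(3) \<sigma>(4) by simp
      with XW(1,2) show "\<exists>X W :: nat \<Rightarrow> ('h, 'n) block_op. depth_model idx r X W \<and> W r \<noteq> 0 \<and>
          (\<forall>p>0. \<not> schatten p (W r))" by (intro exI conjI)
    next
      fix g :: "nat \<Rightarrow> real" assume "g \<longlonglongrightarrow> 0"
      from dominating_sequence_exists[OF this] obtain \<sigma> :: "nat \<Rightarrow> real"
        where \<sigma>: "antimono \<sigma>" "\<sigma> \<longlonglongrightarrow> 0" "\<forall>j. 0 < \<sigma> j"
          "\<forall>f. (\<forall>j. f (Suc j) = \<sigma> j) \<longrightarrow> f \<notin> O(g)"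
        by (elim exE conjE) (rule that)
      from model[OF \<sigma>(1,2) \<sigma>(3)[rule_format]] obtain X and W :: "nat \<Rightarrow> ('h, 'n) block_op"
        where XW: "depth_model idx r X W" "W r \<noteq> 0" "\<forall>j. singular_value (W r) (Suc j) = \<sigma> j"
        by (elim exE conjE) (rule that)
      from XW(1,2) \<sigma>(4)[rule_format, OF XW(3)[rule_format]]
      show "\<exists>X W :: nat \<Rightarrow> ('h, 'n) block_op. depth_model idx r X W \<and> W r \<noteq> 0 \<and>
          singular_value (W r) \<notin> O(g)" by (intro exI conjI)
    next
      fix g :: "nat \<Rightarrow> real" assume "\<forall>j. 0 < g j"
      then have "0 < g j" for j by simp
      from dominated_sequence_exists[of g, OF this] obtain \<sigma> :: "nat \<Rightarrow> real"
        where \<sigma>: "antimono \<sigma>" "\<sigma> \<longlonglongrightarrow> 0" "\<forall>j. 0 < \<sigma> j"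
          "\<forall>f. (\<forall>j. f (Suc j) = \<sigma> j) \<longrightarrow> f \<in> o(g)"
        by (elim exE conjE) (rule that)
      from model[OF \<sigma>(1,2) \<sigma>(3)[rule_format]] obtain X and W :: "nat \<Rightarrow> ('h, 'n) block_op"
        where XW: "depth_model idx r X W" "W r \<noteq> 0" "\<forall>j. singular_value (W r) (Suc j) = \<sigma> j"
        by (elim exE conjE) (rule that)
      from XW(1,2) pos[OF XW(3) \<sigma>(3)] \<sigma>(4)[rule_format, OF XW(3)[rule_format]]
      show "\<exists>X W :: nat \<Rightarrow> ('h, 'n) block_op. depth_model idx r X W \<and> W r \<noteq> 0 \<and>
          (\<forall>j\<ge>1. 0 < singular_value (W r) j) \<and> singular_value (W r) \<in> o(g)" by (intro exI conjI)
    next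
      define \<sigma> :: "nat \<Rightarrow> real" where "\<sigma> j = (1/2) ^ j" for j
      have \<sigma>: "antimono \<sigma>" "\<sigma> \<longlonglongrightarrow> 0" "\<forall>j. 0 < \<sigma> j"
      proof -
        show "antimono \<sigma>" unfolding \<sigma>_def by (rule antimonoI) (simp add: power_decreasing)
        show "\<sigma> \<longlonglongrightarrow> 0" unfolding \<sigma>_def by (rule LIMSEQ_realpow_zero) simp_all
      qed (simp add: \<sigma>_def)
      from model[OF \<sigma>(1,2) \<sigma>(3)[rule_format]] obtain X and W :: "nat \<Rightarrow> ('h, 'n) block_op"
        where XW: "depth_model idx r X W" "W r \<noteq> 0" "\<forall>j. singular_value (W r) (Suc j) = \<sigma> j"
        by (elim exE conjE) (rule that)
      have "singular_value (W r) (Suc j) = (1/2) ^ j" for j using XW(3) by (simp add: \<sigma>_def)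
      from XW(1,2) pos[OF XW(3) \<sigma>(3)] geometric_not_regularly_varying[OF this]
      show "\<exists>X W :: nat \<Rightarrow> ('h, 'n) block_op. depth_model idx r X W \<and> W r \<noteq> 0 \<and>
          (\<forall>j\<ge>1. 0 < singular_value (W r) j) \<and> \<not> regularly_varying (singular_value (W r))"
        by (intro exI conjI)
    next
      fix \<alpha> :: real and g :: "real \<Rightarrow> real" assume \<alpha>: "0 \<le> \<alpha>"
      from mellin_sequence_exists[OF \<alpha>, of g] obtain \<sigma> :: "nat \<Rightarrow> real"
        where \<sigma>: "antimono \<sigma>" "\<sigma> \<longlonglongrightarrow> 0" "\<forall>j. 0 < \<sigma> j"
          "\<forall>s. 0 < s \<longrightarrow> summable (\<lambda>j. \<sigma> j powr s) \<longleftrightarrow> \<alpha> < s"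
          "(\<lambda>s. \<Sum>j. \<sigma> j powr s) \<notin> O[at_right \<alpha>](g)"
        by (elim exE conjE) (rule that)
      from model[OF \<sigma>(1,2) \<sigma>(3)[rule_format]] obtain X and W :: "nat \<Rightarrow> ('h, 'n) block_op"
        where XW: "depth_model idx r X W" "W r \<noteq> 0" "\<forall>j. singular_value (W r) (Suc j) = \<sigma> j"
          "\<forall>p. schatten p (W r) \<longleftrightarrow> summable (\<lambda>j. \<sigma> j powr p)"
        by (elim exE conjE) (rule that)
      have "{s. 0 < s \<and> schatten s (W r)} = {\<alpha><..}"
        using \<alpha> \<sigma>(4) XW(4) by auto
      then have "mellin_abscissa (W r) = (INF s\<in>{\<alpha><..}. ereal s)" by (simp add: mellin_abscissa_def)
      also have "\<dots> = ereal \<alpha>"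
      proof (rule antisym)
        show "ereal \<alpha> \<le> (INF s\<in>{\<alpha><..}. ereal s)" by (rule INF_greatest) auto
        show "(INF s\<in>{\<alpha><..}. ereal s) \<le> ereal \<alpha>"
        proof (rule ereal_le_epsilon2)
          fix e :: real assume "0 < e"
          then show "(INF s\<in>{\<alpha><..}. ereal s) \<le> ereal \<alpha> + ereal e"
            by (intro INF_lower2[of "\<alpha> + e"]) auto
        qed
      qed
      finally have abscissa: "mellin_abscissa (W r) = ereal \<alpha>" .
      have "mellin_trace (W r) = (\<lambda>s. \<Sum>j. \<sigma> j powr s)"
        using XW(3) by (simp add: mellin_trace_def fun_eq_iff)
      then have "mellin_trace (W r) \<notin> O[at_right \<alpha>](g)" using \<sigma>(5) by simp
      with XW(1,2) abscissa
      show "\<exists>X W :: nat \<Rightarrow> ('h, 'n) block_op. depth_model idx r X W \<and> W r \<noteq> 0 \<and>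
          mellin_abscissa (W r) = ereal \<alpha> \<and> mellin_trace (W r) \<notin> O[at_right \<alpha>](g)"
        by (intro exI conjI)
    next
      fix g :: "real \<Rightarrow> real" assume "g \<in> o[at_top](\<lambda>a. a)"
      from fredholm_sequence_exists[OF this] obtain \<sigma> :: "nat \<Rightarrow> real"
        where \<sigma>: "antimono \<sigma>" "\<sigma> \<longlonglongrightarrow> 0" "\<forall>j. 0 < \<sigma> j" "summable (\<lambda>j. \<sigma> j powr 1)"
          "\<forall>D. (\<forall>a n. (\<Prod>j<n. (a * \<sigma> j)\<^sup>2) \<le> D a) \<longrightarrow> (\<lambda>a. 1 / 2 * ln (D a)) \<notin> O[at_top](g)"
        by (elim exE conjE) (rule that)
      from model[OF \<sigma>(1,2) \<sigma>(3)[rule_format]] obtain X and W :: "nat \<Rightarrow> ('h, 'n) block_op"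
        where XW: "depth_model idx r X W" "W r \<noteq> 0"
          "\<forall>p. schatten p (W r) \<longleftrightarrow> summable (\<lambda>j. \<sigma> j powr p)"
          "trace_class (W r) \<longrightarrow> (\<forall>a n. (\<Prod>j<n. (a * \<sigma> j)\<^sup>2)
            \<le> Re (fredholm_det (complex_of_real (a\<^sup>2) *\<^sub>C (adj (W r) o\<^sub>C\<^sub>L W r))))"
        by (elim exE conjE) (rule that)
      have tc: "trace_class (W r)" using XW(3) \<sigma>(4) by simp
      have "fredholm_growth (W r) \<notin> O[at_top](g)"
        unfolding fredholm_growth_def[abs_def]
        by (rule \<sigma>(5)[rule_format]) (rule XW(4)[rule_format, OF tc])
      with XW(1,2) tc
      show "\<exists>X W :: nat \<Rightarrow> ('h, 'n) block_op. depth_model idx r X W \<and> W r \<noteq> 0 \<and>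
          trace_class (W r) \<and> fredholm_growth (W r) \<notin> O[at_top](g)" by (intro exI conjI)
    qed
  qed
  moreover have ?triangular
  proof (intro allI impI)
    fix D R :: "('h, 'n) block_op" and z
    assume "trace_class D \<and> trace_class R \<and> (\<forall>i k. i \<noteq> k \<longrightarrow> block D i k = 0) \<and>
          ((\<forall>i\<le>r. \<forall>k\<le>r. i \<le> k \<longrightarrow> block R (idx i) (idx k) = 0) \<or>
           (\<forall>i\<le>r. \<forall>k\<le>r. k \<le> i \<longrightarrow> block R (idx i) (idx k) = 0))"
    then show "fredholm_det (z *\<^sub>C (D + R)) = (\<Prod>j=0..r. fredholm_det (z *\<^sub>C block D (idx j) (idx j)))"
      by (intro fredholm_det_triangular_perturbation[OF idx]) auto
  qed
  ultimately show ?thesis by (intro conjI)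
qed

end
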